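(* Let $N\geq 1$, $0<s<1$ and $p\geq 2$. For all $u\in \dot{W}^s_p(\mathbb{R}^N)$ in case $p < N/s$, and for all $u\in \dot{W}^s_p(\mathbb{R}^N\setminus\{0\})$ in case $p > N/s$, with $v(x)=|x|^{(N-ps)/p} u(x)$, \[ \iint_{\mathbb{R}^N\times\mathbb{R}^N} \frac{|u(x)-u(y)|^p}{|x-y|^{N+ps} } \,dx\,dy - \mathcal C_{N,s,p} \int_{\mathbb{R}^N} \frac{|u(x)|^p}{|x|^{ps}}\,dx \geq c_p\, \iint_{\mathbb{R}^N\times\mathbb{R}^N} \frac{|v(x)-v(y)|^p}{|x-y|^{N+ps} } \frac{dx}{|x|^{(N-ps)/2}} \frac{dy}{|y|^{(N-ps)/2}}, \] where $\mathcal C_{N,s,p} := 2 \int_0^1 r^{ps-1} |1 - r^{(N-ps)/p} |^p \Phi_{N,s,p}(r) \, dr$ and \[ c_p:=\min_{0<\tau<1/2} \left((1-\tau)^p -\tau^p + p\tau^{p-1}\right) \] satisfies $0<c_p\leq 1$. If $p=2$, the inequality is an equality with $c_2=1$.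
   Context: $\Phi_{N,s,p}(r) := |\mathbb{S}^{N-2}| \int_{-1}^1 (1-t^2)^{(N-3)/2} (1-2rt+r^2)^{-(N+ps)/2}\,dt$ for $N\geq 2$ and $\Phi_{1,s,p}(r) := (1-r)^{-1-ps} + (1+r)^{-1-ps}$ for $N=1$, where $|\mathbb{S}^{N-2}|$ is the surface area of the unit sphere in $\mathbb{R}^{N-1}$. $\dot{W}^s_p(\mathbb{R}^N)$ (for $p<N/s$) is the completion of $C_0^\infty(\mathbb{R}^N)$, and $\dot{W}^s_p(\mathbb{R}^N\setminus\{0\})$ (for $p>N/s$) the completion of $C_0^\infty(\mathbb{R}^N\setminus\{0\})$, with respect to $\left(\iint |u(x)-u(y)|^p|x-y|^{-N-ps}\,dx\,dy\right)^{1/p}$; elements are identified with functions. *)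

theory Defs
  imports "HOL-Analysis.Analysis"
begin

text \<open>Infinitely differentiable real-valued functions on a Euclidean space:
  differentiable everywhere, and all partial derivatives are again smooth
  (greatest fixed point, i.e. derivatives of every order exist).\<close>
coinductive smooth_fun :: "('a::euclidean_space \<Rightarrow> real) \<Rightarrow> bool" where
  "f differentiable_on UNIV \<Longrightarrow>
   (\<forall>i\<in>Basis. smooth_fun (\<lambda>x. frechet_derivative f (at x) i)) \<Longrightarrow> smooth_fun f"

definition Cc_infty :: "('a::euclidean_space \<Rightarrow> real) set" where
  "Cc_infty = {f. smooth_fun f \<and> compact (closure {x. f x \<noteq> 0})}"

definition Cc_infty_punct :: "('a::euclidean_space \<Rightarrow> real) set" where
  "Cc_infty_punct = {f. f \<in> Cc_infty \<and> 0 \<notin> closure {x. f x \<noteq> 0}}"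

definition gagliardo :: "real \<Rightarrow> real \<Rightarrow> ('a::euclidean_space \<Rightarrow> real) \<Rightarrow> ennreal" where
  "gagliardo s p u =
     (\<integral>\<^sup>+ x. \<integral>\<^sup>+ y. ennreal (\<bar>u x - u y\<bar> powr p / norm (x - y) powr (real DIM('a) + p * s))
        \<partial>lebesgue \<partial>lebesgue)"

text \<open>Completion of a class of test functions w.r.t. the Gagliardo seminorm, with
  elements identified with functions: u is the a.e. limit of test functions
  phi_k which converge to u in the Gagliardo seminorm.\<close>
definition hom_frac_sobolev :: "real \<Rightarrow> real \<Rightarrow> ('a::euclidean_space \<Rightarrow> real) set \<Rightarrow> ('a \<Rightarrow> real) set" where
  "hom_frac_sobolev s p T =
     {u. u \<in> borel_measurable lebesgue \<and>
         (\<exists>\<phi>::nat \<Rightarrow> 'a \<Rightarrow> real. (\<forall>k. \<phi> k \<in> T) \<and>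
            (AE x in lebesgue. (\<lambda>k. \<phi> k x) \<longlonglongrightarrow> u x) \<and>
            (\<lambda>k. gagliardo s p (\<lambda>x. u x - \<phi> k x)) \<longlonglongrightarrow> 0)}"

text \<open>Surface area of the unit sphere S^(N-2) in R^(N-1), N >= 2.\<close>
definition sphere_area :: "nat \<Rightarrow> real" where
  "sphere_area N = 2 * pi powr ((real N - 1) / 2) / Gamma ((real N - 1) / 2)"

definition Phi :: "nat \<Rightarrow> real \<Rightarrow> real \<Rightarrow> real \<Rightarrow> real" where
  "Phi N s p r =
    (if N = 1 then (1 - r) powr (-1 - p * s) + (1 + r) powr (-1 - p * s)
     else sphere_area N *
       (LBINT t=-1..1. (1 - t\<^sup>2) powr ((real N - 3) / 2) *
                        (1 - 2 * r * t + r\<^sup>2) powr (- (real N + p * s) / 2)))"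

definition hardy_const :: "nat \<Rightarrow> real \<Rightarrow> real \<Rightarrow> real" where
  "hardy_const N s p =
    2 * (LBINT r=0..1. r powr (p * s - 1) * \<bar>1 - r powr ((real N - p * s) / p)\<bar> powr p * Phi N s p r)"

definition cp_fun :: "real \<Rightarrow> real \<Rightarrow> real" where
  "cp_fun p \<tau> = (1 - \<tau>) powr p - \<tau> powr p + p * \<tau> powr (p - 1)"

definition c_p :: "real \<Rightarrow> real" where
  "c_p p = (INF \<tau>\<in>{0<..<1/2}. cp_fun p \<tau>)"

end

theory Submission
  imports Defs
begin

text \<open>
  Write \<open>u = \<omega> v\<close> with \<open>\<omega>(x) = |x|\<^sup>-\<^sup>\<alpha>\<close> and \<open>\<alpha> = (N - ps)/p\<close>. A pointwise inequality bounds
  \<open>|u(x) - u(y)|\<^sup>p\<close> from below by \<open>c\<^sub>p (\<omega>(x) \<omega>(y))\<^sup>p\<^sup>/\<^sup>2 |v(x) - v(y)|\<^sup>p\<close> plus a difference of a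
  multiple of \<open>|u(x)|\<^sup>p\<close> and a multiple of \<open>|u(y)|\<^sup>p\<close>, with equality for \<open>p = 2\<close>. Against the kernel
  \<open>|x - y|\<^sup>-\<^sup>N\<^sup>-\<^sup>p\<^sup>s\<close> each of these multiples has a non-integrable singularity on \<open>|x| = |y|\<close>, so the
  integration is first restricted to the scale-invariant region \<open>|y| < \<theta> |x|\<close> with \<open>\<theta> < 1\<close>. There both
  terms are exact multiples of \<open>\<integral> |u|\<^sup>p |x|\<^sup>-\<^sup>p\<^sup>s\<close>, the difference of the two coefficients is
  \<open>\<integral>\<^sub>0\<^sup>\<theta> r\<^sup>p\<^sup>s\<^sup>-\<^sup>1 |1 - r\<^sup>\<alpha>|\<^sup>p \<Phi>(r) dr\<close> by the symmetry \<open>\<Phi>(1/r) = r\<^sup>N\<^sup>+\<^sup>p\<^sup>s \<Phi>(r)\<close>, and monotone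
  convergence as \<open>\<theta> \<rightarrow> 1\<close> gives the claim whenever \<open>\<integral> |u|\<^sup>p |x|\<^sup>-\<^sup>p\<^sup>s\<close> is finite. Finiteness holds for
  test functions and passes to the completion by Fatou's lemma.
\<close>


subsection \<open>The constant \<open>c\<^sub>p\<close>\<close>

text \<open>Let t in (0,1) be the ratio of the smaller to the larger of the two values \<omega>(x),
  \<omega>(y). By homogeneity the pointwise inequality bounds from below the gap in Jensen's
  inequality for |.|^p at the points z, z + t, z + 1, by c_p (1 - t) t^(p/2). As t tends to 1, the
  gap divided by 1 - t tends to \<open>cp_fun p (z + 1)\<close> for z in [-1,0]. This is the origin
  of \<open>c_p\<close>; the work lies in showing that smaller t and other z do no worse.

  The multiples of |u(x)|^p and |u(y)|^p are dictated by \<omega>: they are |\<omega>(x) -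
  \<omega>(y)|^(p-1) divided by \<omega>(x)^(p-1) or \<omega>(y)^(p-1), with opposite signs, so that
  constant v gives equality. Integrated in the other variable they form the p-Laplace type operator
  applied to \<omega>, which yields the Hardy potential.

  Identities are therefore kept as equalities of sums, and a summand is cancelled only once it is
  known to be finite. Both the truncation and the finiteness of the Hardy integral serve this
  cancellation.\<close>

lemma powr_strict_tangent:
  fixes x y q :: real
  assumes "0 < x" "0 < y" "x \<noteq> y" "1 < q"
  shows "x powr q + q * x powr (q - 1) * (y - x) < y powr q"
proof (cases "x < y")
  case True
  have "\<And>z. x \<le> z \<Longrightarrow> z \<le> y \<Longrightarrow> ((\<lambda>z. z powr q) has_real_derivative q * z powr (q - 1)) (at z)"
    using assms by (auto intro!: derivative_eq_intros)
  from MVT2[OF True this] obtain z where z: "x < z" "z < y"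
    "y powr q - x powr q = (y - x) * (q * z powr (q - 1))" by blast
  have "x powr (q - 1) < z powr (q - 1)" using z assms by (intro powr_less_mono2) auto
  then have "(y - x) * (q * x powr (q - 1)) < (y - x) * (q * z powr (q - 1))"
    using True assms by (intro mult_strict_left_mono) auto
  with z(3) show ?thesis by (simp add: algebra_simps)
next
  case False
  then have lt: "y < x" using assms by simp
  have "\<And>z. y \<le> z \<Longrightarrow> z \<le> x \<Longrightarrow> ((\<lambda>z. z powr q) has_real_derivative q * z powr (q - 1)) (at z)"
    using assms by (auto intro!: derivative_eq_intros)
  from MVT2[OF lt this] obtain z where z: "y < z" "z < x"
    "x powr q - y powr q = (x - y) * (q * z powr (q - 1))" by blast
  have "z powr (q - 1) < x powr (q - 1)" using z assms by (intro powr_less_mono2) auto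
  then have "(x - y) * (q * z powr (q - 1)) < (x - y) * (q * x powr (q - 1))"
    using lt assms by (intro mult_strict_left_mono) auto
  with z(3) show ?thesis by (simp add: algebra_simps)
qed

lemma continuous_on_cp_fun:
  assumes "2 \<le> p" shows "continuous_on {0..1} (cp_fun p)"
  unfolding cp_fun_def using assms by (intro continuous_intros continuous_on_powr') auto

lemma cp_fun_two: "0 \<le> \<tau> \<Longrightarrow> \<tau> \<le> 1 \<Longrightarrow> cp_fun 2 \<tau> = 1"
  by (cases "\<tau> = 0"; cases "\<tau> = 1") (auto simp: cp_fun_def power2_eq_square algebra_simps)

lemma cp_fun_has_derivative:
  assumes "0 < \<tau>" "\<tau> < 1"
  shows "(cp_fun p has_real_derivative
    p * ((p - 1) * \<tau> powr (p - 2) - \<tau> powr (p - 1) - (1 - \<tau>) powr (p - 1))) (at \<tau>)"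
  unfolding cp_fun_def[abs_def] using assms
  by (auto intro!: derivative_eq_intros simp: algebra_simps)

text \<open>On this range 1 - \<tau> is at most \<tau>, so the two subtracted powers together are at
  most \<tau>^(p-2). The bound serves twice: for p > 2 its strict sign at 1/2 keeps the minimiser
  off that endpoint, and monotonicity beyond 1/2 extends the lower bound \<open>c_p\<close> to
  [0,1].\<close>

lemma cp_fun_deriv_pos:
  fixes p \<tau> :: real
  assumes p: "2 \<le> p" and \<tau>: "1 / 2 \<le> \<tau>" "\<tau> < 1"
  shows "p * (p - 2) * \<tau> powr (p - 2) \<le>
    p * ((p - 1) * \<tau> powr (p - 2) - \<tau> powr (p - 1) - (1 - \<tau>) powr (p - 1))"
proof -
  have "(1 - \<tau>) powr (p - 2) \<le> \<tau> powr (p - 2)" using assms by (intro powr_mono2) auto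
  then have "(1 - \<tau>) * (1 - \<tau>) powr (p - 2) \<le> (1 - \<tau>) * \<tau> powr (p - 2)"
    using \<tau> by (intro mult_left_mono) auto
  moreover have "(1 - \<tau>) powr (p - 1) = (1 - \<tau>) * (1 - \<tau>) powr (p - 2)"
    "\<tau> powr (p - 1) = \<tau> * \<tau> powr (p - 2)"
    using \<tau> by (simp_all add: powr_mult_base)
  ultimately have "(1 - \<tau>) powr (p - 1) + \<tau> powr (p - 1) \<le> \<tau> powr (p - 2)"
    by (simp add: algebra_simps)
  then have "(p - 2) * \<tau> powr (p - 2) \<le> (p - 1) * \<tau> powr (p - 2) - \<tau> powr (p - 1) - (1 - \<tau>) powr (p - 1)"
    by (simp add: algebra_simps)
  then have "p * ((p - 2) * \<tau> powr (p - 2)) \<le> p * ((p - 1) * \<tau> powr (p - 2) - \<tau> powr (p - 1) - (1 - \<tau>) powr (p - 1))"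
    using p by (intro mult_left_mono) auto
  then show ?thesis by (simp only: mult.assoc)
qed

text \<open>The infimum in \<open>c_p\<close> runs over an open interval, so the minimiser on
  [0,1/2] has to be kept off both endpoints. For p > 2 the function drops below its value 1 just to
  the right of 0 and increases at 1/2; for p = 2 it is constant.\<close>

lemma cp_fun_min_attained:
  assumes p: "2 \<le> p"
  obtains \<sigma> where "\<sigma> \<in> {0<..<1/2}" "\<And>\<tau>. \<tau> \<in> {0..1/2} \<Longrightarrow> cp_fun p \<sigma> \<le> cp_fun p \<tau>"
proof (cases "p = 2")
  case True
  with that[of "1/4"] show ?thesis by (auto simp: cp_fun_two)
next
  case False
  with p have p2: "2 < p" by simp
  have "continuous_on {0..1/2} (cp_fun p)"
    by (rule continuous_on_subset[OF continuous_on_cp_fun[OF p]]) auto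
  then obtain \<sigma> where \<sigma>: "\<sigma> \<in> {0..1/2}" "\<And>\<tau>. \<tau> \<in> {0..1/2} \<Longrightarrow> cp_fun p \<sigma> \<le> cp_fun p \<tau>"
    using continuous_attains_inf[of "{0..1/2::real}" "cp_fun p"] by auto
  have "\<sigma> \<noteq> 0"
  proof
    assume "\<sigma> = 0"
    \<comment> \<open>Chosen so that p \<tau>^(p-2) is at most 1/2: then p \<tau>^(p-1) is below
      \<tau>, while (1 - \<tau>)^p has already lost at least \<tau> against 1.\<close>
    define \<tau> where "\<tau> = min (1/2) ((1 / (2 * p)) powr (1 / (p - 2)))"
    have \<tau>: "0 < \<tau>" "\<tau> \<le> 1/2" using p2 by (auto simp: \<tau>_def)
    have "\<tau> powr (p - 2) \<le> ((1 / (2 * p)) powr (1 / (p - 2))) powr (p - 2)"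
      using \<tau> p2 by (intro powr_mono2) (auto simp: \<tau>_def)
    also have "\<dots> = 1 / (2 * p)" using p2 by (simp add: powr_powr)
    finally have "p * \<tau> powr (p - 2) < 1" using p2 by (simp add: field_simps)
    then have "\<tau> * (p * \<tau> powr (p - 2)) < \<tau> * 1" using \<tau> by (intro mult_strict_left_mono)
    moreover have "\<tau> powr (p - 1) = \<tau> * \<tau> powr (p - 2)" using \<tau> by (simp add: powr_mult_base)
    ultimately have "p * \<tau> powr (p - 1) < \<tau>" by (simp add: mult_ac)
    moreover have "(1 - \<tau>) powr p \<le> 1 - \<tau>" using \<tau> p2 powr_mono'[of 1 p "1 - \<tau>"] by auto
    moreover have "0 \<le> \<tau> powr p" by simp
    ultimately have "cp_fun p \<tau> < 1" using \<tau> unfolding cp_fun_def by linarith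
    moreover have "cp_fun p 0 = 1" by (simp add: cp_fun_def)
    ultimately show False using \<sigma>(2)[of \<tau>] \<tau> \<open>\<sigma> = 0\<close> by auto
  qed
  moreover have "\<sigma> \<noteq> 1/2"
  proof
    assume eq: "\<sigma> = 1/2"
    have "0 < p * (p - 2) * (1/2) powr (p - 2)" using p2 by simp
    with cp_fun_deriv_pos[OF p, of "1/2"]
    have "0 < p * ((p - 1) * (1/2) powr (p - 2) - (1/2) powr (p - 1) - (1 - 1/2) powr (p - 1))"
      by linarith
    from DERIV_pos_inc_left[OF cp_fun_has_derivative this] obtain d where
      d: "d > 0" "\<And>h. h > 0 \<Longrightarrow> h < d \<Longrightarrow> cp_fun p (1/2 - h) < cp_fun p (1/2)" by auto
    have "cp_fun p (1/2 - min (1/4) (d/2)) < cp_fun p (1/2)"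
      using d(1) by (intro d(2)) auto
    moreover have "cp_fun p (1/2) \<le> cp_fun p (1/2 - min (1/4) (d/2))"
      using \<sigma>(2)[of "1/2 - min (1/4) (d/2)"] eq d(1) by auto
    ultimately show False by simp
  qed
  ultimately show ?thesis using that[of \<sigma>] \<sigma> by auto
qed

lemma c_p_attained:
  assumes p: "2 \<le> p"
  obtains \<sigma> where "\<sigma> \<in> {0<..<1/2}" "cp_fun p \<sigma> = c_p p" "\<forall>\<tau>\<in>{0..1/2}. c_p p \<le> cp_fun p \<tau>"
proof -
  obtain \<sigma> where \<sigma>: "\<sigma> \<in> {0<..<1/2}" "\<And>\<tau>. \<tau> \<in> {0..1/2} \<Longrightarrow> cp_fun p \<sigma> \<le> cp_fun p \<tau>"
    using cp_fun_min_attained[OF p] by blast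
  have "c_p p = cp_fun p \<sigma>"
    unfolding c_p_def by (rule cInf_eq_minimum) (use \<sigma> in auto)
  with \<sigma> that show ?thesis by auto
qed

text \<open>The pointwise inequality evaluates \<open>cp_fun\<close> at z + 1 for every z in [-1,0],
  hence on the whole unit interval and not only on the half over which \<open>c_p\<close> is
  taken.\<close>

lemma c_p_le_cp_fun:
  assumes p: "2 \<le> p" and \<tau>: "0 \<le> \<tau>" "\<tau> \<le> 1"
  shows "c_p p \<le> cp_fun p \<tau>"
proof -
  have le: "\<forall>\<tau>\<in>{0..1/2}. c_p p \<le> cp_fun p \<tau>" by (rule c_p_attained[OF p])
  show ?thesis
  proof (cases "\<tau> \<le> 1/2")
    case True then show ?thesis using le \<tau> by simp
  next
    case False
    have "cp_fun p (1/2) \<le> cp_fun p \<tau>"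
    proof (rule DERIV_nonneg_imp_increasing_open[of "1/2" \<tau>])
      show "1/2 \<le> \<tau>" using False by simp
      show "continuous_on {1/2..\<tau>} (cp_fun p)"
        by (rule continuous_on_subset[OF continuous_on_cp_fun[OF p]]) (use \<tau> in auto)
      fix x assume x: "1/2 < x" "x < \<tau>"
      have "0 \<le> p * (p - 2) * x powr (p - 2)" using p by simp
      with cp_fun_deriv_pos[OF p, of x] cp_fun_has_derivative[of x p] x \<tau>
      show "\<exists>y. (cp_fun p has_real_derivative y) (at x) \<and> 0 \<le> y" by fastforce
    qed
    with bspec[OF le, of "1/2"] show ?thesis by simp
  qed
qed

lemma c_p_le_one: "2 \<le> p \<Longrightarrow> c_p p \<le> 1"
  using c_p_le_cp_fun[of p 0] by (simp add: cp_fun_def)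

lemma c_p_pos:
  assumes p: "2 \<le> p" shows "0 < c_p p"
proof -
  obtain \<sigma> where \<sigma>: "\<sigma> \<in> {0<..<1/2}" "cp_fun p \<sigma> = c_p p" using c_p_attained[OF p] by blast
  have "\<sigma> powr p < (1 - \<sigma>) powr p" using \<sigma> p by (intro powr_less_mono2) auto
  moreover have "0 \<le> p * \<sigma> powr (p - 1)" using p by simp
  ultimately show ?thesis using \<sigma>(2) unfolding cp_fun_def by linarith
qed

lemma c_p_two: "c_p 2 = 1"
proof -
  obtain \<sigma> where \<sigma>: "\<sigma> \<in> {0<..<1/2}" "cp_fun 2 \<sigma> = c_p 2" using c_p_attained[of 2] by auto
  then show ?thesis using cp_fun_two[of \<sigma>] by auto
qed


subsection \<open>The pointwise inequality\<close>

text \<open>Odd extension of z^q from the positive axis; for q = p - 1 it is the derivative of |z|^p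
  divided by p.\<close>

definition signed_powr :: "real \<Rightarrow> real \<Rightarrow> real" where
  "signed_powr z q = z * \<bar>z\<bar> powr (q - 1)"

lemma signed_powr_nonneg: "0 \<le> z \<Longrightarrow> signed_powr z q = z powr q"
  by (cases "z = 0") (auto simp: signed_powr_def powr_mult_base)

lemma signed_powr_minus: "signed_powr (- z) q = - signed_powr z q"
  by (simp add: signed_powr_def)

lemma abs_powr_eq_signed_powr: "\<bar>z\<bar> powr p = z * signed_powr z (p - 1)"
proof (cases "z = 0")
  case False
  have "\<bar>z\<bar> powr p = \<bar>z\<bar> powr (2 + (p - 2))" by simp
  also have "\<dots> = \<bar>z\<bar> powr 2 * \<bar>z\<bar> powr (p - 2)" by (rule powr_add)
  also have "\<bar>z\<bar> powr 2 = z * z" using False by (simp add: power2_eq_square)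
  finally show ?thesis by (simp add: signed_powr_def algebra_simps)
qed (simp add: signed_powr_def)

lemma continuous_on_signed_powr:
  "1 < q \<Longrightarrow> continuous_on S (\<lambda>z. signed_powr z q)"
  unfolding signed_powr_def by (intro continuous_intros continuous_on_powr') auto

lemma abs_powr_has_derivative:
  fixes z p :: real
  assumes p: "1 < p"
  shows "((\<lambda>z. \<bar>z\<bar> powr p) has_real_derivative p * signed_powr z (p - 1)) (at z)"
proof -
  consider "z = 0" | "z > 0" | "z < 0" by linarith
  then show ?thesis
  proof cases
    case 1
    have "((\<lambda>h. \<bar>h\<bar> powr p / h) \<longlongrightarrow> 0) (at 0)"
    proof (rule Lim_null_comparison)
      show "\<forall>\<^sub>F h in at (0::real). norm (\<bar>h\<bar> powr p / h) \<le> \<bar>h\<bar> powr (p - 1)"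
        by (auto simp: eventually_at_filter powr_diff divide_simps intro!: always_eventually)
      show "((\<lambda>h::real. \<bar>h\<bar> powr (p - 1)) \<longlongrightarrow> 0) (at 0)"
        using p by (auto intro!: tendsto_eq_intros)
    qed
    then show ?thesis using 1 by (simp add: DERIV_def signed_powr_def)
  next
    case 2
    have "((\<lambda>z. z powr p) has_real_derivative p * signed_powr z (p - 1)) (at z)"
      using 2 by (auto intro!: derivative_eq_intros simp: signed_powr_nonneg)
    moreover have ev: "\<forall>\<^sub>F x in nhds z. x powr p = \<bar>x\<bar> powr p"
      using eventually_nhds_in_open[of "{0<..}" z] 2 by (auto elim!: eventually_mono)
    ultimately show ?thesis using DERIV_cong_ev[OF refl ev refl] by simp
  next
    case 3
    have "((\<lambda>z. (- z) powr p) has_real_derivative p * signed_powr z (p - 1)) (at z)"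
      using 3 signed_powr_minus[of "- z" "p - 1"]
      by (auto intro!: derivative_eq_intros simp: signed_powr_nonneg)
    moreover have ev: "\<forall>\<^sub>F x in nhds z. (- x) powr p = \<bar>x\<bar> powr p"
      using eventually_nhds_in_open[of "{..<0}" z] 3 by (auto elim!: eventually_mono)
    ultimately show ?thesis using DERIV_cong_ev[OF refl ev refl] by simp
  qed
qed

lemma powr_tangent:
  fixes x y q :: real
  assumes "0 < x" "0 \<le> y" "1 < q"
  shows "x powr q + q * x powr (q - 1) * (y - x) \<le> y powr q"
proof (cases "y = 0")
  case True
  have "x powr q = x * x powr (q - 1)" using assms by (simp add: powr_mult_base)
  then have "x powr q + q * x powr (q - 1) * (0 - x) = (1 - q) * x powr q" by (simp add: algebra_simps)
  also have "\<dots> \<le> 0" using assms by (simp add: mult_nonpos_nonneg)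
  finally show ?thesis using True by simp
next
  case False
  then show ?thesis using powr_strict_tangent[of x y q] assms by (cases "x = y") auto
qed

text \<open>z + t is the mean of z and z + 1 with weights 1 - t and t, so this is the gap in
  Jensen's inequality for |.|^p, the distance of the two points being normalised to 1.\<close>

definition jensen_gap :: "real \<Rightarrow> real \<Rightarrow> real \<Rightarrow> real" where
  "jensen_gap p z t = (1 - t) * \<bar>z\<bar> powr p + t * \<bar>z + 1\<bar> powr p - \<bar>z + t\<bar> powr p"

lemma jensen_gap_has_derivative_left:
  assumes "1 < p"
  shows "((\<lambda>z. jensen_gap p z t) has_real_derivative
    p * ((1 - t) * signed_powr z (p - 1) + t * signed_powr (z + 1) (p - 1) - signed_powr (z + t) (p - 1))) (at z)"
  unfolding jensen_gap_def
  by (rule derivative_eq_intros refl abs_powr_has_derivative[OF assms, THEN DERIV_chain2] |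
      simp add: algebra_simps)+

lemma jensen_gap_has_derivative_right:
  assumes "1 < p"
  shows "((\<lambda>t. jensen_gap p z t) has_real_derivative
    \<bar>z + 1\<bar> powr p - \<bar>z\<bar> powr p - p * signed_powr (z + t) (p - 1)) (at t)"
  unfolding jensen_gap_def
  by (rule derivative_eq_intros refl abs_powr_has_derivative[OF assms, THEN DERIV_chain2] |
      simp add: algebra_simps)+

lemma jensen_gap_reflect: "jensen_gap p z t = jensen_gap p (- 1 - z) (1 - t)"
proof -
  have "\<bar>- 1 - z + 1\<bar> = \<bar>z\<bar>" "\<bar>- 1 - z\<bar> = \<bar>z + 1\<bar>" "\<bar>- 1 - z + (1 - t)\<bar> = \<bar>z + t\<bar>" by auto
  then show ?thesis by (simp add: jensen_gap_def)
qed

text \<open>The derivative in z is p times the Jensen gap of x^(p-1), which is convex because p > 2.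
  So the gap increases on the positive axis and is at least its value at z = 0.\<close>

lemma jensen_gap_ge_right:
  assumes p: "2 < p" and t: "0 \<le> t" "t \<le> 1" and z: "0 \<le> z"
  shows "t - t powr p \<le> jensen_gap p z t"
proof -
  have "jensen_gap p 0 t \<le> jensen_gap p z t"
  proof (rule DERIV_nonneg_imp_increasing_open[OF z])
    show "continuous_on {0..z} (\<lambda>z. jensen_gap p z t)"
      unfolding jensen_gap_def using p by (intro continuous_intros continuous_on_powr') auto
    fix x :: real assume x: "0 < x" "x < z"
    have "x powr (p - 1) \<ge> (x + t) powr (p - 1) + (p - 1) * (x + t) powr (p - 1 - 1) * (x - (x + t))"
      "(x + 1) powr (p - 1) \<ge> (x + t) powr (p - 1) + (p - 1) * (x + t) powr (p - 1 - 1) * (x + 1 - (x + t))"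
      using p t x by (intro powr_tangent; simp)+
    then have "(1 - t) * x powr (p - 1) + t * (x + 1) powr (p - 1) \<ge>
      (1 - t) * ((x + t) powr (p - 1) + (p - 1) * (x + t) powr (p - 1 - 1) * (x - (x + t))) +
      t * ((x + t) powr (p - 1) + (p - 1) * (x + t) powr (p - 1 - 1) * (x + 1 - (x + t)))"
      using t by (intro add_mono mult_left_mono) auto
    also have "(1 - t) * ((x + t) powr (p - 1) + (p - 1) * (x + t) powr (p - 1 - 1) * (x - (x + t))) +
      t * ((x + t) powr (p - 1) + (p - 1) * (x + t) powr (p - 1 - 1) * (x + 1 - (x + t))) = (x + t) powr (p - 1)"
      by (simp add: algebra_simps)
    finally have "0 \<le> p * ((1 - t) * signed_powr x (p - 1) + t * signed_powr (x + 1) (p - 1) - signed_powr (x + t) (p - 1))"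
      using p x t by (simp add: signed_powr_nonneg)
    with jensen_gap_has_derivative_left[of p t x] p
    show "\<exists>y. ((\<lambda>z. jensen_gap p z t) has_real_derivative y) (at x) \<and> 0 \<le> y" by force
  qed
  then show ?thesis using t by (simp add: jensen_gap_def)
qed

lemma jensen_gap_ge_left:
  assumes p: "2 < p" and t: "0 \<le> t" "t \<le> 1" and z: "z \<le> - 1"
  shows "(1 - t) - (1 - t) powr p \<le> jensen_gap p z t"
  using jensen_gap_ge_right[of p "1 - t" "- 1 - z"] assms by (simp flip: jensen_gap_reflect)

text \<open>The left side is the integral of p \<open>signed_powr\<close> x (p - 1) over [w, v], the
  right side its trapezoid rule. For w \<ge> 0 the rule overestimates because the integrand is
  strictly convex. For w < 0 the right side without the factor p/2 is already larger than the left,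
  and p/2 > 1.\<close>

lemma trapezoid_strict:
  fixes p w v :: real
  assumes p: "2 < p" and w: "\<bar>w\<bar> < v"
  shows "v powr p - \<bar>w\<bar> powr p < p / 2 * (v - w) * (v powr (p - 1) + signed_powr w (p - 1))"
proof (cases "0 \<le> w")
  case True
  define D where "D = (\<lambda>w. p / 2 * (v - w) * (v powr (p - 1) + w powr (p - 1)) - v powr p + w powr p)"
  \<comment> \<open>\<open>D\<close> is the excess of the trapezoid rule and vanishes at
    \<open>v\<close>. Its derivative is p/2 times (tangent of the (p-1)-th power at x, evaluated at
    v, minus v^(p-1)), negative by strict convexity.\<close>
  have "D w > D v"
  proof (rule DERIV_neg_imp_decreasing_open[of w v])
    show "w < v" using w by simp
    show "continuous_on {w..v} D"
      unfolding D_def using p True by (intro continuous_intros continuous_on_powr') auto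
    fix x assume x: "w < x" "x < v"
    have "((\<lambda>w. c * (v - w) * (v powr (p - 1) + w powr (p - 1)) - v powr p + w powr p) has_real_derivative
      c * (- (v powr (p - 1) + x powr (p - 1)) + (v - x) * ((p - 1) * x powr (p - 2))) + p * x powr (p - 1)) (at x)" for c
      using x True by (auto intro!: derivative_eq_intros simp: algebra_simps)
    then have "(D has_real_derivative p / 2 * (- (v powr (p - 1) + x powr (p - 1)) + (v - x) * ((p - 1) * x powr (p - 2))) + p * x powr (p - 1)) (at x)"
      unfolding D_def by blast
    moreover have "p / 2 * (- (v powr (p - 1) + x powr (p - 1)) + (v - x) * ((p - 1) * x powr (p - 2))) + p * x powr (p - 1)
      = p / 2 * (x powr (p - 1) + (p - 1) * x powr (p - 1 - 1) * (v - x) - v powr (p - 1))"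
      by (simp add: algebra_simps)
    moreover have "x powr (p - 1) + (p - 1) * x powr (p - 1 - 1) * (v - x) < v powr (p - 1)"
      using x True p by (intro powr_strict_tangent) auto
    then have "p / 2 * (x powr (p - 1) + (p - 1) * x powr (p - 1 - 1) * (v - x) - v powr (p - 1)) < 0"
      using p by (intro mult_pos_neg) auto
    ultimately show "\<exists>y. (D has_real_derivative y) (at x) \<and> y < 0" by auto
  qed
  then show ?thesis using True by (simp add: D_def signed_powr_nonneg)
next
  case False
  define m where "m = - w"
  have m: "0 < m" "m < v" using False w by (auto simp: m_def)
  have "m powr (p - 1) < v powr (p - 1)" using m p by (intro powr_less_mono2) auto
  then have le: "(v + m) * (v powr (p - 1) - m powr (p - 1)) * 1 < (v + m) * (v powr (p - 1) - m powr (p - 1)) * (p / 2)"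
    using m p by (intro mult_strict_left_mono) auto
  have pw: "v powr p = v * v powr (p - 1)" "m powr p = m * m powr (p - 1)"
    "v powr (p - 1) = v * v powr (p - 2)" "m powr (p - 1) = m * m powr (p - 2)"
    using m by (simp_all add: powr_mult_base)
  have "m powr (p - 2) < v powr (p - 2)" using m p by (intro powr_less_mono2) auto
  then have "m * v * m powr (p - 2) < m * v * v powr (p - 2)" using m by (intro mult_strict_left_mono) auto
  then have "v powr p - m powr p < (v + m) * (v powr (p - 1) - m powr (p - 1))"
    unfolding pw(1,2) unfolding pw(3,4) by (simp add: algebra_simps)
  also have "\<dots> < p / 2 * (v + m) * (v powr (p - 1) - m powr (p - 1))" using le by (simp add: mult_ac)
  finally have "v powr p - m powr p < p / 2 * (v + m) * (v powr (p - 1) - m powr (p - 1))" .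
  moreover have w_eq: "signed_powr w (p - 1) = - (m powr (p - 1))" "\<bar>w\<bar> = m" "v - w = v + m"
    using signed_powr_minus[of m "p - 1"] m by (auto simp: m_def signed_powr_nonneg)
  ultimately show ?thesis unfolding w_eq by simp
qed

text \<open>At a critical point the chord of the signed power through \<open>z + t\<close> and \<open>z + 1\<close> passes through
  \<open>z\<close>; if \<open>z + t\<close> lay beyond \<open>-(z + 1)\<close>, the chord would be flatter than the tangent there.\<close>
lemma jensen_gap_critical_bound:
  fixes p z t :: real
  assumes p: "2 < p" and t: "0 < t" "t < 1" and z: "- 1 < z" "z < 0"
    and crit: "signed_powr (z + t) (p - 1) = (1 - t) * signed_powr z (p - 1) + t * signed_powr (z + 1) (p - 1)"
  shows "\<bar>z + t\<bar> < z + 1"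
proof (rule ccontr)
  assume neg: "\<not> \<bar>z + t\<bar> < z + 1"
  \<comment> \<open>Since z + t < z + 1, the bound can only fail through z + t \<le> -(z + 1), that
    is \<open>v \<le> m\<close>. The new variables make all three bases positive, with n = m + t and
    v + m = 1 - t.\<close>
  define n m v q where "n = - z" "m = - (z + t)" "v = z + 1" "q = p - 1"
  have nm: "0 < v" "v \<le> m" "n = m + t" "v + m = 1 - t" "0 < n" "1 < q" "0 < m"
    using neg t z p by (auto simp: n_m_v_q_def)
  have eq: "(1 - t) * n powr q = m powr q + t * v powr q"
  proof -
    have "signed_powr z q = - (n powr q)" "signed_powr (z + t) q = - (m powr q)" "signed_powr (z + 1) q = v powr q"
      using signed_powr_minus[of n q] signed_powr_minus[of m q] signed_powr_nonneg[of n q]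
        signed_powr_nonneg[of m q] signed_powr_nonneg[of v q] nm(1,5,7)
      by (simp_all add: n_m_v_q_def add.commute)
    with crit[folded n_m_v_q_def(4)] show ?thesis by algebra
  qed
  have "v powr (q - 1) \<le> m powr (q - 1)" using nm by (intro powr_mono2) auto
  then have "v * v powr (q - 1) \<le> v * m powr (q - 1)" using nm by (intro mult_left_mono) auto
  moreover have "v powr q = v * v powr (q - 1)" "m powr q = m * m powr (q - 1)"
    using nm by (simp_all add: powr_mult_base)
  ultimately have *: "v powr q + m powr q \<le> (1 - t) * m powr (q - 1)"
    by (simp flip: nm(4) add: algebra_simps)
  have "1 * ((1 - t) * m powr (q - 1)) < q * ((1 - t) * m powr (q - 1))"
    using nm t by (intro mult_strict_right_mono) auto
  with * have *: "v powr q + m powr q < q * ((1 - t) * m powr (q - 1))" by linarith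
  \<comment> \<open>The contradiction: criticality prescribes (1 - t) n^q = m^q + t v^q, but already
    the tangent at m, evaluated at n and multiplied by 1 - t, is larger than that.\<close>
  have "m powr q + t * v powr q = (1 - t) * m powr q + t * (v powr q + m powr q)" by (simp add: algebra_simps)
  also have "\<dots> < (1 - t) * m powr q + t * (q * ((1 - t) * m powr (q - 1)))"
    using * t by (intro add_strict_left_mono mult_strict_left_mono) auto
  also have "\<dots> = (1 - t) * (m powr q + q * m powr (q - 1) * (n - m))"
    by (simp add: nm(3) algebra_simps)
  also have "\<dots> \<le> (1 - t) * n powr q"
    using nm t by (intro mult_left_mono powr_tangent) auto
  finally show False using eq by simp
qed

text \<open>At a critical z the gap collapses to t (1 - t) (Y - X), where X and Y are the signed
  powers at z and z + 1. The numerator of the derivative in t is then, up to positive factors, the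
  exact integral minus the trapezoid rule over [z + t, z + 1], which is negative. The exponent p/2
  of t is what supplies the factor p/2 of that rule.\<close>

lemma jensen_gap_ratio_deriv_neg:
  fixes p z t :: real
  assumes p: "2 < p" and t: "0 < t" "t < 1" and z: "- 1 < z" "z < 0"
    and crit: "signed_powr (z + t) (p - 1) = (1 - t) * signed_powr z (p - 1) + t * signed_powr (z + 1) (p - 1)"
  obtains y where "((\<lambda>t. jensen_gap p z t / ((1 - t) * t powr (p / 2))) has_real_derivative y) (at t)" "y < 0"
proof -
  define X Y U where "X = signed_powr z (p - 1)" "Y = signed_powr (z + 1) (p - 1)" "U = signed_powr (z + t) (p - 1)"
  have U: "U = (1 - t) * X + t * Y" using crit by (simp add: X_Y_U_def)
  have f: "\<bar>z\<bar> powr p = z * X" "\<bar>z + 1\<bar> powr p = (z + 1) * Y" "\<bar>z + t\<bar> powr p = (z + t) * U"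
    unfolding X_Y_U_def by (rule abs_powr_eq_signed_powr)+
  define J where "J = \<bar>z + 1\<bar> powr p - \<bar>z\<bar> powr p - p * U"
  let ?e = "(p / 2)"
  have gap: "jensen_gap p z t = t * (1 - t) * (Y - X)"
    unfolding jensen_gap_def f U by (simp add: algebra_simps)
  have "\<bar>z + 1\<bar> powr p - \<bar>z + t\<bar> powr p < p / 2 * (1 - t) * (Y + U)"
    using trapezoid_strict[OF p jensen_gap_critical_bound[OF assms]] z
    by (simp add: X_Y_U_def signed_powr_nonneg)
  then have *: "(z + 1) * Y - (z + t) * U < p / 2 * (1 - t) * (Y + U)" by (simp add: f)
  have "(1 - t) * (J - (Y - X) * (- t + p / 2 * (1 - t))) = (z + 1) * Y - (z + t) * U - p / 2 * (1 - t) * (Y + U)"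
    unfolding J_def f U by (simp add: field_simps)
  with * have "(1 - t) * (J - (Y - X) * (- t + p / 2 * (1 - t))) < 0" by simp
  then have **: "J - (Y - X) * (- t + p / 2 * (1 - t)) < 0" using t by (simp add: mult_less_0_iff)
  have k: "t powr ?e = t * t powr (p / 2 - 1)" using t by (simp add: powr_mult_base)
  define y where "y = (J * ((1 - t) * t powr ?e) - jensen_gap p z t *
      (- (t powr ?e) + (1 - t) * (p / 2 * t powr (p / 2 - 1)))) / ((1 - t) * t powr ?e)\<^sup>2"
  have "((\<lambda>t. (1 - t) * t powr ?e) has_real_derivative
     (- (t powr ?e) + (1 - t) * (p / 2 * t powr (p / 2 - 1)))) (at t)"
    using t by (auto intro!: derivative_eq_intros)
  from DERIV_divide[OF jensen_gap_has_derivative_right this, of p z]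
  have D: "((\<lambda>t. jensen_gap p z t / ((1 - t) * t powr ?e)) has_real_derivative y) (at t)"
    using p t unfolding y_def J_def X_Y_U_def by (simp add: power2_eq_square)
  have gen: "J * ((1 - t) * (t * h)) - t * (1 - t) * (Y - X) * (- (t * h) + (1 - t) * (P * h))
     = (1 - t) * t * h * (J - (Y - X) * (- t + P * (1 - t)))" for h P by algebra
  have "J * ((1 - t) * t powr ?e) - jensen_gap p z t *
      (- (t powr ?e) + (1 - t) * (p / 2 * t powr (p / 2 - 1)))
     = (1 - t) * t * t powr (p / 2 - 1) * (J - (Y - X) * (- t + p / 2 * (1 - t)))"
    unfolding gap k by (rule gen)
  also have "\<dots> < 0" using ** t by (intro mult_pos_neg) auto
  finally have "y < 0" unfolding y_def using t by (intro divide_neg_pos) auto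
  with D that show ?thesis by blast
qed

lemma powr_le_base:
  fixes t q :: real
  shows "0 < t \<Longrightarrow> t \<le> 1 \<Longrightarrow> 1 \<le> q \<Longrightarrow> t powr q \<le> t"
  using powr_mono'[of 1 q t] by simp

text \<open>Here the constant 1 works, and \<open>c_p\<close> is at most 1. The endpoint values t -
  t^p and (1 - t) - (1 - t)^p both dominate t (1 - t), and t^(p/2) \<le> t.\<close>

lemma jensen_gap_ge_outside:
  fixes p z t :: real
  assumes p: "2 < p" and t: "0 < t" "t < 1" and z: "z \<le> - 1 \<or> 0 \<le> z"
  shows "(1 - t) * t powr (p / 2) \<le> jensen_gap p z t"
proof -
  have le: "t powr (p / 2) \<le> t" using t p by (intro powr_le_base) auto
  from z show ?thesis
  proof
    assume "z \<le> - 1"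
    have "(1 - t) powr (p - 1) \<le> 1 - t" using t p by (intro powr_le_base) auto
    then have "(1 - t) * t powr (p / 2) \<le> (1 - t) * (1 - (1 - t) powr (p - 1))"
      using le t by (intro mult_left_mono) auto
    also have "\<dots> = (1 - t) - (1 - t) powr p" using t by (simp add: powr_mult_base right_diff_distrib)
    also have "\<dots> \<le> jensen_gap p z t" using \<open>z \<le> - 1\<close> p t by (intro jensen_gap_ge_left) auto
    finally show ?thesis .
  next
    assume "0 \<le> z"
    have "t powr (p - 1) \<le> t" using t p by (intro powr_le_base) auto
    then have "(1 - t) * t powr (p / 2) \<le> (1 - t powr (p - 1)) * t"
      using le t by (intro mult_mono) auto
    also have "\<dots> = t - t powr p" using t by (simp add: powr_mult_base algebra_simps)
    also have "\<dots> \<le> jensen_gap p z t" using \<open>0 \<le> z\<close> p t by (intro jensen_gap_ge_right) auto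
    finally show ?thesis .
  qed
qed

lemma abs_powr_tangent:
  fixes x y p :: real
  assumes "1 < p"
  shows "\<bar>x\<bar> powr p + p * signed_powr x (p - 1) * (y - x) \<le> \<bar>y\<bar> powr p"
proof (cases "x = 0")
  case True
  then show ?thesis by (simp add: signed_powr_def)
next
  case False
  have "\<bar>x\<bar> powr p + p * \<bar>x\<bar> powr (p - 1) * (\<bar>y\<bar> - \<bar>x\<bar>) \<le> \<bar>y\<bar> powr p"
    using False assms by (intro powr_tangent) auto
  moreover have "signed_powr x (p - 1) = sgn x * \<bar>x\<bar> powr (p - 1)"
    using False powr_mult_base[of "\<bar>x\<bar>" "p - 2"] by (simp add: signed_powr_def) (metis mult.assoc sgn_mult_abs)
  moreover have "sgn x * (y - x) \<le> \<bar>y\<bar> - \<bar>x\<bar>" by (auto simp: sgn_if)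
  then have "p * \<bar>x\<bar> powr (p - 1) * (sgn x * (y - x)) \<le> p * \<bar>x\<bar> powr (p - 1) * (\<bar>y\<bar> - \<bar>x\<bar>)"
    using assms by (intro mult_left_mono) auto
  ultimately show ?thesis by (simp add: mult_ac)
qed

text \<open>The place where \<open>cp_fun\<close> enters. The tangent of |.|^p at z + t, evaluated
  at z + 1, shows that the gap is at least 1 - t times \<open>cp_fun p (z + 1)\<close>, up to
  replacing the slope at z + 1 by the slope at z + t. That error is small for t near 1.\<close>

lemma jensen_gap_ge_near_one:
  fixes p z t :: real
  assumes p: "2 < p" and t: "0 < t" "t < 1" and z: "- 1 \<le> z" "z \<le> 0"
  shows "(1 - t) * (c_p p - p * (signed_powr (z + 1) (p - 1) - signed_powr (z + t) (p - 1))) \<le> jensen_gap p z t"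
proof -
  have "c_p p \<le> cp_fun p (z + 1)" using p z by (intro c_p_le_cp_fun) auto
  also have "\<dots> = \<bar>z\<bar> powr p - \<bar>z + 1\<bar> powr p + p * signed_powr (z + 1) (p - 1)"
    using z by (simp add: cp_fun_def signed_powr_nonneg)
  finally have "(1 - t) * (c_p p - p * (signed_powr (z + 1) (p - 1) - signed_powr (z + t) (p - 1))) \<le>
    (1 - t) * (\<bar>z\<bar> powr p - \<bar>z + 1\<bar> powr p + p * signed_powr (z + t) (p - 1))"
    using t by (intro mult_left_mono) (auto simp: algebra_simps)
  also have "\<dots> \<le> jensen_gap p z t"
    using abs_powr_tangent[of p "z + t" "z + 1"] p by (simp add: jensen_gap_def algebra_simps)
  finally show ?thesis .
qed

text \<open>Suppose the ratio \<open>R\<close> of the two sides is below \<open>c\<^sub>p\<close> somewhere and minimise it over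
  \<open>[-1, 0] \<times> [t, T]\<close>. The minimum is critical in the first variable, so \<open>R\<close> strictly decreases in the
  second one there and the minimum sits at \<open>T\<close>; but \<open>R\<close> is at least about \<open>c\<^sub>p\<close> for \<open>T\<close> near 1.\<close>
lemma jensen_gap_ge:
  fixes p z t :: real
  assumes p: "2 < p" and t: "0 < t" "t < 1"
  shows "c_p p * ((1 - t) * t powr (p / 2)) \<le> jensen_gap p z t"
proof (cases "z \<le> - 1 \<or> 0 \<le> z")
  case True
  have "c_p p * ((1 - t) * t powr (p / 2)) \<le> 1 * ((1 - t) * t powr (p / 2))"
    using c_p_le_one[of p] p t by (intro mult_right_mono) auto
  with jensen_gap_ge_outside[OF p t True] show ?thesis by simp
next
  case False
  let ?F = "\<lambda>z. signed_powr z (p - 1)"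
  show ?thesis
  proof (rule ccontr)
    assume neg: "\<not> c_p p * ((1 - t) * t powr (p / 2)) \<le> jensen_gap p z t"
    define R where "R = (\<lambda>z t. jensen_gap p z t / ((1 - t) * t powr (p / 2)))"
    define \<eta> where "\<eta> = R z t"
    have \<eta>: "\<eta> < c_p p" using neg t by (simp add: \<eta>_def R_def divide_less_eq)
    have "uniformly_continuous_on {-1..1} ?F"
      using p by (intro compact_uniformly_continuous continuous_on_signed_powr) auto
    \<comment> \<open>Uniform continuity makes the slope error small for all z in [-1,0] at once.
      \<eta> is clipped at 0 because T^(p/2) \<le> 1 is going to be multiplied by it.\<close>
    moreover have "0 < (c_p p - max \<eta> 0) / p" using \<eta> c_p_pos[of p] p by auto
    ultimately obtain d where d: "d > 0" "\<And>x y. x \<in> {-1..1} \<Longrightarrow> y \<in> {-1..1} \<Longrightarrow> dist y x < d \<Longrightarrow>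
      dist (?F y) (?F x) < (c_p p - max \<eta> 0) / p"
      unfolding uniformly_continuous_on_def by meson
    \<comment> \<open>At least t, so that the offending point lies in the rectangle, and closer to 1
      than the modulus \<open>d\<close>.\<close>
    define T where "T = max t (1 - min (d/2) (1/2))"
    have T: "t \<le> T" "0 < T" "T < 1" "1 - T < d" using t d(1) by (auto simp: T_def)
    have at_T: "\<eta> < R y T" if y: "- 1 \<le> y" "y \<le> 0" for y
    proof -
      have "dist (?F (y + 1)) (?F (y + T)) < (c_p p - max \<eta> 0) / p"
        using y T by (intro d(2)) (auto simp: dist_real_def)
      then have "p * \<bar>?F (y + 1) - ?F (y + T)\<bar> < c_p p - max \<eta> 0"
        using p by (simp add: dist_real_def less_divide_eq mult.commute)
      moreover have "p * (?F (y + 1) - ?F (y + T)) \<le> p * \<bar>?F (y + 1) - ?F (y + T)\<bar>"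
        using p by (intro mult_left_mono) auto
      ultimately have "max \<eta> 0 < c_p p - p * (?F (y + 1) - ?F (y + T))"
        by linarith
      then have "(1 - T) * max \<eta> 0 < (1 - T) * (c_p p - p * (?F (y + 1) - ?F (y + T)))"
        using T by (intro mult_strict_left_mono) auto
      also have "\<dots> \<le> jensen_gap p y T" using p T y by (intro jensen_gap_ge_near_one) auto
      finally have "(1 - T) * max \<eta> 0 < jensen_gap p y T" .
      moreover have "(1 - T) * max \<eta> 0 * T powr (p / 2) \<le> (1 - T) * max \<eta> 0 * 1"
        using T powr_le_base[of T "p / 2"] p by (intro mult_left_mono) auto
      moreover have "\<eta> * ((1 - T) * T powr (p / 2)) \<le> max \<eta> 0 * ((1 - T) * T powr (p / 2))"
        using T by (intro mult_right_mono) auto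
      ultimately have "\<eta> * ((1 - T) * T powr (p / 2)) < jensen_gap p y T"
        by (simp add: mult_ac)
      then show ?thesis using T by (simp add: R_def less_divide_eq)
    qed
    have "continuous_on ({-1..0} \<times> {t..T}) (\<lambda>(z, t). R z t)"
      unfolding R_def jensen_gap_def case_prod_beta using p t T
      by (intro continuous_intros continuous_on_powr') auto
    moreover have "compact ({-1..0::real} \<times> {t..T})" "{-1..0::real} \<times> {t..T} \<noteq> {}"
      using T by (auto intro: compact_Times)
    ultimately have "\<exists>m\<in>{-1..0} \<times> {t..T}. \<forall>y\<in>{-1..0} \<times> {t..T}. (\<lambda>(z, t). R z t) m \<le> (\<lambda>(z, t). R z t) y"
      by (intro continuous_attains_inf)
    then obtain z1 t1 where z1: "- 1 \<le> z1" "z1 \<le> 0" and t1: "t \<le> t1" "t1 \<le> T"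
      and min: "\<And>y s. - 1 \<le> y \<Longrightarrow> y \<le> 0 \<Longrightarrow> t \<le> s \<Longrightarrow> s \<le> T \<Longrightarrow> R z1 t1 \<le> R y s"
      by auto
    have le: "R z1 t1 \<le> \<eta>" unfolding \<eta>_def using False T by (intro min) auto
    have t1': "0 < t1" "t1 < 1" using t1 t T by auto
    have "t1 < T" using at_T[OF z1] le t1 by (cases "t1 = T") auto
    \<comment> \<open>On the edges z = -1 and z = 0 the ratio is at least 1, which is at least
      \<open>c_p\<close> and hence above \<eta>; so the minimum is interior in z and
      critical.\<close>
    have "\<not> (z1 \<le> - 1 \<or> 0 \<le> z1)"
    proof
      assume "z1 \<le> - 1 \<or> 0 \<le> z1"
      from jensen_gap_ge_outside[OF p t1' this] have "1 \<le> R z1 t1"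
        using t1' by (simp add: R_def le_divide_eq)
      with le \<eta> c_p_le_one[of p] p show False by simp
    qed
    then have z1': "- 1 < z1" "z1 < 0" by auto
    have "((\<lambda>z. R z t1) has_real_derivative
      p * ((1 - t1) * ?F z1 + t1 * ?F (z1 + 1) - ?F (z1 + t1))
        / ((1 - t1) * t1 powr (p / 2))) (at z1)"
      unfolding R_def using p by (intro DERIV_cdivide jensen_gap_has_derivative_left) auto
    then have "p * ((1 - t1) * ?F z1 + t1 * ?F (z1 + 1) - ?F (z1 + t1))
        / ((1 - t1) * t1 powr (p / 2)) = 0"
    proof (rule DERIV_local_min)
      show "0 < min (z1 + 1) (- z1)" using z1' by simp
      show "\<forall>y. \<bar>z1 - y\<bar> < min (z1 + 1) (- z1) \<longrightarrow> R z1 t1 \<le> R y t1"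
        using t1 by (auto intro!: min)
    qed
    then have "?F (z1 + t1) = (1 - t1) * ?F z1 + t1 * ?F (z1 + 1)"
      using p t1' by simp
    from jensen_gap_ratio_deriv_neg[OF p t1' z1' this] obtain y
      where "(R z1 has_real_derivative y) (at t1)" "y < 0" unfolding R_def by blast
    from DERIV_neg_dec_right[OF this] obtain e where e: "e > 0"
      "\<And>h. h > 0 \<Longrightarrow> h < e \<Longrightarrow> R z1 (t1 + h) < R z1 t1" by auto
    define h where "h = min (e / 2) (T - t1)"
    have "R z1 (t1 + h) < R z1 t1" using e(1) \<open>t1 < T\<close> by (intro e(2)) (auto simp: h_def)
    moreover have "R z1 t1 \<le> R z1 (t1 + h)"
      using z1 t1 \<open>t1 < T\<close> e(1) by (intro min) (auto simp: h_def)
    ultimately show False by simp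
  qed
qed

text \<open>x is the value of u at the point where \<omega> is larger, y the value where it is
  smaller, and t the ratio of the two weights. Proportionality of u to \<omega> means y = t x, and
  then both sides agree. Otherwise division by |y/t - x|^p reduces the claim to
  \<open>jensen_gap_ge\<close>; for p = 2 it is an algebraic identity.\<close>

lemma ground_state_pointwise:
  fixes p t x y :: real
  assumes p: "2 \<le> p" and t: "0 < t" "t < 1"
  shows "(1 - t) powr (p - 1) * \<bar>x\<bar> powr p + c_p p * (t powr (p / 2) * \<bar>x - y / t\<bar> powr p)
    \<le> \<bar>x - y\<bar> powr p + ((1 - t) / t) powr (p - 1) * \<bar>y\<bar> powr p"
    (is ?le)
  and "p = 2 \<Longrightarrow> (1 - t) powr (p - 1) * \<bar>x\<bar> powr p + t powr (p / 2) * \<bar>x - y / t\<bar> powr p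
    = \<bar>x - y\<bar> powr p + ((1 - t) / t) powr (p - 1) * \<bar>y\<bar> powr p"
    (is "_ \<Longrightarrow> ?eq")
proof -
  show eq: ?eq if [simp]: "p = 2"
  proof -
    have "(1 - t) * x\<^sup>2 + t * (x - y / t)\<^sup>2 = (x - y)\<^sup>2 + (1 - t) / t * y\<^sup>2"
      using t by (simp add: field_simps power2_eq_square)
    then show ?thesis using t by (simp add: powr_numeral)
  qed
  show ?le
  proof (cases "p = 2")
    case True
    with eq show ?thesis by (simp add: c_p_two)
  next
    case False
    then have p2: "2 < p" using p by simp
    define D where "D = y / t - x"
    show ?thesis
    proof (cases "D = 0")
      case True
      then have y: "y = t * x" using t by (simp add: D_def field_simps)
      have "\<bar>x - y\<bar> powr p = ((1 - t) * \<bar>x\<bar>) powr p" using t by (simp add: y abs_mult flip: left_diff_distrib[of 1 t x, simplified])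
      also have "\<dots> = (1 - t) powr (p - 1) * ((1 - t) * \<bar>x\<bar> powr p)"
        using t by (simp add: powr_mult powr_mult_base flip: mult.assoc) (simp add: powr_mult_base mult.commute)
      finally have 1: "\<bar>x - y\<bar> powr p = (1 - t) powr (p - 1) * ((1 - t) * \<bar>x\<bar> powr p)" .
      have "t powr p = t * t powr (p - 1)" using t by (simp add: powr_mult_base)
      then have 2: "((1 - t) / t) powr (p - 1) * \<bar>y\<bar> powr p = (1 - t) powr (p - 1) * (t * \<bar>x\<bar> powr p)"
        using t by (simp add: y abs_mult powr_mult powr_divide)
      show ?thesis using t unfolding 1 2 by (simp add: y) (simp add: algebra_simps)
    next
      case False
      \<comment> \<open>With this z, the points z, z + 1 and z + t times D are x - y, (1 - t) y / t
        and (1 - t) x, exactly the three quantities in the claim. A common factor 1 - t is cancelled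
        at the end.\<close>
      define z where "z = (x - y) / D"
      have A: "z * D = x - y" "(z + 1) * D = (1 - t) / t * y" "(z + t) * D = (1 - t) * x"
        using False t by (simp_all add: z_def add_divide_eq_iff distrib_right) (simp_all add: D_def field_simps)
      have B: "\<bar>z\<bar> powr p * \<bar>D\<bar> powr p = \<bar>x - y\<bar> powr p"
        "\<bar>z + 1\<bar> powr p * \<bar>D\<bar> powr p = ((1 - t) / t) powr p * \<bar>y\<bar> powr p"
        "\<bar>z + t\<bar> powr p * \<bar>D\<bar> powr p = (1 - t) powr p * \<bar>x\<bar> powr p"
        using A[THEN arg_cong[where f="\<lambda>x. \<bar>x\<bar> powr p"]] t powr_mult[of "(1 - t) / t" "\<bar>y\<bar>" p]
        by (simp_all add: abs_mult powr_mult)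
      have "c_p p * ((1 - t) * t powr (p / 2)) * \<bar>D\<bar> powr p \<le> jensen_gap p z t * \<bar>D\<bar> powr p"
        using jensen_gap_ge[OF p2 t] by (intro mult_right_mono) auto
      also have "\<dots> = (1 - t) * \<bar>x - y\<bar> powr p + t * (((1 - t) / t) powr p * \<bar>y\<bar> powr p) - (1 - t) powr p * \<bar>x\<bar> powr p"
        unfolding jensen_gap_def B[symmetric] by (simp add: algebra_simps)
      also have "t * (((1 - t) / t) powr p * \<bar>y\<bar> powr p) = (1 - t) * (((1 - t) / t) powr (p - 1) * \<bar>y\<bar> powr p)"
      proof -
        have "((1 - t) / t) powr p = (1 - t) / t * ((1 - t) / t) powr (p - 1)"
          using t powr_mult_base[of "(1 - t) / t" "p - 1"] by simp
        then have "t * ((1 - t) / t) powr p = (1 - t) * ((1 - t) / t) powr (p - 1)" using t by simp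
        then show ?thesis by (simp only: mult.assoc[symmetric])
      qed
      also have "(1 - t) powr p = (1 - t) * (1 - t) powr (p - 1)"
        using t powr_mult_base[of "1 - t" "p - 1"] by simp
      finally have "(1 - t) * (c_p p * (t powr (p / 2) * \<bar>D\<bar> powr p)) \<le>
        (1 - t) * (\<bar>x - y\<bar> powr p + ((1 - t) / t) powr (p - 1) * \<bar>y\<bar> powr p - (1 - t) powr (p - 1) * \<bar>x\<bar> powr p)"
        using t by (simp add: algebra_simps)
      then have "c_p p * (t powr (p / 2) * \<bar>D\<bar> powr p) \<le>
        \<bar>x - y\<bar> powr p + ((1 - t) / t) powr (p - 1) * \<bar>y\<bar> powr p - (1 - t) powr (p - 1) * \<bar>x\<bar> powr p"
        using t by (simp only: mult_le_cancel_left_pos)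
      then show ?thesis by (simp add: D_def abs_minus_commute)
    qed
  qed
qed


subsection \<open>Substitution and radial integration\<close>

lemma nn_integral_indicator_Union:
  assumes "incseq A" "range A \<subseteq> sets M" and [measurable]: "f \<in> borel_measurable M"
  shows "(\<integral>\<^sup>+x. f x * indicator (\<Union>n. A n) x \<partial>M) = (SUP n. \<integral>\<^sup>+x. f x * indicator (A n) x \<partial>M)"
proof -
  have [measurable]: "A n \<in> sets M" for n using assms(2) by auto
  have ind: "indicator (\<Union>n. A n) x = (SUP n. indicator (A n) x :: ennreal)" for x
  proof (cases "x \<in> (\<Union>n. A n)")
    case True
    then obtain n where n: "x \<in> A n" by auto
    have "(SUP n. indicator (A n) x :: ennreal) = 1"
      by (intro antisym SUP_least SUP_upper2[of n]) (auto simp: n indicator_def)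
    with True show ?thesis by simp
  qed auto
  have "incseq (\<lambda>n x. f x * indicator (A n) x)"
    using assms(1) by (auto simp: incseq_def le_fun_def indicator_def split: if_splits)
  then show ?thesis
    by (subst nn_integral_monotone_convergence_SUP[symmetric]) (auto simp: ind SUP_mult_left_ennreal)
qed

text \<open>The substitutions below live on open half-lines, one with a derivative that is singular
  at the endpoint. The rule for compact intervals is applied along an exhaustion and passed to the
  limit by monotone convergence.\<close>

lemma nn_integral_substitution_Union:
  fixes f :: "real \<Rightarrow> ennreal" and g g' :: "real \<Rightarrow> real" and a b :: "nat \<Rightarrow> real"
  assumes [measurable]: "f \<in> borel_measurable borel" "g \<in> borel_measurable borel" "g' \<in> borel_measurable borel"
    and ab: "\<And>n. a n < b n" "decseq a" "incseq b"
    and g: "\<And>n x. x \<in> {a n..b n} \<Longrightarrow> (g has_real_derivative g' x) (at x)"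
    and g': "\<And>n. continuous_on {a n..b n} g'" "\<And>n x. x \<in> {a n..b n} \<Longrightarrow> 0 \<le> g' x"
  shows "(\<integral>\<^sup>+x. f x * indicator (\<Union>n. {g (a n)..g (b n)}) x \<partial>lborel) =
         (\<integral>\<^sup>+x. f (g x) * g' x * indicator (\<Union>n. {a n..b n}) x \<partial>lborel)"
proof -
  have inc1: "incseq (\<lambda>n. {a n..b n})"
    using ab unfolding incseq_def decseq_def by (fastforce intro: order_trans)
  have mono: "g x \<le> g y" if "x \<in> {a n..b n}" "y \<in> {a n..b n}" "x \<le> y" for x y n
  proof (rule DERIV_nonneg_imp_nondecreasing[OF that(3)])
    fix z assume "x \<le> z" "z \<le> y"
    with that have "z \<in> {a n..b n}" by auto
    with g[OF this] g'(2)[OF this] show "\<exists>y. (g has_real_derivative y) (at z) \<and> 0 \<le> y" by blast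
  qed
  have inc2: "incseq (\<lambda>n. {g (a n)..g (b n)})"
  proof (rule incseq_SucI)
    fix n
    have "a (Suc n) \<le> a n" "b n \<le> b (Suc n)" "a n < b n"
      using ab by (auto simp: decseq_Suc_iff incseq_Suc_iff)
    then have "g (a (Suc n)) \<le> g (a n)" "g (b n) \<le> g (b (Suc n))"
      by (auto intro!: mono[of _ "Suc n"])
    then show "{g (a n)..g (b n)} \<subseteq> {g (a (Suc n))..g (b (Suc n))}" by auto
  qed
  have "(\<integral>\<^sup>+x. f x * indicator (\<Union>n. {g (a n)..g (b n)}) x \<partial>lborel) =
     (SUP n. \<integral>\<^sup>+x. f x * indicator {g (a n)..g (b n)} x \<partial>lborel)"
    by (rule nn_integral_indicator_Union[OF inc2]) auto
  also have "\<dots> = (SUP n. \<integral>\<^sup>+x. f (g x) * g' x * indicator {a n..b n} x \<partial>lborel)"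
    using ab g g' by (intro SUP_cong refl nn_integral_substitution_aux) auto
  also have "\<dots> = (\<integral>\<^sup>+x. f (g x) * g' x * indicator (\<Union>n. {a n..b n}) x \<partial>lborel)"
    by (rule nn_integral_indicator_Union[OF inc1, symmetric]) auto
  finally show ?thesis .
qed

text \<open>At a fixed coordinate c along an axis, this passes from the distance to the axis to the
  distance x to the origin.\<close>

lemma nn_integral_substitution_sqrt:
  fixes f :: "real \<Rightarrow> ennreal"
  assumes [measurable]: "f \<in> borel_measurable borel"
  shows "(\<integral>\<^sup>+x. f x * indicator {0<..} x \<partial>lborel) =
    (\<integral>\<^sup>+x. f (sqrt (x\<^sup>2 - c\<^sup>2)) * ennreal (x / sqrt (x\<^sup>2 - c\<^sup>2)) * indicator {\<bar>c\<bar><..} x \<partial>lborel)"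
proof -
  \<comment> \<open>The left ends stay strictly above |c|, where the derivative blows up; the offset
    of at least 2 in \<open>b\<close> keeps it above \<open>a\<close>, whose offset is at most
    1.\<close>
  define a b where "a = (\<lambda>n. \<bar>c\<bar> + 1 / real (Suc n))" "b = (\<lambda>n. \<bar>c\<bar> + real (Suc (Suc n)))"
  have sq: "c\<^sup>2 < x\<^sup>2" if "\<bar>c\<bar> < x" for x
    using that by (metis abs_ge_zero abs_le_square_iff abs_of_nonneg linorder_not_le order_less_imp_le order_le_less_trans)
  have U1: "(\<Union>n. {a n..b n}) = {\<bar>c\<bar><..}"
  proof (intro set_eqI iffI)
    fix x assume "x \<in> {\<bar>c\<bar><..}"
    then have "0 < x - \<bar>c\<bar>" by simp
    then obtain n where n: "inverse (real (Suc n)) < x - \<bar>c\<bar>" using reals_Archimedean by blast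
    obtain m where m: "x - \<bar>c\<bar> < real m" using reals_Archimedean2 by blast
    have "1 / real (Suc (max n m)) \<le> 1 / real (Suc n)" by (intro divide_left_mono) auto
    with n m have "x \<in> {a (max n m)..b (max n m)}" by (auto simp: a_b_def inverse_eq_divide)
    then show "x \<in> (\<Union>n. {a n..b n})" by blast
  qed (auto simp: a_b_def intro: less_le_trans[rotated])
  have U2: "(\<Union>n. {sqrt ((a n)\<^sup>2 - c\<^sup>2)..sqrt ((b n)\<^sup>2 - c\<^sup>2)}) = {0<..}"
  proof (intro set_eqI iffI)
    fix y :: real assume "y \<in> {0<..}"
    then have y: "0 < y" by simp
    have "\<bar>c\<bar> < sqrt (y\<^sup>2 + c\<^sup>2)" using y by (intro real_less_rsqrt) auto
    then have "sqrt (y\<^sup>2 + c\<^sup>2) \<in> (\<Union>n. {a n..b n})" unfolding U1 by simp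
    then obtain n where n: "a n \<le> sqrt (y\<^sup>2 + c\<^sup>2)" "sqrt (y\<^sup>2 + c\<^sup>2) \<le> b n" by auto
    have pos: "0 \<le> a n" "0 \<le> b n" by (auto simp: a_b_def)
    have "(a n)\<^sup>2 \<le> y\<^sup>2 + c\<^sup>2" "y\<^sup>2 + c\<^sup>2 \<le> (b n)\<^sup>2"
      using power_mono[OF n(1) pos(1), of 2] power_mono[OF n(2), of 2] by auto
    then have "sqrt ((a n)\<^sup>2 - c\<^sup>2) \<le> y" "y \<le> sqrt ((b n)\<^sup>2 - c\<^sup>2)"
      using y by (auto intro!: real_le_lsqrt real_le_rsqrt)
    then show "y \<in> (\<Union>n. {sqrt ((a n)\<^sup>2 - c\<^sup>2)..sqrt ((b n)\<^sup>2 - c\<^sup>2)})" by auto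
  next
    fix y assume "y \<in> (\<Union>n. {sqrt ((a n)\<^sup>2 - c\<^sup>2)..sqrt ((b n)\<^sup>2 - c\<^sup>2)})"
    then obtain n where "sqrt ((a n)\<^sup>2 - c\<^sup>2) \<le> y" by auto
    moreover have "0 < sqrt ((a n)\<^sup>2 - c\<^sup>2)" using sq[of "a n"] by (simp add: a_b_def)
    ultimately show "y \<in> {0<..}" by (metis greaterThan_iff less_le_trans)
  qed
  have "(\<integral>\<^sup>+x. f x * indicator (\<Union>n. {sqrt ((a n)\<^sup>2 - c\<^sup>2)..sqrt ((b n)\<^sup>2 - c\<^sup>2)}) x \<partial>lborel) =
    (\<integral>\<^sup>+x. f (sqrt (x\<^sup>2 - c\<^sup>2)) * ennreal (x / sqrt (x\<^sup>2 - c\<^sup>2)) * indicator (\<Union>n. {a n..b n}) x \<partial>lborel)"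
  proof (rule nn_integral_substitution_Union)
    show "a n < b n" for n
    proof -
      have "1 / real (Suc n) \<le> 1" by simp
      then show ?thesis unfolding a_b_def of_nat_Suc by linarith
    qed
    show "decseq a" unfolding a_b_def decseq_Suc_iff by (auto simp: field_simps)
    show "incseq b" unfolding a_b_def incseq_Suc_iff by auto
    have c: "\<bar>c\<bar> < x" if "x \<in> {a n..b n}" for x n using that U1 by blast
    show "((\<lambda>x. sqrt (x\<^sup>2 - c\<^sup>2)) has_real_derivative x / sqrt (x\<^sup>2 - c\<^sup>2)) (at x)" if "x \<in> {a n..b n}" for x n
      using sq[OF c[OF that]] by (auto intro!: derivative_eq_intros simp: field_simps)
    show "continuous_on {a n..b n} (\<lambda>x. x / sqrt (x\<^sup>2 - c\<^sup>2))" for n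
      using sq c[of _ n] by (intro continuous_intros) force
    show "0 \<le> x / sqrt (x\<^sup>2 - c\<^sup>2)" if "x \<in> {a n..b n}" for x n
      using sq[OF c[OF that]] c[OF that] by auto
  qed measurable
  then show ?thesis unfolding U1 U2 .
qed

lemma nn_integral_substitution_inverse:
  fixes f :: "real \<Rightarrow> ennreal"
  assumes [measurable]: "f \<in> borel_measurable borel"
  shows "(\<integral>\<^sup>+x. f x * indicator {0<..} x \<partial>lborel) =
    (\<integral>\<^sup>+x. f (1 / x) * ennreal (1 / x\<^sup>2) * indicator {0<..} x \<partial>lborel)"
proof -
  \<comment> \<open>Inversion reverses orientation, so the increasing map x -> -1/x on the negative
    axis is used instead, followed by the reflection x -> -x.\<close>
  define a b where "a = (\<lambda>n. - real (Suc (Suc n)))" "b = (\<lambda>n. - 1 / real (Suc n))"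
  have U1: "(\<Union>n. {a n..b n}) = {..<0}"
  proof (intro set_eqI iffI)
    fix x :: real assume "x \<in> {..<0}"
    then have "0 < - x" by simp
    then obtain n where n: "inverse (real (Suc n)) < - x" using reals_Archimedean by blast
    obtain m where m: "- x < real m" using reals_Archimedean2 by blast
    have "1 / real (Suc (max n m)) \<le> 1 / real (Suc n)" by (intro divide_left_mono) auto
    with n m have "x \<in> {a (max n m)..b (max n m)}" by (auto simp: a_b_def inverse_eq_divide)
    then show "x \<in> (\<Union>n. {a n..b n})" by blast
  qed (auto simp: a_b_def intro: le_less_trans)
  have U2: "(\<Union>n. {- 1 / a n..- 1 / b n}) = {0<..}"
  proof (intro set_eqI iffI)
    fix y :: real assume "y \<in> {0<..}"
    then have y: "0 < y" by simp
    then have "- 1 / y \<in> (\<Union>n. {a n..b n})" unfolding U1 by simp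
    then obtain n where n: "a n \<le> - 1 / y" "- 1 / y \<le> b n" by auto
    have "a n < 0" "b n < 0" by (auto simp: a_b_def)
    with n y have "- 1 / a n \<le> y" "y \<le> - 1 / b n" by (auto simp: field_simps)
    then show "y \<in> (\<Union>n. {- 1 / a n..- 1 / b n})" by auto
  next
    fix y assume "y \<in> (\<Union>n. {- 1 / a n..- 1 / b n})"
    then obtain n where "- 1 / a n \<le> y" by auto
    moreover have "0 < - 1 / a n" by (simp add: a_b_def)
    ultimately show "y \<in> {0<..}" by (metis greaterThan_iff less_le_trans)
  qed
  have "(\<integral>\<^sup>+x. f x * indicator (\<Union>n. {- 1 / a n..- 1 / b n}) x \<partial>lborel) =
    (\<integral>\<^sup>+x. f (- 1 / x) * ennreal (1 / x\<^sup>2) * indicator (\<Union>n. {a n..b n}) x \<partial>lborel)"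
  proof (rule nn_integral_substitution_Union)
    show "a n < b n" for n
    proof -
      have "1 / real (Suc n) \<le> 1" by simp
      then show ?thesis unfolding a_b_def of_nat_Suc by linarith
    qed
    show "incseq b" unfolding a_b_def incseq_Suc_iff by (auto simp: field_simps)
    show "decseq a" unfolding a_b_def decseq_Suc_iff by auto
    have c: "x < 0" if "x \<in> {a n..b n}" for x n using that U1 by blast
    show "((\<lambda>x. - 1 / x) has_real_derivative 1 / x\<^sup>2) (at x)" if "x \<in> {a n..b n}" for x n
      using c[OF that] by (auto intro!: derivative_eq_intros simp: field_simps power2_eq_square)
    show "continuous_on {a n..b n} (\<lambda>x. 1 / x\<^sup>2)" for n
      using c[of _ n] by (intro continuous_intros) force
    show "0 \<le> 1 / x\<^sup>2" if "x \<in> {a n..b n}" for x n by simp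
  qed measurable
  also have "\<dots> = (\<integral>\<^sup>+x. f (- 1 / x) * ennreal (1 / x\<^sup>2) * indicator (\<Union>n. {a n..b n}) x \<partial>distr lborel borel uminus)"
    by (simp add: lborel_distr_uminus)
  also have "\<dots> = (\<integral>\<^sup>+x. f (1 / x) * ennreal (1 / x\<^sup>2) * indicator {0<..} x \<partial>lborel)"
    unfolding U1 by (subst nn_integral_distr) (auto intro!: nn_integral_cong simp: indicator_def)
  finally show ?thesis unfolding U2 .
qed

text \<open>The image of M under \<rho> is determined by its values on half-lines, where it agrees
  with the density c m r^(m-1). M is kept abstract because the formula is needed both for
  \<open>lborel\<close> and for a product measure over a set of coordinates.\<close>

lemma nn_integral_radial:
  fixes G :: "real \<Rightarrow> ennreal" and \<rho> :: "'b \<Rightarrow> real"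
  assumes [measurable]: "\<rho> \<in> borel_measurable M" "G \<in> borel_measurable borel"
    and \<rho>: "\<And>x. x \<in> space M \<Longrightarrow> 0 \<le> \<rho> x" and m: "1 \<le> m" and c: "0 \<le> c"
    and ball: "\<And>r. 0 < r \<Longrightarrow> emeasure M {x\<in>space M. \<rho> x \<le> r} = ennreal (c * r ^ m)"
  shows "(\<integral>\<^sup>+x. G (\<rho> x) \<partial>M) =
    (\<integral>\<^sup>+r. G r * ennreal (c * real m * r ^ (m - 1)) * indicator {0<..} r \<partial>lborel)"
proof -
  define D where "D = density lborel (\<lambda>r. ennreal (c * real m * r ^ (m - 1)) * indicator {0<..} r)"
  have "distr M borel \<rho> = D"
  proof (rule measure_eqI_generator_eq[where E="range (\<lambda>r::real. {..r})" and A="\<lambda>n. {..real n}" and \<Omega>=UNIV])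
    show "Int_stable (range (\<lambda>r::real. {..r}))"
      by (auto simp: Int_stable_def intro!: exI[of _ "min _ _"])
    have dist: "emeasure (distr M borel \<rho>) {..r} = emeasure M {x\<in>space M. \<rho> x \<le> r}" for r
      by (subst emeasure_distr) (auto intro!: arg_cong[where f="emeasure M"])
    have emD: "emeasure D {..r} = (\<integral>\<^sup>+x. ennreal (c * real m * x ^ (m - 1)) * indicator {0<..} x * indicator {..r} x \<partial>lborel)" for r
      unfolding D_def by (subst emeasure_density) auto
    have D: "emeasure D {..r} = ennreal (c * r ^ m)" if "0 \<le> r" for r
    proof -
      have "emeasure D {..r} = (\<integral>\<^sup>+x. ennreal (c * real m * x ^ (m - 1)) * indicator {0..r} x \<partial>lborel)"
        unfolding emD using AE_lborel_singleton[of 0]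
        by (intro nn_integral_cong_AE) (auto elim!: eventually_mono simp: indicator_def)
      also have "\<dots> = ennreal (c * r ^ m - c * 0 ^ m)"
        using that c m by (intro nn_integral_FTC_Icc[where F="\<lambda>x. c * x ^ m"])
          (auto intro!: derivative_eq_intros)
      finally show ?thesis using m by (simp add: zero_power)
    qed
    have D0: "emeasure D {..r} = 0" if "r \<le> 0" for r
    proof -
      have "emeasure D {..r} = (\<integral>\<^sup>+x. 0 \<partial>(lborel :: real measure))"
        unfolding emD using that by (intro nn_integral_cong) (auto simp: indicator_def)
      then show ?thesis by simp
    qed
    \<comment> \<open>The volume hypothesis covers only positive radii; the set where \<rho> \<le> 0
      is null because it lies in all balls of radius 1/(n+1).\<close>
    have M0: "emeasure M {x\<in>space M. \<rho> x \<le> r} = 0" if "r \<le> 0" for r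
    proof -
      have "emeasure M {x\<in>space M. \<rho> x \<le> r} \<le> ennreal (c * (1 / real (Suc n)) ^ m)" for n
        unfolding ball[symmetric, of "1 / real (Suc n)", simplified] using that
        by (subst ball[symmetric]) (auto intro!: emeasure_mono intro: order_trans)
      moreover have "(\<lambda>n. ennreal (c * (1 / real (Suc n)) ^ m)) \<longlonglongrightarrow> ennreal (c * 0 ^ m)"
        using LIMSEQ_inverse_real_of_nat by (intro tendsto_ennrealI tendsto_intros) (simp add: inverse_eq_divide)
      ultimately have "emeasure M {x\<in>space M. \<rho> x \<le> r} \<le> ennreal (c * 0 ^ m)"
        by (intro LIMSEQ_le_const) auto
      then show ?thesis using m by (simp add: zero_power)
    qed
    show "emeasure (distr M borel \<rho>) X = emeasure D X" if "X \<in> range (\<lambda>r::real. {..r})" for X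
    proof -
      from that obtain r where X: "X = {..r}" by auto
      show ?thesis unfolding X dist
        using ball[of r] D[of r] D0[of r] M0[of r] by (cases "0 < r") auto
    qed
    show "sets (distr M borel \<rho>) = sigma_sets UNIV (range (\<lambda>r::real. {..r}))"
      "sets D = sigma_sets UNIV (range (\<lambda>r::real. {..r}))"
      by (simp_all add: D_def borel_eq_atMost)
    show "(\<Union>i. {..real i}) = UNIV" by (auto intro: real_arch_simple)
    show "emeasure (distr M borel \<rho>) {..real i} \<noteq> \<infinity>" for i
      unfolding dist using ball[of "real i"] M0[of "real i"] by (cases "i = 0") auto
  qed auto
  moreover have "(\<integral>\<^sup>+x. G (\<rho> x) \<partial>M) = (\<integral>\<^sup>+x. G x \<partial>distr M borel \<rho>)"
    by (simp add: nn_integral_distr)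
  ultimately have "(\<integral>\<^sup>+x. G (\<rho> x) \<partial>M) = (\<integral>\<^sup>+x. G x \<partial>D)" by simp
  also have "\<dots> = (\<integral>\<^sup>+r. G r * ennreal (c * real m * r ^ (m - 1)) * indicator {0<..} r \<partial>lborel)"
    unfolding D_def by (subst nn_integral_density) (auto intro!: nn_integral_cong simp: mult_ac)
  finally show ?thesis .
qed


subsection \<open>Polar coordinates around an axis\<close>

text \<open>Integral over the unit sphere of a function of \<open>t = e \<bullet> \<xi>\<close>, for a fixed unit vector \<open>e\<close>.\<close>
definition axial_integral :: "nat \<Rightarrow> (real \<Rightarrow> ennreal) \<Rightarrow> ennreal" where
  "axial_integral N h = (if N = 1 then h 1 + h (- 1)
     else ennreal (sphere_area N) *
       (\<integral>\<^sup>+t. ennreal ((1 - t\<^sup>2) powr ((real N - 3) / 2)) * h t * indicator {-1<..<1} t \<partial>lborel))"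

lemma measurable_axial_integral [measurable]:
  assumes [measurable]: "case_prod h \<in> borel_measurable (M \<Otimes>\<^sub>M borel)"
  shows "(\<lambda>x. axial_integral N (h x)) \<in> borel_measurable M"
proof (cases "N = 1")
  case True
  then show ?thesis unfolding axial_integral_def by simp
next
  case False
  have [measurable]: "(\<lambda>x. h (fst x) (snd x)) \<in> borel_measurable (M \<Otimes>\<^sub>M borel)"
    using assms by (simp add: case_prod_beta')
  have [measurable]: "(\<lambda>x. h (fst x) (snd x)) \<in> borel_measurable (M \<Otimes>\<^sub>M lborel)"
  proof -
    have "sets (M \<Otimes>\<^sub>M lborel) = sets (M \<Otimes>\<^sub>M (borel :: real measure))"
      by (intro sets_pair_measure_cong refl sets_lborel)
    then have "borel_measurable (M \<Otimes>\<^sub>M lborel) = (borel_measurable (M \<Otimes>\<^sub>M borel) :: ('a \<times> real \<Rightarrow> ennreal) set)"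
      by (intro measurable_cong_sets refl)
    then show ?thesis by simp
  qed
  show ?thesis using False unfolding axial_integral_def by simp
qed

lemma axial_integral_cmult:
  assumes [measurable]: "h \<in> borel_measurable borel"
  shows "axial_integral N (\<lambda>t. c * h t) = c * axial_integral N h"
proof (cases "N = 1")
  case True
  then show ?thesis by (simp add: axial_integral_def distrib_left)
next
  case False
  have "(\<integral>\<^sup>+t. ennreal ((1 - t\<^sup>2) powr ((real N - 3) / 2)) * (c * h t) * indicator {-1<..<1} t \<partial>lborel) =
    (\<integral>\<^sup>+t. c * (ennreal ((1 - t\<^sup>2) powr ((real N - 3) / 2)) * h t * indicator {-1<..<1} t) \<partial>lborel)"
    by (intro nn_integral_cong) (simp only: mult_ac)
  also have "\<dots> = c * (\<integral>\<^sup>+t. ennreal ((1 - t\<^sup>2) powr ((real N - 3) / 2)) * h t * indicator {-1<..<1} t \<partial>lborel)"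
    by (rule nn_integral_cmult) measurable
  finally show ?thesis using False by (simp add: axial_integral_def mult.left_commute)
qed

lemma sphere_area_eq_unit_ball_vol:
  assumes "2 \<le> N"
  shows "sphere_area N = unit_ball_vol (real (N - 1)) * real (N - 1)"
proof -
  define m where "m = real (N - 1)"
  have m: "0 < m" "real N - 1 = m" using assms by (auto simp: m_def)
  have G: "Gamma (m / 2 + 1) = m / 2 * Gamma (m / 2)"
    using m by (subst Gamma_plus1) (auto simp: nonpos_Ints_def)
  have "2 * A / Gamma (m / 2) = A / (m / 2 * Gamma (m / 2)) * m" for A
    using m by simp
  then show ?thesis unfolding sphere_area_def unit_ball_vol_def m_def[symmetric] m(2) G by blast
qed

lemma norm_sum_Basis:
  "norm (\<Sum>i\<in>Basis. f i *\<^sub>R i :: 'a::euclidean_space) = sqrt (\<Sum>i\<in>Basis. (f i)\<^sup>2)"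
proof -
  have "norm (\<Sum>i\<in>Basis. f i *\<^sub>R i :: 'a) = sqrt (\<Sum>j\<in>Basis. ((\<Sum>i\<in>Basis. f i *\<^sub>R i) \<bullet> j)\<^sup>2)"
    using euclidean_dist_l2[of "\<Sum>i\<in>Basis. f i *\<^sub>R i :: 'a" 0] by (simp add: L2_set_def dist_real_def)
  also have "(\<Sum>j\<in>Basis. ((\<Sum>i\<in>Basis. f i *\<^sub>R i) \<bullet> j)\<^sup>2) = (\<Sum>j\<in>(Basis :: 'a set). (f j)\<^sup>2)"
    by (intro sum.cong refl) simp
  finally show ?thesis .
qed

lemma nn_integral_axial_scale:
  fixes F :: "real \<Rightarrow> ennreal"
  assumes [measurable]: "F \<in> borel_measurable borel" and r: "0 < r" and N: "2 \<le> N"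
  shows "(\<integral>\<^sup>+a. F a * ennreal (r * (r\<^sup>2 - a\<^sup>2) powr ((real N - 3) / 2)) * indicator {-r<..<r} a \<partial>lborel)
    = ennreal (r ^ (N - 1)) * (\<integral>\<^sup>+t. ennreal ((1 - t\<^sup>2) powr ((real N - 3) / 2)) * F (r * t) * indicator {-1<..<1} t \<partial>lborel)"
proof -
  let ?e = "((real N - 3) / 2)"
  have "(\<integral>\<^sup>+a. F a * ennreal (r * (r\<^sup>2 - a\<^sup>2) powr ?e) * indicator {-r<..<r} a \<partial>lborel)
    = ennreal r * (\<integral>\<^sup>+t. F (r * t) * ennreal (r * (r\<^sup>2 - (r * t)\<^sup>2) powr ?e) * indicator {-r<..<r} (r * t) \<partial>lborel)"
    using r by (subst nn_integral_real_affine[where c=r and t=0]) auto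
  also have "\<dots> = (\<integral>\<^sup>+t. ennreal (r ^ (N - 1)) * (ennreal ((1 - t\<^sup>2) powr ?e) * F (r * t) * indicator {-1<..<1} t) \<partial>lborel)"
  proof (subst nn_integral_cmult[symmetric], measurable, rule nn_integral_cong)
    fix t
    show "ennreal r * (F (r * t) * ennreal (r * (r\<^sup>2 - (r * t)\<^sup>2) powr ?e) * indicator {-r<..<r} (r * t)) =
      ennreal (r ^ (N - 1)) * (ennreal ((1 - t\<^sup>2) powr ?e) * F (r * t) * indicator {-1<..<1} t)"
    proof (cases "t \<in> {-1<..<1}")
      case True
      then have t: "0 < 1 - t\<^sup>2" by (simp add: abs_square_less_1 abs_less_iff)
      have "r * (r * (r\<^sup>2 - (r * t)\<^sup>2) powr ?e) = r powr 2 * ((r\<^sup>2) powr ?e * (1 - t\<^sup>2) powr ?e)"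
        using r t by (subst powr_mult[symmetric]) (auto simp: power_mult_distrib algebra_simps power2_eq_square)
      also have "(r\<^sup>2) powr ?e = r powr (real N - 3)"
      proof -
        have "2 * ?e = real N - 3" by (simp only: nonzero_mult_div_cancel_left times_divide_eq_right)
        with r powr_powr[of r 2 "(real N - 3) / 2"] show ?thesis by (simp only: powr_numeral)
      qed
      also have "r powr 2 * (r powr (real N - 3) * (1 - t\<^sup>2) powr ?e) = r powr (real (N - 1)) * (1 - t\<^sup>2) powr ?e"
        using N by (simp add: mult.assoc[symmetric] flip: powr_add)
      also have "r powr (real (N - 1)) = r ^ (N - 1)" using r by (simp only: powr_realpow)
      finally have "ennreal r * ennreal (r * (r\<^sup>2 - (r * t)\<^sup>2) powr ?e) =
        ennreal (r ^ (N - 1)) * ennreal ((1 - t\<^sup>2) powr ?e)"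
        using r by (simp flip: ennreal_mult)
      moreover have "r * t \<in> {-r<..<r}"
        using True r mult_strict_left_mono[of t 1 r] mult_strict_left_mono[of "-1" t r] by auto
      ultimately show ?thesis using True by (simp add: mult.left_commute[of _ "F (r * t)"] mult.commute[of "F (r * t)"] flip: mult.assoc)
    next
      case False
      have "r * t \<notin> {-r<..<r}"
      proof
        assume "r * t \<in> {-r<..<r}"
        then have "r * (-1) < r * t" "r * t < r * 1" by auto
        with r False show False by (simp only: mult_less_cancel_left_pos) auto
      qed
      with False show ?thesis by simp
    qed
  qed
  also have "\<dots> = ennreal (r ^ (N - 1)) * (\<integral>\<^sup>+t. ennreal ((1 - t\<^sup>2) powr ?e) * F (r * t) * indicator {-1<..<1} t \<partial>lborel)"
    by (rule nn_integral_cmult) measurable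
  finally show ?thesis .
qed

text \<open>Fix the coordinate a = y \<bullet> b and use polar coordinates in the remaining N - 1
  dimensions. Pass from the distance to the axis to r = |y|, exchange the integrals, and put a = r
  t. In dimension one there is no complement, and the two half-lines give t = 1 and t = -1.\<close>

lemma nn_integral_axial:
  fixes b :: "'a::euclidean_space" and F :: "real \<times> real \<Rightarrow> ennreal"
  assumes b: "b \<in> Basis" and F [measurable]: "F \<in> borel_measurable (borel \<Otimes>\<^sub>M borel)"
  shows "(\<integral>\<^sup>+y. F (norm y, y \<bullet> b) \<partial>(lborel :: 'a measure)) =
    (\<integral>\<^sup>+r. ennreal (r ^ (DIM('a) - 1)) * axial_integral DIM('a) (\<lambda>t. F (r, r * t)) * indicator {0<..} r \<partial>lborel)"
proof -
  define I where "I = (Basis - {b} :: 'a set)"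
  have I: "finite I" "b \<notin> I" "insert b I = Basis" "card I = DIM('a) - 1"
    using b by (auto simp: I_def)
  interpret product_sigma_finite "\<lambda>_. lborel :: real measure" ..
  have [measurable]: "(\<lambda>x. F (f x, g x)) \<in> borel_measurable M" if "f \<in> borel_measurable M" "g \<in> borel_measurable M" for f g and M :: "'z measure"
    using that by measurable
  have "(\<integral>\<^sup>+y. F (norm y, y \<bullet> b) \<partial>(lborel :: 'a measure)) =
    (\<integral>\<^sup>+f. F (sqrt (\<Sum>i\<in>Basis. (f i)\<^sup>2), f b) \<partial>(\<Pi>\<^sub>M i\<in>(Basis :: 'a set). lborel))"
    by (subst lborel_eq, subst nn_integral_distr) (use b in \<open>auto simp: norm_sum_Basis\<close>)
  also have "\<dots> = (\<integral>\<^sup>+f. F (sqrt (\<Sum>i\<in>insert b I. (f i)\<^sup>2), f b) \<partial>(\<Pi>\<^sub>M i\<in>insert b I. lborel))"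
    by (simp add: I)
  also have "\<dots> = (\<integral>\<^sup>+a. \<integral>\<^sup>+f. F (sqrt (\<Sum>i\<in>insert b I. ((f(b := a)) i)\<^sup>2), a) \<partial>(\<Pi>\<^sub>M i\<in>I. lborel) \<partial>lborel)"
    using I(1,2) by (subst product_nn_integral_insert_rev) simp_all
  also have "\<dots> = (\<integral>\<^sup>+a. \<integral>\<^sup>+f. F (sqrt (a\<^sup>2 + (sqrt (\<Sum>i\<in>I. (f i)\<^sup>2))\<^sup>2), a) \<partial>(\<Pi>\<^sub>M i\<in>I. lborel) \<partial>lborel)"
  proof -
    have "(\<Sum>i\<in>insert b I. ((f(b := a)) i)\<^sup>2) = a\<^sup>2 + (sqrt (\<Sum>i\<in>I. (f i)\<^sup>2))\<^sup>2" for f a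
    proof -
      have "(\<Sum>i\<in>insert b I. ((f(b := a)) i)\<^sup>2) = a\<^sup>2 + (\<Sum>i\<in>I. ((f(b := a)) i)\<^sup>2)"
        using I(1,2) by (subst sum.insert) auto
      also have "(\<Sum>i\<in>I. ((f(b := a)) i)\<^sup>2) = (\<Sum>i\<in>I. (f i)\<^sup>2)"
        using I(2) by (intro sum.cong) auto
      finally show ?thesis by (simp add: sum_nonneg)
    qed
    then show ?thesis by simp
  qed
  finally have *: "(\<integral>\<^sup>+y. F (norm y, y \<bullet> b) \<partial>(lborel :: 'a measure)) =
    (\<integral>\<^sup>+a. \<integral>\<^sup>+f. F (sqrt (a\<^sup>2 + (sqrt (\<Sum>i\<in>I. (f i)\<^sup>2))\<^sup>2), a) \<partial>(\<Pi>\<^sub>M i\<in>I. lborel) \<partial>lborel)" .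
  show ?thesis
  proof (cases "DIM('a) = 1")
    case True
    with I have "I = {}" by simp
    then have "(\<integral>\<^sup>+y. F (norm y, y \<bullet> b) \<partial>(lborel :: 'a measure)) = (\<integral>\<^sup>+a. F (\<bar>a\<bar>, a) \<partial>lborel)"
      unfolding * by (simp add: PiM_empty nn_integral_count_space_finite)
    also have "\<dots> = (\<integral>\<^sup>+a. F (a, a) * indicator {0<..} a + F (- a, a) * indicator {..<0} a \<partial>lborel)"
      using AE_lborel_singleton[of 0]
      by (intro nn_integral_cong_AE) (auto elim!: eventually_mono simp: indicator_def)
    also have "\<dots> = (\<integral>\<^sup>+a. F (a, a) * indicator {0<..} a \<partial>lborel) + (\<integral>\<^sup>+a. F (- a, a) * indicator {..<0} a \<partial>lborel)"
      by (rule nn_integral_add) auto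
    also have "(\<integral>\<^sup>+a. F (- a, a) * indicator {..<0} a \<partial>lborel) = (\<integral>\<^sup>+a. F (- a, a) * indicator {..<0} a \<partial>distr lborel borel uminus)"
      by (simp add: lborel_distr_uminus)
    also have "\<dots> = (\<integral>\<^sup>+a. F (a, - a) * indicator {0<..} a \<partial>lborel)"
      by (subst nn_integral_distr) (auto intro!: nn_integral_cong simp: indicator_def)
    also have "(\<integral>\<^sup>+a. F (a, a) * indicator {0<..} a \<partial>lborel) + (\<integral>\<^sup>+a. F (a, - a) * indicator {0<..} a \<partial>lborel)
      = (\<integral>\<^sup>+a. F (a, a) * indicator {0<..} a + F (a, - a) * indicator {0<..} a \<partial>lborel)"
      by (rule nn_integral_add[symmetric]) auto
    finally show ?thesis using True by (simp add: axial_integral_def distrib_right)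
  next
    case False
    define m where "m = DIM('a) - 1"
    have m: "1 \<le> m" using False DIM_positive[where 'a='a] unfolding m_def by linarith
    have N: "2 \<le> DIM('a)" "real (m - 1) = real DIM('a) - 2" using m by (auto simp: m_def)
    define c where "c = unit_ball_vol (real m)"
    have c: "0 \<le> c" "sphere_area DIM('a) = c * real m"
      using sphere_area_eq_unit_ball_vol[OF N(1)] by (auto simp: c_def m_def)
    define w where "w = (\<lambda>r a. ennreal (c * real m * (r * (r\<^sup>2 - a\<^sup>2) powr ((real DIM('a) - 3) / 2))))"
    have "(\<integral>\<^sup>+f. F (sqrt (a\<^sup>2 + (sqrt (\<Sum>i\<in>I. (f i)\<^sup>2))\<^sup>2), a) \<partial>(\<Pi>\<^sub>M i\<in>I. lborel)) =
       (\<integral>\<^sup>+r. F (r, a) * w r a * indicator {\<bar>a\<bar><..} r \<partial>lborel)" for a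
    proof -
      have "(\<integral>\<^sup>+f. F (sqrt (a\<^sup>2 + (sqrt (\<Sum>i\<in>I. (f i)\<^sup>2))\<^sup>2), a) \<partial>(\<Pi>\<^sub>M i\<in>I. lborel)) =
        (\<integral>\<^sup>+r. F (sqrt (a\<^sup>2 + r\<^sup>2), a) * ennreal (c * real m * r ^ (m - 1)) * indicator {0<..} r \<partial>lborel)"
      proof (rule nn_integral_radial[where G="\<lambda>r. F (sqrt (a\<^sup>2 + r\<^sup>2), a)" and \<rho>="\<lambda>f. sqrt (\<Sum>i\<in>I. (f i)\<^sup>2)"])
        fix r :: real assume "0 < r"
        from emeasure_cball_aux[OF I(1) this]
        show "emeasure (\<Pi>\<^sub>M i\<in>I. lborel) {x \<in> space (\<Pi>\<^sub>M i\<in>I. lborel). sqrt (\<Sum>i\<in>I. (x i)\<^sup>2) \<le> r} = ennreal (c * r ^ m)"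
          by (simp add: c_def m_def I(4) Int_def conj_commute)
      qed (use m c in \<open>auto simp: sum_nonneg\<close>)
      also have "\<dots> = (\<integral>\<^sup>+r. F (sqrt (a\<^sup>2 + (sqrt (r\<^sup>2 - a\<^sup>2))\<^sup>2), a) * ennreal (c * real m * sqrt (r\<^sup>2 - a\<^sup>2) ^ (m - 1)) *
         ennreal (r / sqrt (r\<^sup>2 - a\<^sup>2)) * indicator {\<bar>a\<bar><..} r \<partial>lborel)"
        by (rule nn_integral_substitution_sqrt) measurable
      also have "\<dots> = (\<integral>\<^sup>+r. F (r, a) * w r a * indicator {\<bar>a\<bar><..} r \<partial>lborel)" (is "integral\<^sup>N _ ?f = integral\<^sup>N _ ?g")
      proof (rule nn_integral_cong)
        fix r :: real
        show "?f r = ?g r"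
        proof (cases "\<bar>a\<bar> < r")
          case True
          then have "a\<^sup>2 < r\<^sup>2" by (metis abs_ge_zero abs_le_square_iff abs_of_nonneg linorder_not_le order_less_imp_le order_le_less_trans)
          \<comment> \<open>The Jacobian of the substitution removes one power of sqrt q from sqrt q
            ^ (N - 2), which leaves the exponent (N - 3)/2 of the spherical weight.\<close>
          define q where "q = r\<^sup>2 - a\<^sup>2"
          have q: "0 < q" using \<open>a\<^sup>2 < r\<^sup>2\<close> by (simp add: q_def)
          have "sqrt q ^ (m - 1) = (q powr (1/2)) powr real (m - 1)"
            using q by (simp add: powr_half_sqrt flip: powr_realpow)
          also have "\<dots> = q powr ((real DIM('a) - 2) / 2)" unfolding N powr_powr by simp
          finally have "sqrt q ^ (m - 1) / sqrt q = q powr ((real DIM('a) - 2) / 2) / q powr (1/2)"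
            using q by (simp add: powr_half_sqrt)
          also have "\<dots> = q powr ((real DIM('a) - 2) / 2 - 1/2)" by (simp add: powr_diff)
          also have "(real DIM('a) - 2) / 2 - 1/2 = (real DIM('a) - 3) / 2" by (simp add: field_simps)
          finally have "sqrt q ^ (m - 1) / sqrt q = q powr ((real DIM('a) - 3) / 2)" .
          moreover have "c * real m * sqrt q ^ (m - 1) * (r / sqrt q) = c * real m * (r * (sqrt q ^ (m - 1) / sqrt q))"
            by simp
          ultimately have "c * real m * sqrt q ^ (m - 1) * (r / sqrt q) = c * real m * (r * q powr ((real DIM('a) - 3) / 2))"
            by (simp only:)
          then have "ennreal (c * real m * sqrt q ^ (m - 1)) * ennreal (r / sqrt q) = ennreal (c * real m * (r * q powr ((real DIM('a) - 3) / 2)))"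
            using q c True by (simp flip: ennreal_mult)
          moreover have "sqrt (a\<^sup>2 + (sqrt q)\<^sup>2) = r" using True q by (simp add: q_def)
          ultimately show ?thesis unfolding w_def q_def[symmetric] by (simp add: mult.assoc)
        qed auto
      qed
      finally show ?thesis .
    qed
    then have "(\<integral>\<^sup>+y. F (norm y, y \<bullet> b) \<partial>(lborel :: 'a measure)) =
      (\<integral>\<^sup>+a. \<integral>\<^sup>+r. F (r, a) * w r a * indicator {\<bar>a\<bar><..} r \<partial>lborel \<partial>lborel)"
      unfolding * by simp
    also have "\<dots> = (\<integral>\<^sup>+r. \<integral>\<^sup>+a. F (r, a) * w r a * indicator {\<bar>a\<bar><..} r \<partial>lborel \<partial>lborel)"
      by (rule lborel_pair.Fubini') (simp add: w_def case_prod_beta' greaterThan_def)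
    also have "\<dots> = (\<integral>\<^sup>+r. ennreal (r ^ (DIM('a) - 1)) * axial_integral DIM('a) (\<lambda>t. F (r, r * t)) * indicator {0<..} r \<partial>lborel)" (is "integral\<^sup>N _ ?f = integral\<^sup>N _ ?g")
    proof (rule nn_integral_cong)
      fix r :: real
      show "?f r = ?g r"
      proof (cases "0 < r")
        case True
        have "(\<integral>\<^sup>+a. F (r, a) * w r a * indicator {\<bar>a\<bar><..} r \<partial>lborel) =
          (\<integral>\<^sup>+a. ennreal (c * real m) * (F (r, a) * ennreal (r * (r\<^sup>2 - a\<^sup>2) powr ((real DIM('a) - 3) / 2)) * indicator {-r<..<r} a) \<partial>lborel)"
          using True c by (intro nn_integral_cong) (auto simp: w_def indicator_def ennreal_mult' mult_ac)
        also have "\<dots> = ennreal (c * real m) * (\<integral>\<^sup>+a. F (r, a) * ennreal (r * (r\<^sup>2 - a\<^sup>2) powr ((real DIM('a) - 3) / 2)) * indicator {-r<..<r} a \<partial>lborel)"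
          by (rule nn_integral_cmult) measurable
        also have "\<dots> = ennreal (c * real m) * (ennreal (r ^ (DIM('a) - 1)) * (\<integral>\<^sup>+t. ennreal ((1 - t\<^sup>2) powr ((real DIM('a) - 3) / 2)) * F (r, r * t) * indicator {-1<..<1} t \<partial>lborel))"
          by (subst nn_integral_axial_scale[OF _ True N(1)]) auto
        finally show ?thesis using True False by (simp add: axial_integral_def c mult_ac)
      next
        case False
        then have "indicator {\<bar>a\<bar><..} r = (0 :: ennreal)" for a by auto
        with False show ?thesis by simp
      qed
    qed
    finally show ?thesis .
  qed
qed


subsection \<open>Rotation invariance and radial kernels\<close>

lemma nn_integral_lborel_reflect:
  fixes f :: "'a::euclidean_space \<Rightarrow> ennreal"
  assumes [measurable]: "f \<in> borel_measurable borel"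
  shows "(\<integral>\<^sup>+y. f (b - y) \<partial>lborel) = (\<integral>\<^sup>+y. f y \<partial>lborel)"
proof -
  have "(\<integral>\<^sup>+y. f (b - y) \<partial>lborel) = (\<integral>\<^sup>+y. f y \<partial>distr lborel borel (\<lambda>y. b + (- 1) *\<^sub>R y))"
    by (subst nn_integral_distr) auto
  also have "distr lborel borel (\<lambda>y. b + (- 1) *\<^sub>R y) = (lborel :: 'a measure)"
    using lborel_affine[of "-1" b] by (simp add: density_1)
  finally show ?thesis .
qed

text \<open>Evaluate \<open>\<integral>\<integral> 1\<^sub>A(x) 1\<^sub>B(x + y) dy d\<mu>(x)\<close> in both orders.\<close>
lemma translation_invariant_measure_unique:
  fixes \<mu> :: "'a::euclidean_space measure"
  assumes sets [measurable_cong]: "sets \<mu> = sets borel" and "sigma_finite_measure \<mu>"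
    and inv: "\<And>f c. f \<in> borel_measurable borel \<Longrightarrow> (\<integral>\<^sup>+x. f (x + c) \<partial>\<mu>) = (\<integral>\<^sup>+x. f x \<partial>\<mu>)"
    and A [measurable]: "A \<in> sets borel" and B [measurable]: "B \<in> sets borel"
  shows "emeasure \<mu> A * emeasure lborel B = emeasure \<mu> B * emeasure lborel A"
proof -
  interpret sigma_finite_measure \<mu> by fact
  interpret pair_sigma_finite \<mu> "lborel :: 'a measure" ..
  have lb: "(\<integral>\<^sup>+y. f (c + y) \<partial>lborel) = (\<integral>\<^sup>+y. f y \<partial>lborel)" if [measurable]: "f \<in> borel_measurable borel" for f :: "'a \<Rightarrow> ennreal" and c
  proof -
    have "(\<integral>\<^sup>+y. f y \<partial>lborel) = (\<integral>\<^sup>+y. f y \<partial>distr lborel borel (\<lambda>x. c + x))"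
      by (simp add: lborel_distr_plus)
    also have "\<dots> = (\<integral>\<^sup>+y. f (c + y) \<partial>lborel)" by (rule nn_integral_distr) measurable
    finally show ?thesis ..
  qed
  have refl: "(\<integral>\<^sup>+y. indicator A (x - y) \<partial>lborel) = emeasure lborel A" for x :: 'a
    using nn_integral_lborel_reflect[of "indicator A" x] by simp
  have "emeasure \<mu> A * emeasure lborel B = (\<integral>\<^sup>+x. indicator A x * emeasure lborel B \<partial>\<mu>)"
    by (simp add: nn_integral_multc sets)
  also have "\<dots> = (\<integral>\<^sup>+x. \<integral>\<^sup>+y. indicator A x * indicator B (x + y) \<partial>lborel \<partial>\<mu>)"
  proof (rule nn_integral_cong)
    fix x
    have "(\<integral>\<^sup>+y. indicator A x * indicator B (x + y) \<partial>lborel) = indicator A x * (\<integral>\<^sup>+y. indicator B (x + y) \<partial>lborel)"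
      by (rule nn_integral_cmult) measurable
    then show "indicator A x * emeasure lborel B = (\<integral>\<^sup>+y. indicator A x * indicator B (x + y) \<partial>lborel)"
      using lb[of "indicator B" x] by simp
  qed
  also have "\<dots> = (\<integral>\<^sup>+y. \<integral>\<^sup>+x. indicator A x * indicator B (x + y) \<partial>\<mu> \<partial>lborel)"
    by (rule Fubini'[symmetric]) measurable
  also have "\<dots> = (\<integral>\<^sup>+y. \<integral>\<^sup>+x. indicator A (x - y) * indicator B x \<partial>\<mu> \<partial>lborel)"
  proof (rule nn_integral_cong)
    fix y :: 'a
    have "(\<integral>\<^sup>+x. indicator A (x - y) * indicator B x \<partial>\<mu>) = (\<integral>\<^sup>+x. indicator A (x + y - y) * indicator B (x + y) \<partial>\<mu>)"
      by (rule inv[symmetric, of "\<lambda>x. indicator A (x - y) * indicator B x"]) measurable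
    then show "(\<integral>\<^sup>+x. indicator A x * indicator B (x + y) \<partial>\<mu>) = (\<integral>\<^sup>+x. indicator A (x - y) * indicator B x \<partial>\<mu>)"
      by simp
  qed
  also have "\<dots> = (\<integral>\<^sup>+x. \<integral>\<^sup>+y. indicator A (x - y) * indicator B x \<partial>lborel \<partial>\<mu>)"
    by (rule Fubini') measurable
  also have "\<dots> = (\<integral>\<^sup>+x. emeasure lborel A * indicator B x \<partial>\<mu>)"
    by (intro nn_integral_cong) (subst nn_integral_multc, auto simp: refl)
  also have "\<dots> = emeasure \<mu> B * emeasure lborel A"
    by (subst nn_integral_cmult) (auto simp: sets mult.commute)
  finally show ?thesis .
qed

text \<open>The image measure is translation invariant, since T is linear and its own inverse, and
  it gives the unit ball the same finite positive mass because T preserves norms. Uniqueness of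
  translation-invariant measures then fixes it.\<close>

lemma lborel_distr_isometric_involution:
  fixes T :: "'a::euclidean_space \<Rightarrow> 'a"
  assumes T: "linear T" "\<And>x. T (T x) = x" "\<And>x. norm (T x) = norm x"
  shows "distr lborel borel T = lborel"
proof -
  have "continuous_on UNIV T" using T(1) by (simp add: linear_continuous_on linear_conv_bounded_linear)
  then have T_meas [measurable]: "T \<in> borel_measurable borel" by (rule borel_measurable_continuous_onI)
  define \<mu> where "\<mu> = distr lborel borel T"
  have sets_mu [measurable_cong, simp]: "sets \<mu> = sets borel" by (simp add: \<mu>_def)
  have em: "emeasure \<mu> A = emeasure lborel (T -` A)" if "A \<in> sets borel" for A
    unfolding \<mu>_def using that by (subst emeasure_distr) auto
  have cball: "emeasure \<mu> (cball 0 r) = emeasure lborel (cball (0::'a) r)" for r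
    by (subst em) (auto simp: T intro!: arg_cong[where f="emeasure lborel"])
  have "sigma_finite_measure \<mu>"
  proof
    show "\<exists>A. countable A \<and> A \<subseteq> sets \<mu> \<and> \<Union>A = space \<mu> \<and> (\<forall>a\<in>A. emeasure \<mu> a \<noteq> \<infinity>)"
    proof (intro exI[of _ "range (\<lambda>n. cball 0 (real n))"] conjI ballI)
      show "\<Union>(range (\<lambda>n. cball 0 (real n))) = space \<mu>"
        by (auto simp: \<mu>_def intro: real_arch_simple)
      show "emeasure \<mu> a \<noteq> \<infinity>" if "a \<in> range (\<lambda>n. cball 0 (real n))" for a
        using that by (auto simp: cball emeasure_cball)
    qed auto
  qed
  moreover have "(\<integral>\<^sup>+x. f (x + c) \<partial>\<mu>) = (\<integral>\<^sup>+x. f x \<partial>\<mu>)" if [measurable]: "f \<in> borel_measurable borel" for f c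
  proof -
    have "(\<integral>\<^sup>+x. f (x + c) \<partial>\<mu>) = (\<integral>\<^sup>+x. f (T x + c) \<partial>lborel)"
      unfolding \<mu>_def by (rule nn_integral_distr) measurable
    also have "\<dots> = (\<integral>\<^sup>+x. f (T (T c + x)) \<partial>lborel)"
      using T by (simp add: linear_add add.commute)
    also have "\<dots> = (\<integral>\<^sup>+x. f (T x) \<partial>distr lborel borel (\<lambda>x. T c + x))"
      by (rule nn_integral_distr[symmetric]) measurable
    also have "\<dots> = (\<integral>\<^sup>+x. f x \<partial>\<mu>)"
      unfolding \<mu>_def lborel_distr_plus by (rule nn_integral_distr[symmetric]) measurable
    finally show ?thesis .
  qed
  ultimately have *: "emeasure \<mu> A * emeasure lborel (cball (0::'a) 1) = emeasure lborel A * emeasure lborel (cball (0::'a) 1)"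
    if "A \<in> sets borel" for A
    using translation_invariant_measure_unique[of \<mu> A "cball 0 1"] that cball[of 1] by (simp add: mult.commute)
  have "0 < emeasure lborel (cball (0::'a) 1)" "emeasure lborel (cball (0::'a) 1) < \<infinity>"
    by (simp_all add: emeasure_cball ennreal_zero_less_mult_iff)
  then have "emeasure \<mu> A = emeasure lborel A" if "A \<in> sets borel" for A
    using *[OF that] ennreal_mult_divide_eq[of "emeasure lborel (cball (0::'a) 1)"] by (metis infinity_ennreal_def less_irrefl)
  then show ?thesis unfolding \<mu>_def[symmetric] by (intro measure_eqI) auto
qed

text \<open>Householder reflection: x and |x| b have equal norms, so reflecting in the hyperplane
  orthogonal to their difference exchanges them.\<close>

lemma obtain_reflection:
  fixes x b :: "'a::euclidean_space"
  assumes "norm b = 1"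
  obtains T where "linear T" "\<And>y. T (T y) = y" "\<And>y. norm (T y) = norm y" "T x = norm x *\<^sub>R b"
proof (cases "x = norm x *\<^sub>R b")
  case True
  then show ?thesis using that[of "\<lambda>y. y"] linear_id by (auto simp: id_def)
next
  case False
  define w where "w = x - norm x *\<^sub>R b"
  define T where "T = (\<lambda>y. y - (2 * (y \<bullet> w) / (w \<bullet> w)) *\<^sub>R w)"
  have w: "w \<bullet> w \<noteq> 0" using False by (simp add: w_def)
  have lin: "linear T" unfolding T_def
    by (intro linearI) (auto simp: inner_add_left algebra_simps add_divide_distrib)
  have Tw: "T y \<bullet> w = - (y \<bullet> w)" for y
    using w by (simp add: T_def inner_diff_left)
  have inv: "T (T y) = y" for y
  proof -
    have "T (T y) = T y - (2 * (T y \<bullet> w) / (w \<bullet> w)) *\<^sub>R w" by (simp add: T_def)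
    then show ?thesis unfolding Tw by (simp add: T_def)
  qed
  have "T y \<bullet> T y = y \<bullet> y" for y
  proof -
    have "T y \<bullet> T y = T y \<bullet> y - (2 * (y \<bullet> w) / (w \<bullet> w)) * (T y \<bullet> w)"
      unfolding T_def by (simp add: inner_diff_right)
    also have "\<dots> = y \<bullet> y" unfolding Tw by (simp add: T_def inner_diff_left inner_diff_right inner_commute)
    finally show ?thesis .
  qed
  then have nrm: "norm (T y) = norm y" for y by (simp add: norm_eq_sqrt_inner)
  have bb: "b \<bullet> b = 1" using assms by (simp add: norm_eq_sqrt_inner)
  have xx: "x \<bullet> x = (norm x)\<^sup>2" by (simp add: power2_norm_eq_inner)
  have "w \<bullet> w = 2 * (x \<bullet> w)"
    unfolding w_def by (simp add: inner_diff_left inner_diff_right bb xx inner_commute power2_eq_square)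
  then have "T x = norm x *\<^sub>R b" using w by (simp add: T_def w_def)
  with lin inv nrm that show ?thesis by blast
qed

text \<open>The integral of |e - r \<xi>|^(-\<beta>) over \<xi> in the unit sphere, for a unit
  vector e. With \<beta> = N + ps it is an extended-valued version of \<open>Phi\<close>, meaningful
  also for r \<ge> 1 and where the integral diverges.\<close>

definition sphere_kernel :: "nat \<Rightarrow> real \<Rightarrow> real \<Rightarrow> ennreal" where
  "sphere_kernel N \<beta> r = axial_integral N (\<lambda>t. ennreal ((1 - 2 * r * t + r\<^sup>2) powr (- \<beta> / 2)))"

lemma measurable_sphere_kernel [measurable]: "sphere_kernel N \<beta> \<in> borel_measurable borel"
  unfolding sphere_kernel_def[abs_def] by measurable

lemma sphere_kernel_scale:
  assumes "0 < c" "0 \<le> r"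
  shows "axial_integral N (\<lambda>t. ennreal ((c\<^sup>2 - 2 * c * (c * r * t) + (c * r)\<^sup>2) powr (- \<beta> / 2)))
    = ennreal (c powr (- \<beta>)) * sphere_kernel N \<beta> r"
proof -
  have "axial_integral N (\<lambda>t. ennreal ((c\<^sup>2 - 2 * c * (c * r * t) + (c * r)\<^sup>2) powr (- \<beta> / 2))) =
    axial_integral N (\<lambda>t. ennreal (c powr (- \<beta>)) * ennreal ((1 - 2 * r * t + r\<^sup>2) powr (- \<beta> / 2)))"
  proof -
    have "(c\<^sup>2 - 2 * c * (c * r * t) + (c * r)\<^sup>2) powr (- \<beta> / 2) = c powr (- \<beta>) * (1 - 2 * r * t + r\<^sup>2) powr (- \<beta> / 2)" for t
    proof -
      have "(c\<^sup>2 - 2 * c * (c * r * t) + (c * r)\<^sup>2) = c powr 2 * (1 - 2 * r * t + r\<^sup>2)"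
        using assms by (simp add: algebra_simps power2_eq_square)
      then show ?thesis by (simp add: powr_mult powr_powr)
    qed
    then show ?thesis by (simp add: ennreal_mult')
  qed
  also have "\<dots> = ennreal (c powr (- \<beta>)) * sphere_kernel N \<beta> r"
    unfolding sphere_kernel_def by (rule axial_integral_cmult) measurable
  finally show ?thesis .
qed

text \<open>The squared distance between points of radii 1 and r at a given angle is symmetric in
  the radii, so scaling by r exchanges the ratio 1/r with r.\<close>

lemma sphere_kernel_inverse:
  assumes "0 < r"
  shows "sphere_kernel N \<beta> (1 / r) = ennreal (r powr \<beta>) * sphere_kernel N \<beta> r"
proof -
  have "sphere_kernel N \<beta> r = axial_integral N (\<lambda>t. ennreal ((r\<^sup>2 - 2 * r * (r * (1 / r) * t) + (r * (1 / r))\<^sup>2) powr (- \<beta> / 2)))"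
    using assms by (simp add: sphere_kernel_def algebra_simps)
  also have "\<dots> = ennreal (r powr (- \<beta>)) * sphere_kernel N \<beta> (1 / r)"
    using assms by (intro sphere_kernel_scale) auto
  finally have "ennreal (r powr \<beta>) * sphere_kernel N \<beta> r = ennreal (r powr \<beta>) * ennreal (r powr (- \<beta>)) * sphere_kernel N \<beta> (1 / r)"
    by (simp add: mult.assoc)
  also have "ennreal (r powr \<beta>) * ennreal (r powr (- \<beta>)) = 1"
    using assms by (simp add: powr_minus flip: ennreal_mult)
  finally show ?thesis by simp
qed

text \<open>A reflection moves x onto a coordinate axis without changing |y|, so the axial formula
  applies; scaling by |x| then extracts the homogeneity degree N - \<beta>.\<close>

lemma nn_integral_radial_kernel:
  fixes x :: "'a::euclidean_space" and g :: "real \<Rightarrow> ennreal"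
  assumes [measurable]: "g \<in> borel_measurable borel" and x: "x \<noteq> 0"
  shows "(\<integral>\<^sup>+y. g (norm y / norm x) * ennreal (norm (x - y) powr (- \<beta>)) \<partial>lborel) =
    ennreal (norm x powr (real DIM('a) - \<beta>)) *
      (\<integral>\<^sup>+r. g r * ennreal (r ^ (DIM('a) - 1)) * sphere_kernel DIM('a) \<beta> r * indicator {0<..} r \<partial>lborel)"
proof -
  let ?\<Psi> = "sphere_kernel DIM('a) \<beta>"
  obtain b :: 'a where b: "b \<in> Basis" using nonempty_Basis by blast
  then obtain T where T: "linear T" "\<And>y. T (T y) = y" "\<And>y. norm (T y) = norm y" "T x = norm x *\<^sub>R b"
    using obtain_reflection[of b x] by auto
  have "continuous_on UNIV T" using T(1) by (simp add: linear_continuous_on linear_conv_bounded_linear)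
  then have [measurable]: "T \<in> borel_measurable borel" by (rule borel_measurable_continuous_onI)
  define c where "c = norm x"
  have c: "0 < c" using x by (simp add: c_def)
  define F where "F = (\<lambda>(r, a). g (r / c) * ennreal ((c\<^sup>2 - 2 * c * a + r\<^sup>2) powr (- \<beta> / 2)))"
  have [measurable]: "F \<in> borel_measurable (borel \<Otimes>\<^sub>M borel)" unfolding F_def by measurable
  have "(\<integral>\<^sup>+y. g (norm y / norm x) * ennreal (norm (x - y) powr (- \<beta>)) \<partial>lborel) =
    (\<integral>\<^sup>+y. g (norm y / norm x) * ennreal (norm (x - y) powr (- \<beta>)) \<partial>distr lborel borel T)"
    by (simp add: lborel_distr_isometric_involution[OF T(1-3)])
  also have "\<dots> = (\<integral>\<^sup>+y. g (norm y / norm x) * ennreal (norm (c *\<^sub>R b - y) powr (- \<beta>)) \<partial>lborel)"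
  proof -
    have "norm (x - T y) = norm (c *\<^sub>R b - y)" for y
    proof -
      have "T (x - T y) = c *\<^sub>R b - y" using T by (simp add: linear_diff c_def)
      then show ?thesis using T(3)[of "x - T y"] by simp
    qed
    then show ?thesis by (subst nn_integral_distr) (auto simp: T(3))
  qed
  also have "\<dots> = (\<integral>\<^sup>+y. F (norm y, y \<bullet> b) \<partial>lborel)"
  proof (rule nn_integral_cong)
    fix y :: 'a
    have "(norm (c *\<^sub>R b - y))\<^sup>2 = c\<^sup>2 - 2 * c * (y \<bullet> b) + (norm y)\<^sup>2"
      unfolding power2_norm_eq_inner using b
      by (simp add: inner_diff_left inner_diff_right inner_commute power2_eq_square)
    then have "(c\<^sup>2 - 2 * c * (y \<bullet> b) + (norm y)\<^sup>2) powr (- \<beta> / 2) = (norm (c *\<^sub>R b - y) powr 2) powr (- \<beta> / 2)"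
      by simp
    also have "\<dots> = norm (c *\<^sub>R b - y) powr (- \<beta>)" by (subst powr_powr) simp
    finally show "g (norm y / norm x) * ennreal (norm (c *\<^sub>R b - y) powr (- \<beta>)) = F (norm y, y \<bullet> b)"
      by (simp add: F_def c_def)
  qed
  also have "\<dots> = (\<integral>\<^sup>+r. ennreal (r ^ (DIM('a) - 1)) * axial_integral DIM('a) (\<lambda>t. F (r, r * t)) * indicator {0<..} r \<partial>lborel)"
    by (rule nn_integral_axial[OF b]) measurable
  also have "\<dots> = ennreal c * (\<integral>\<^sup>+r. ennreal ((c * r) ^ (DIM('a) - 1)) * axial_integral DIM('a) (\<lambda>t. F (c * r, c * r * t)) * indicator {0<..} (c * r) \<partial>lborel)"
    using c by (subst nn_integral_real_affine[where c=c and t=0]) auto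
  also have "\<dots> = (\<integral>\<^sup>+r. ennreal c * (ennreal ((c * r) ^ (DIM('a) - 1)) * axial_integral DIM('a) (\<lambda>t. F (c * r, c * r * t)) * indicator {0<..} (c * r)) \<partial>lborel)"
    by (rule nn_integral_cmult[symmetric]) measurable
  also have "\<dots> = (\<integral>\<^sup>+r. ennreal (c powr (real DIM('a) - \<beta>)) * (g r * ennreal (r ^ (DIM('a) - 1)) * ?\<Psi> r * indicator {0<..} r) \<partial>lborel)" (is "integral\<^sup>N _ ?f = integral\<^sup>N _ ?g")
  proof (rule nn_integral_cong)
    fix r :: real
    show "?f r = ?g r"
    proof (cases "0 < r")
      case True
      have "axial_integral DIM('a) (\<lambda>t. F (c * r, c * r * t)) = g r * (ennreal (c powr (- \<beta>)) * ?\<Psi> r)"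
        using c True by (subst sphere_kernel_scale[symmetric]) (auto simp: F_def axial_integral_cmult)
      moreover have e: "ennreal c * ennreal ((c * r) ^ (DIM('a) - 1)) * ennreal (c powr (- \<beta>)) = ennreal (c powr (real DIM('a) - \<beta>)) * ennreal (r ^ (DIM('a) - 1))"
      proof -
        have "c * c ^ (DIM('a) - 1) = c powr real DIM('a)" using c by (simp add: powr_realpow power_eq_if)
        then have "c * (c * r) ^ (DIM('a) - 1) * c powr (- \<beta>) = c powr (real DIM('a) - \<beta>) * r ^ (DIM('a) - 1)"
          by (simp add: power_mult_distrib powr_diff powr_minus divide_inverse mult_ac)
        then show ?thesis using c True by (simp flip: ennreal_mult)
      qed
      moreover have "C * (R * (G * (B * S)) * 1) = D * (G * M * S * 1)" if "C * R * B = D * M" for C R G B S D M :: ennreal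
        using arg_cong[OF that, of "\<lambda>z. z * (G * S)"] by (simp add: mult_ac)
      ultimately show ?thesis using True c by simp
    next
      case False
      then show ?thesis using c by (simp add: zero_less_mult_iff)
    qed
  qed
  also have "\<dots> = ennreal (c powr (real DIM('a) - \<beta>)) * (\<integral>\<^sup>+r. g r * ennreal (r ^ (DIM('a) - 1)) * ?\<Psi> r * indicator {0<..} r \<partial>lborel)"
    by (rule nn_integral_cmult) measurable
  finally show ?thesis unfolding c_def .
qed


subsection \<open>The Hardy constant\<close>

text \<open>Extended-valued integrand of the Hardy constant without its factor 2. That factor
  returns later from the two halves |y| < |x| and |x| < |y| of the double integral.\<close>

definition hardy_density :: "nat \<Rightarrow> real \<Rightarrow> real \<Rightarrow> real \<Rightarrow> ennreal" where
  "hardy_density N s p r =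
    ennreal (\<bar>1 - r powr ((real N - p * s) / p)\<bar> powr p * r powr (p * s - 1)) * sphere_kernel N (real N + p * s) r"

definition hardy_mass :: "nat \<Rightarrow> real \<Rightarrow> real \<Rightarrow> real \<Rightarrow> ennreal" where
  "hardy_mass N s p \<theta> = (\<integral>\<^sup>+r. hardy_density N s p r * indicator {0<..<\<theta>} r \<partial>lborel)"

text \<open>With \<open>r = |y| / |x| < \<theta>\<close>, the coefficients of \<open>|u(x)|\<^sup>p\<close> and of \<open>|u(y)|\<^sup>p\<close> after integrating
  out the other variable, up to the factor \<open>|x|\<^sup>-\<^sup>p\<^sup>s\<close> or \<open>|y|\<^sup>-\<^sup>p\<^sup>s\<close>.\<close>
definition inner_mass :: "nat \<Rightarrow> real \<Rightarrow> real \<Rightarrow> real \<Rightarrow> ennreal" where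
  "inner_mass N s p \<theta> = (\<integral>\<^sup>+r. ennreal (\<bar>1 - r powr ((real N - p * s) / p)\<bar> powr (p - 1) *
     r powr (p * s - 1 + (real N - p * s) / p)) * sphere_kernel N (real N + p * s) r * indicator {0<..<\<theta>} r \<partial>lborel)"

definition outer_mass :: "nat \<Rightarrow> real \<Rightarrow> real \<Rightarrow> real \<Rightarrow> ennreal" where
  "outer_mass N s p \<theta> = (\<integral>\<^sup>+r. ennreal (\<bar>1 - r powr ((real N - p * s) / p)\<bar> powr (p - 1) *
     r powr (p * s - 1)) * sphere_kernel N (real N + p * s) r * indicator {0<..<\<theta>} r \<partial>lborel)"

lemma measurable_hardy_density [measurable]: "hardy_density N s p \<in> borel_measurable borel"
  unfolding hardy_density_def[abs_def] by measurable

text \<open>Pulling r^(-\<alpha>) out of |1 - r^(-\<alpha>)| leaves the exponent -\<alpha> (p - 1) +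
  N - 1 of r, which is ps - 1 + \<alpha> because \<alpha> p = N - ps.\<close>

lemma nn_integral_inner_kernel:
  fixes x :: "'a::euclidean_space" and s p \<theta> :: real
  assumes p: "0 < p" and x: "x \<noteq> 0"
  defines "\<alpha> \<equiv> (real DIM('a) - p * s) / p"
  shows "(\<integral>\<^sup>+y. ennreal (\<bar>1 - (norm y / norm x) powr (- \<alpha>)\<bar> powr (p - 1)) *
      ennreal (norm (x - y) powr - (real DIM('a) + p * s)) * indicator {..<\<theta>} (norm y / norm x) \<partial>lborel)
    = ennreal (norm x powr (- (p * s))) * inner_mass DIM('a) s p \<theta>"
proof -
  let ?\<Psi> = "sphere_kernel DIM('a) (real DIM('a) + p * s)"
  let ?n = "real DIM('a)"
  define g where "g = (\<lambda>r. ennreal (\<bar>1 - r powr (- \<alpha>)\<bar> powr (p - 1)) * indicator {..<\<theta>} r)"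
  have [measurable]: "g \<in> borel_measurable borel" unfolding g_def by measurable
  have "(\<integral>\<^sup>+y. ennreal (\<bar>1 - (norm y / norm x) powr (- \<alpha>)\<bar> powr (p - 1)) *
      ennreal (norm (x - y) powr - (?n + p * s)) * indicator {..<\<theta>} (norm y / norm x) \<partial>lborel) =
    (\<integral>\<^sup>+y. g (norm y / norm x) * ennreal (norm (x - y) powr - (?n + p * s)) \<partial>lborel)"
    by (simp add: g_def mult_ac)
  also have "\<dots> = ennreal (norm x powr (?n - (?n + p * s))) *
      (\<integral>\<^sup>+r. g r * ennreal (r ^ (DIM('a) - 1)) * ?\<Psi> r * indicator {0<..} r \<partial>lborel)"
    by (rule nn_integral_radial_kernel[OF _ x]) measurable
  also have "(\<integral>\<^sup>+r. g r * ennreal (r ^ (DIM('a) - 1)) * ?\<Psi> r * indicator {0<..} r \<partial>lborel)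
    = inner_mass DIM('a) s p \<theta>"
    unfolding inner_mass_def
  proof (rule nn_integral_cong)
    fix r :: real
    show "g r * ennreal (r ^ (DIM('a) - 1)) * ?\<Psi> r * indicator {0<..} r =
      ennreal (\<bar>1 - r powr ((?n - p * s) / p)\<bar> powr (p - 1) * r powr (p * s - 1 + (?n - p * s) / p)) *
        ?\<Psi> r * indicator {0<..<\<theta>} r"
    proof (cases "0 < r")
      case True
      have "\<bar>1 - r powr (- \<alpha>)\<bar> = r powr (- \<alpha>) * \<bar>1 - r powr \<alpha>\<bar>"
      proof -
        have "1 - r powr (- \<alpha>) = - (r powr (- \<alpha>) * (1 - r powr \<alpha>))"
          using True by (simp add: right_diff_distrib flip: powr_add)
        then have "\<bar>1 - r powr (- \<alpha>)\<bar> = \<bar>r powr (- \<alpha>) * (1 - r powr \<alpha>)\<bar>" by (simp only: abs_minus_cancel)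
        also have "\<dots> = r powr (- \<alpha>) * \<bar>1 - r powr \<alpha>\<bar>" by (simp add: abs_mult)
        finally show ?thesis .
      qed
      then have "\<bar>1 - r powr (- \<alpha>)\<bar> powr (p - 1) * r ^ (DIM('a) - 1)
        = (r powr (- \<alpha>) * \<bar>1 - r powr \<alpha>\<bar>) powr (p - 1) * r powr real (DIM('a) - 1)"
        using powr_realpow[OF True, of "DIM('a) - 1"] by (simp only:)
      also have "(r powr (- \<alpha>) * \<bar>1 - r powr \<alpha>\<bar>) powr (p - 1) = \<bar>1 - r powr \<alpha>\<bar> powr (p - 1) * r powr (- \<alpha> * (p - 1))"
        by (simp add: powr_mult powr_powr)
      also have "\<dots> * r powr real (DIM('a) - 1) = \<bar>1 - r powr \<alpha>\<bar> powr (p - 1) * (r powr (- \<alpha> * (p - 1)) * r powr real (DIM('a) - 1))"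
        by (rule mult.assoc)
      also have "r powr (- \<alpha> * (p - 1)) * r powr real (DIM('a) - 1) = r powr (p * s - 1 + \<alpha>)"
      proof -
        have "- \<alpha> * (p - 1) + real (DIM('a) - 1) = \<alpha> + ?n - 1 - \<alpha> * p"
          using DIM_positive[where 'a='a] by (simp add: algebra_simps of_nat_diff Suc_leI)
        also have "\<alpha> * p = ?n - p * s" using p by (simp add: \<alpha>_def)
        finally show ?thesis by (simp flip: powr_add add: algebra_simps)
      qed
      finally show ?thesis using True
        by (simp add: g_def indicator_def \<alpha>_def[symmetric] flip: ennreal_mult)
    qed simp
  qed
  finally show ?thesis by simp
qed

text \<open>Now the larger radius is integrated, so |x|/|y| exceeds 1/\<theta>. Inversion brings the
  integral back to (0,\<theta>), and the factor r^(N+ps) from \<open>sphere_kernel_inverse\<close>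
  combines with the Jacobian to r^(ps-1).\<close>

lemma nn_integral_outer_kernel:
  fixes y :: "'a::euclidean_space" and s p \<theta> :: real
  assumes y: "y \<noteq> 0" and \<theta>: "0 < \<theta>"
  defines "\<alpha> \<equiv> (real DIM('a) - p * s) / p"
  shows "(\<integral>\<^sup>+x. ennreal (\<bar>1 - (norm y / norm x) powr \<alpha>\<bar> powr (p - 1)) *
      ennreal (norm (x - y) powr - (real DIM('a) + p * s)) * indicator {..<\<theta>} (norm y / norm x) \<partial>lborel)
    = ennreal (norm y powr (- (p * s))) * outer_mass DIM('a) s p \<theta>"
proof -
  let ?\<Psi> = "sphere_kernel DIM('a) (real DIM('a) + p * s)"
  let ?n = "real DIM('a)"
  define g where "g = (\<lambda>\<rho>. ennreal (\<bar>1 - (1 / \<rho>) powr \<alpha>\<bar> powr (p - 1)) * indicator {..<\<theta>} (1 / \<rho>))"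
  have [measurable]: "g \<in> borel_measurable borel" unfolding g_def by measurable
  have "(\<integral>\<^sup>+x. ennreal (\<bar>1 - (norm y / norm x) powr \<alpha>\<bar> powr (p - 1)) *
      ennreal (norm (x - y) powr - (?n + p * s)) * indicator {..<\<theta>} (norm y / norm x) \<partial>lborel) =
    (\<integral>\<^sup>+x. g (norm x / norm y) * ennreal (norm (y - x) powr - (?n + p * s)) \<partial>lborel)"
    by (simp add: g_def mult_ac norm_minus_commute)
  also have "\<dots> = ennreal (norm y powr (?n - (?n + p * s))) *
      (\<integral>\<^sup>+r. g r * ennreal (r ^ (DIM('a) - 1)) * ?\<Psi> r * indicator {0<..} r \<partial>lborel)"
    by (rule nn_integral_radial_kernel[OF _ y]) measurable
  also have "(\<integral>\<^sup>+r. g r * ennreal (r ^ (DIM('a) - 1)) * ?\<Psi> r * indicator {0<..} r \<partial>lborel)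
    = (\<integral>\<^sup>+r. g (1 / r) * ennreal ((1 / r) ^ (DIM('a) - 1)) * ?\<Psi> (1 / r) * ennreal (1 / r\<^sup>2) * indicator {0<..} r \<partial>lborel)"
    by (rule nn_integral_substitution_inverse) measurable
  also have "\<dots> = outer_mass DIM('a) s p \<theta>"
    unfolding outer_mass_def
  proof (rule nn_integral_cong)
    fix r :: real
    show "g (1 / r) * ennreal ((1 / r) ^ (DIM('a) - 1)) * ?\<Psi> (1 / r) * ennreal (1 / r\<^sup>2) * indicator {0<..} r =
      ennreal (\<bar>1 - r powr ((?n - p * s) / p)\<bar> powr (p - 1) * r powr (p * s - 1)) *
        ?\<Psi> r * indicator {0<..<\<theta>} r"
    proof (cases "0 < r")
      case True
      have "(1 / r) ^ (DIM('a) - 1) * r powr (?n + p * s) * (1 / r\<^sup>2) = r powr (p * s - 1)"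
      proof -
        have "(1 / r) ^ (DIM('a) - 1) = r powr (- real (DIM('a) - 1))"
          using powr_realpow[OF True, of "DIM('a) - 1"] by (simp only: powr_minus_divide power_one_over)
        moreover have "1 / r\<^sup>2 = r powr (- 2)" using True by (simp add: powr_minus inverse_eq_divide)
        moreover have "- real (DIM('a) - 1) + (?n + p * s) + - 2 = p * s - 1"
          using DIM_positive[where 'a='a] by (simp add: of_nat_diff Suc_leI)
        ultimately show ?thesis by (simp flip: powr_add)
      qed
      then have e: "ennreal ((1 / r) ^ (DIM('a) - 1)) * ennreal (r powr (?n + p * s)) * ennreal (1 / r\<^sup>2) = ennreal (r powr (p * s - 1))"
        using True by (simp flip: ennreal_mult)
      have "G * A * (B * S) * C = G * D * S" if "A * B * C = D" for G A B S C D :: ennreal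
        unfolding that[symmetric] by (simp only: mult_ac)
      from this[OF e] show ?thesis using True unfolding sphere_kernel_inverse[OF True]
        by (simp add: g_def indicator_def \<alpha>_def[symmetric] ennreal_mult)
    qed simp
  qed
  finally show ?thesis by simp
qed

text \<open>The outer and inner weights differ by a factor r^\<alpha>, and multiplying by |1 -
  r^\<alpha>| raises the exponent from p - 1 to p. On (0,1) the sign of 1 - r^\<alpha> is that of
  \<alpha>, which decides which mass is the larger.\<close>

lemma mass_balance:
  assumes p: "0 < p" and \<theta>: "\<theta> \<le> 1"
  shows "p * s < real N \<Longrightarrow> outer_mass N s p \<theta> = inner_mass N s p \<theta> + hardy_mass N s p \<theta>"
    and "real N < p * s \<Longrightarrow> inner_mass N s p \<theta> = outer_mass N s p \<theta> + hardy_mass N s p \<theta>"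
proof -
  define \<alpha> where "\<alpha> = (real N - p * s) / p"
  let ?\<Psi> = "sphere_kernel N (real N + p * s)"
  let ?d = "\<lambda>r. \<bar>1 - r powr \<alpha>\<bar>"
  define I where "I = (\<lambda>f. \<integral>\<^sup>+r. ennreal (f r) * ?\<Psi> r * indicator {0<..<\<theta>} r \<partial>lborel)"
  have I_add: "I f = I g + I h" if "g \<in> borel_measurable borel" "h \<in> borel_measurable borel"
    "\<And>r. 0 < r \<Longrightarrow> r < 1 \<Longrightarrow> f r = g r + h r" "\<And>r. 0 \<le> g r" "\<And>r. 0 \<le> h r" for f g h
    unfolding I_def
  proof (subst nn_integral_add[symmetric])
    show "(\<integral>\<^sup>+r. ennreal (f r) * ?\<Psi> r * indicator {0<..<\<theta>} r \<partial>lborel) =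
      (\<integral>\<^sup>+r. ennreal (g r) * ?\<Psi> r * indicator {0<..<\<theta>} r +
        ennreal (h r) * ?\<Psi> r * indicator {0<..<\<theta>} r \<partial>lborel)"
      using \<theta> that(3-5) by (intro nn_integral_cong) (auto simp: indicator_def distrib_right)
  qed (use that(1,2) in measurable)
  have masses: "outer_mass N s p \<theta> = I (\<lambda>r. ?d r powr (p - 1) * r powr (p * s - 1))"
    "inner_mass N s p \<theta> = I (\<lambda>r. ?d r powr (p - 1) * r powr (p * s - 1 + \<alpha>))"
    "hardy_mass N s p \<theta> = I (\<lambda>r. ?d r powr p * r powr (p * s - 1))"
    by (simp_all add: outer_mass_def inner_mass_def hardy_mass_def hardy_density_def I_def \<alpha>_def)
  have split: "z powr p = z * z powr (p - 1)" if "0 \<le> z" for z :: real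
    using that by (simp add: powr_mult_base)
  show "outer_mass N s p \<theta> = inner_mass N s p \<theta> + hardy_mass N s p \<theta>" if "p * s < real N"
    unfolding masses
  proof (rule I_add)
    fix r :: real assume r: "0 < r" "r < 1"
    have "r powr \<alpha> \<le> 1" using r that p by (intro powr_le1) (auto simp: \<alpha>_def)
    then have "?d r powr p = (1 - r powr \<alpha>) * ?d r powr (p - 1)"
      using split[of "?d r"] by simp
    then show "?d r powr (p - 1) * r powr (p * s - 1) =
        ?d r powr (p - 1) * r powr (p * s - 1 + \<alpha>) + ?d r powr p * r powr (p * s - 1)"
      unfolding powr_add[of r "p * s - 1" \<alpha>] by algebra
  qed auto
  show "inner_mass N s p \<theta> = outer_mass N s p \<theta> + hardy_mass N s p \<theta>" if "real N < p * s"
    unfolding masses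
  proof (rule I_add)
    fix r :: real assume r: "0 < r" "r < 1"
    have "\<alpha> < 0" using that p by (simp add: \<alpha>_def divide_neg_pos)
    then have "1 \<le> r powr \<alpha>" using r powr_mono'[of \<alpha> 0 r] by simp
    then have "?d r powr p = (r powr \<alpha> - 1) * ?d r powr (p - 1)"
      using split[of "?d r"] by simp
    then show "?d r powr (p - 1) * r powr (p * s - 1 + \<alpha>) =
        ?d r powr (p - 1) * r powr (p * s - 1) + ?d r powr p * r powr (p * s - 1)"
      unfolding powr_add[of r "p * s - 1" \<alpha>] by algebra
  qed auto
qed

text \<open>For r < \<theta> the factor |1 - r^\<alpha>| is at least d = |1 - \<theta>^\<alpha>| >
  0, so the exponent p - 1 costs only 1/d compared with p and the Hardy mass dominates. The bound
  degenerates as \<theta> tends to 1.\<close>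

lemma outer_mass_finite:
  assumes p: "0 < p" and \<theta>: "0 < \<theta>" "\<theta> < 1" and N: "p * s \<noteq> real N" and fin: "hardy_mass N s p 1 < \<infinity>"
  shows "outer_mass N s p \<theta> < \<infinity>"
proof -
  define \<alpha> where "\<alpha> = (real N - p * s) / p"
  let ?\<Psi> = "sphere_kernel N (real N + p * s)"
  let ?d = "\<lambda>r. \<bar>1 - r powr \<alpha>\<bar>"
  have \<alpha>: "\<alpha> \<noteq> 0" using N p by (simp add: \<alpha>_def)
  define d where "d = \<bar>1 - \<theta> powr \<alpha>\<bar>"
  have "\<theta> powr \<alpha> \<noteq> 1" using \<theta> \<alpha> by (simp add: powr_eq_one_iff_gen)
  then have d: "0 < d" by (simp add: d_def)
  have "d \<le> ?d r" if r: "0 < r" "r < \<theta>" for r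
  proof (cases "0 < \<alpha>")
    case True
    have "r powr \<alpha> \<le> \<theta> powr \<alpha>" "\<theta> powr \<alpha> \<le> 1" using r \<theta> True by (auto intro!: powr_mono2 powr_le1)
    then show ?thesis by (simp add: d_def)
  next
    case False
    have "\<theta> powr \<alpha> \<le> r powr \<alpha>" "1 \<le> \<theta> powr \<alpha>"
      using r \<theta> False powr_mono'[of \<alpha> 0 \<theta>] by (auto intro!: powr_mono2')
    then show ?thesis by (simp add: d_def)
  qed
  note le = this
  have "outer_mass N s p \<theta> \<le> (\<integral>\<^sup>+r. ennreal (1 / d) * (hardy_density N s p r * indicator {0<..<1} r) \<partial>lborel)"
    unfolding outer_mass_def hardy_density_def \<alpha>_def[symmetric]
  proof (rule nn_integral_mono)
    fix r :: real
    show "ennreal (?d r powr (p - 1) * r powr (p * s - 1)) * ?\<Psi> r * indicator {0<..<\<theta>} r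
      \<le> ennreal (1 / d) * (ennreal (?d r powr p * r powr (p * s - 1)) * ?\<Psi> r * indicator {0<..<1} r)"
    proof (cases "r \<in> {0<..<\<theta>}")
      case True
      have "?d r powr (p - 1) * d \<le> ?d r powr (p - 1) * ?d r"
        using le[of r] True by (intro mult_left_mono) auto
      also have "\<dots> = ?d r powr p" by (simp add: powr_mult_base mult.commute)
      finally have "?d r powr (p - 1) \<le> 1 / d * ?d r powr p"
        using d by (simp add: field_simps)
      then have "?d r powr (p - 1) * r powr (p * s - 1) \<le> 1 / d * ?d r powr p * r powr (p * s - 1)"
        by (intro mult_right_mono) auto
      then have "ennreal (?d r powr (p - 1) * r powr (p * s - 1)) \<le> ennreal (1 / d) * ennreal (?d r powr p * r powr (p * s - 1))"
        using d by (simp flip: ennreal_mult add: mult.assoc)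
      from mult_right_mono[OF this, of "?\<Psi> r"] show ?thesis
        using True \<theta> by (simp add: mult.assoc)
    qed auto
  qed
  also have "\<dots> = ennreal (1 / d) * hardy_mass N s p 1"
    unfolding hardy_mass_def by (rule nn_integral_cmult) measurable
  also have "\<dots> < \<infinity>" using fin by (simp add: ennreal_mult_less_top)
  finally show ?thesis .
qed

lemma hardy_mass_mono: "\<theta> \<le> \<theta>' \<Longrightarrow> hardy_mass N s p \<theta> \<le> hardy_mass N s p \<theta>'"
  unfolding hardy_mass_def by (intro nn_integral_mono) (auto simp: indicator_def)

lemma inner_mass_finite:
  assumes p: "0 < p" and \<theta>: "0 < \<theta>" "\<theta> < 1" and N: "p * s \<noteq> real N" and fin: "hardy_mass N s p 1 < \<infinity>"
  shows "inner_mass N s p \<theta> < \<infinity>"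
proof -
  have "hardy_mass N s p \<theta> < \<infinity>" using hardy_mass_mono[of \<theta> 1 N s p] \<theta> fin by (simp add: le_less_trans)
  then show ?thesis
    using outer_mass_finite[OF assms] mass_balance[where p=p and \<theta>=\<theta> and s=s and N=N] p \<theta> N by (cases "p * s < real N") auto
qed


section \<open>Finiteness and positivity of the Hardy mass, and its relation to the Hardy
  constant\<close>

lemma nn_integral_powr_norm_finite:
  fixes \<gamma> R :: real
  assumes \<gamma>: "- real DIM('a) < \<gamma>" and R: "0 \<le> R"
  shows "(\<integral>\<^sup>+z. ennreal (norm z powr \<gamma>) * indicator (cball 0 R) z \<partial>(lborel :: 'a::euclidean_space measure)) < \<infinity>"
proof -
  define N where "N = DIM('a)"
  have N: "1 \<le> N" using DIM_positive[where 'a='a] by (simp add: N_def Suc_leI)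
  let ?e = "(\<gamma> + real N - 1)"
  define c where "c = unit_ball_vol (real N)"
  have c: "0 \<le> c" by (simp add: c_def)
  have "(\<integral>\<^sup>+z. ennreal (norm z powr \<gamma>) * indicator (cball 0 R) z \<partial>(lborel :: 'a measure)) =
    (\<integral>\<^sup>+z. (\<lambda>r. ennreal (r powr \<gamma>) * indicator {..R} r) (norm z) \<partial>(lborel :: 'a measure))"
    by (intro nn_integral_cong) (auto simp: indicator_def)
  also have "\<dots> = (\<integral>\<^sup>+r. ennreal (r powr \<gamma>) * indicator {..R} r * ennreal (c * real N * r ^ (N - 1)) * indicator {0<..} r \<partial>lborel)"
  proof (rule nn_integral_radial)
    fix r :: real assume "0 < r"
    then show "emeasure lborel {x \<in> space lborel. norm (x::'a) \<le> r} = ennreal (c * r ^ N)"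
      using emeasure_cball[of r "0::'a"] by (simp add: cball_def c_def N_def)
  qed (use N c in auto)
  also have "\<dots> \<le> (\<integral>\<^sup>+r. ennreal (c * real N) * (ennreal (r powr ?e) * indicator {0..R} r) \<partial>lborel)" (is "integral\<^sup>N _ ?f \<le> integral\<^sup>N _ ?g")
  proof (rule nn_integral_mono)
    fix r :: real
    show "?f r \<le> ?g r"
    proof (cases "0 < r")
      case True
      have "r ^ (N - 1) = r powr real (N - 1)" using powr_realpow[OF True] by simp
      also have "real (N - 1) = real N - 1" using N by (simp add: of_nat_diff)
      finally have "r powr \<gamma> * (c * real N * r ^ (N - 1)) = c * real N * r powr (\<gamma> + (real N - 1))"
        by (simp add: powr_add)
      then have "ennreal (r powr \<gamma>) * ennreal (c * real N * r ^ (N - 1)) = ennreal (c * real N) * ennreal (r powr ?e)"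
        using c True by (simp flip: ennreal_mult add: add_diff_eq)
      then show ?thesis using True by (auto simp: indicator_def)
    qed auto
  qed
  also have "\<dots> = ennreal (c * real N) * (\<integral>\<^sup>+r. ennreal (r powr ?e) * indicator {0..R} r \<partial>lborel)"
    by (rule nn_integral_cmult) measurable
  also have "(\<integral>\<^sup>+r. ennreal (r powr ?e) * indicator {0..R} r \<partial>lborel) =
     ennreal (R powr (\<gamma> + real N - 1 + 1) / (\<gamma> + real N - 1 + 1))"
  proof -
    have "((\<lambda>r. r powr ?e) has_integral R powr (\<gamma> + real N - 1 + 1) / (\<gamma> + real N - 1 + 1)) {0..R}"
      using \<gamma> R by (intro has_integral_powr_from_0) (auto simp: N_def)
    then have "((\<lambda>r. r powr ?e * indicator {0..R} r) has_integral R powr (\<gamma> + real N - 1 + 1) / (\<gamma> + real N - 1 + 1)) UNIV"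
      by (subst (asm) has_integral_restrict_UNIV[symmetric]) (simp add: indicator_def if_distrib of_bool_def cong: if_cong)
    then have "(\<integral>\<^sup>+r. ennreal (r powr ?e * indicator {0..R} r) \<partial>lborel) = ennreal (R powr (\<gamma> + real N - 1 + 1) / (\<gamma> + real N - 1 + 1))"
      by (intro nn_integral_has_integral_lborel) auto
    moreover have "ennreal (r powr ?e * indicator {0..R} r) = ennreal (r powr ?e) * indicator {0..R} r" for r
      by (auto simp: indicator_def)
    ultimately show ?thesis by simp
  qed
  finally show ?thesis by (simp add: ennreal_mult_less_top le_less_trans flip: ennreal_mult')
qed

text \<open>Undoing the polar coordinates gives an integral over the unit ball with the explicit
  kernel |b - y|^(-N-ps). Finiteness and positivity can be read off from it without estimates for
  \<Phi> near r = 1.\<close>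

lemma hardy_mass_eq_nn_integral:
  fixes b :: "'a::euclidean_space"
  assumes b: "norm b = 1"
  shows "hardy_mass DIM('a) s p 1 = (\<integral>\<^sup>+y. ennreal (\<bar>1 - norm y powr ((real DIM('a) - p * s) / p)\<bar> powr p * norm y powr (p * s - real DIM('a)))
    * indicator {..<1} (norm y) * ennreal (norm (b - y) powr - (real DIM('a) + p * s)) \<partial>lborel)"
proof -
  let ?\<Psi> = "sphere_kernel DIM('a) (real DIM('a) + p * s)"
  let ?n = "real DIM('a)"
  define g where "g = (\<lambda>r. ennreal (\<bar>1 - r powr ((?n - p * s) / p)\<bar> powr p * r powr (p * s - ?n)) * indicator {..<1} r)"
  have [measurable]: "g \<in> borel_measurable borel" unfolding g_def by measurable
  have b0: "b \<noteq> 0" using b by auto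
  have "(\<integral>\<^sup>+y. g (norm y / norm b) * ennreal (norm (b - y) powr - (?n + p * s)) \<partial>lborel) =
    ennreal (norm b powr (?n - (?n + p * s))) *
      (\<integral>\<^sup>+r. g r * ennreal (r ^ (DIM('a) - 1)) * ?\<Psi> r * indicator {0<..} r \<partial>lborel)"
    by (rule nn_integral_radial_kernel[OF _ b0]) measurable
  also have "(\<integral>\<^sup>+r. g r * ennreal (r ^ (DIM('a) - 1)) * ?\<Psi> r * indicator {0<..} r \<partial>lborel)
    = hardy_mass DIM('a) s p 1"
    unfolding hardy_mass_def
  proof (rule nn_integral_cong)
    fix r :: real
    show "g r * ennreal (r ^ (DIM('a) - 1)) * ?\<Psi> r * indicator {0<..} r =
      hardy_density DIM('a) s p r * indicator {0<..<1} r"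
    proof (cases "0 < r")
      case True
      have "r ^ (DIM('a) - 1) = r powr real (DIM('a) - 1)" by (rule powr_realpow[OF True, symmetric])
      also have "real (DIM('a) - 1) = ?n - 1" using DIM_positive[where 'a='a] by (simp add: of_nat_diff Suc_leI)
      finally have "r powr (p * s - ?n) * r ^ (DIM('a) - 1) = r powr (p * s - ?n + (?n - 1))"
        by (simp only: powr_add)
      then have e: "r powr (p * s - ?n) * r ^ (DIM('a) - 1) = r powr (p * s - 1)" by simp
      have "ennreal (A * r powr (p * s - ?n)) * ennreal (r ^ (DIM('a) - 1)) = ennreal (A * r powr (p * s - 1))" if "0 \<le> A" for A
        using True that by (simp flip: e ennreal_mult add: mult.assoc)
      then show ?thesis using True by (auto simp: g_def hardy_density_def indicator_def)
    qed auto
  qed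
  finally show ?thesis using b by (simp add: g_def)
qed

lemma one_minus_powr_le:
  fixes r \<alpha> :: real
  assumes "1/2 \<le> r" "r < 1"
  shows "\<bar>1 - r powr \<alpha>\<bar> \<le> \<bar>\<alpha>\<bar> * 2 powr \<bar>1 - \<alpha>\<bar> * (1 - r)"
proof -
  have "\<And>z. r \<le> z \<Longrightarrow> z \<le> 1 \<Longrightarrow> ((\<lambda>z. z powr \<alpha>) has_real_derivative \<alpha> * z powr (\<alpha> - 1)) (at z)"
    using assms by (auto intro!: derivative_eq_intros)
  from MVT2[OF assms(2) this] obtain z where z: "r < z" "z < 1" "1 powr \<alpha> - r powr \<alpha> = (1 - r) * (\<alpha> * z powr (\<alpha> - 1))"
    by blast
  have "z powr (\<alpha> - 1) = (1 / z) powr (1 - \<alpha>)"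
    using z assms by (simp add: powr_divide powr_diff)
  also have "\<dots> \<le> (1 / z) powr \<bar>1 - \<alpha>\<bar>" using z assms by (intro powr_mono) auto
  also have "\<dots> \<le> 2 powr \<bar>1 - \<alpha>\<bar>" using z assms by (intro powr_mono2) (auto simp: field_simps)
  finally have le: "z powr (\<alpha> - 1) \<le> 2 powr \<bar>1 - \<alpha>\<bar>" .
  have "\<bar>1 - r powr \<alpha>\<bar> = \<bar>\<alpha>\<bar> * z powr (\<alpha> - 1) * (1 - r)" using z assms by (simp add: abs_mult)
  also have "\<dots> \<le> \<bar>\<alpha>\<bar> * 2 powr \<bar>1 - \<alpha>\<bar> * (1 - r)" using le assms by (intro mult_right_mono mult_left_mono) auto
  finally show ?thesis .
qed

text \<open>Near the origin the integrand is bounded by a multiple of |y|^(ps-N) + 1, integrable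
  since ps > 0. Near the sphere |1 - |y|^\<alpha>| is at most a multiple of 1 - |y|, hence of |b -
  y|; this leaves |b - y|^(p-N-ps), integrable since s < 1.\<close>

lemma hardy_mass_finite:
  assumes s: "0 < s" "s < 1" and p: "0 < p"
  shows "hardy_mass DIM('a::euclidean_space) s p 1 < \<infinity>"
proof -
  define N where "N = real DIM('a)"
  have N: "1 \<le> N" using DIM_positive[where 'a='a] by (simp add: N_def Suc_leI)
  define \<alpha> where "\<alpha> = (N - p * s) / p"
  have \<alpha>p: "\<alpha> * p = N - p * s" using p by (simp add: \<alpha>_def)
  let ?L = "(\<bar>\<alpha>\<bar> * 2 powr \<bar>1 - \<alpha>\<bar>)"
  define \<beta> where "\<beta> = N + p * s"
  have ps: "0 < p * s" "p * s < p" using s p by auto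
  obtain b :: 'a where b: "norm b = 1" using norm_Basis nonempty_Basis by blast
  define K where "K = ?L powr p * 2 powr \<bar>p * s - N\<bar>"
  have K: "0 \<le> K" by (simp add: K_def)
  \<comment> \<open>All three are powers of the norm on a ball, so one integrability lemma covers
    them; radius 2 suffices for \<open>f3\<close> because |b - y| < 2 when |y| < 1.\<close>
  define f1 f2 f3 where "f1 = (\<lambda>y::'a. ennreal (norm y powr (p * s - N)) * indicator (cball 0 1) y)"
    "f2 = (\<lambda>y::'a. ennreal (norm y powr 0) * indicator (cball 0 1) y)"
    "f3 = (\<lambda>y::'a. ennreal (norm y powr (p - \<beta>)) * indicator (cball 0 2) y)"
  have [measurable]: "f1 \<in> borel_measurable borel" "f2 \<in> borel_measurable borel" "f3 \<in> borel_measurable borel"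
    unfolding f1_f2_f3_def by (intro borel_measurable_times_ennreal borel_measurable_indicator; simp)+
  have "hardy_mass DIM('a) s p 1 = (\<integral>\<^sup>+y. ennreal (\<bar>1 - norm y powr \<alpha>\<bar> powr p * norm y powr (p * s - N))
    * indicator {..<1} (norm y) * ennreal (norm (b - y) powr - \<beta>) \<partial>lborel)"
    unfolding hardy_mass_eq_nn_integral[OF b] \<alpha>_def N_def \<beta>_def ..
  also have "\<dots> \<le> (\<integral>\<^sup>+y. ennreal (2 powr \<beta>) * (f1 y + f2 y) + ennreal K * f3 (b - y) \<partial>lborel)"
  proof (rule nn_integral_mono)
    fix y :: 'a
    define r where "r = norm y"
    have r: "0 \<le> r" by (simp add: r_def)
    have tri: "1 - r \<le> norm (b - y)" "norm (b - y) \<le> 1 + r"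
      using norm_triangle_ineq2[of b y] norm_triangle_ineq4[of b y] b by (auto simp: r_def)
    consider "y = 0 \<or> 1 \<le> r" | "0 < r" "r < 1/2" | "1/2 \<le> r" "r < 1" using r by (fastforce simp: r_def)
    then show "ennreal (\<bar>1 - norm y powr \<alpha>\<bar> powr p * norm y powr (p * s - N)) * indicator {..<1} (norm y) * ennreal (norm (b - y) powr - \<beta>)
      \<le> ennreal (2 powr \<beta>) * (f1 y + f2 y) + ennreal K * f3 (b - y)"
    proof cases
      case 1
      \<comment> \<open>The left side is 0: outside the ball by the indicator, at the origin because
        \<open>0 powr a = 0\<close>.\<close>
      then show ?thesis by (auto simp: r_def)
    next
      case 2
      have "\<bar>1 - r powr \<alpha>\<bar> powr p \<le> 1 + r powr (\<alpha> * p)"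
      proof (cases "r powr \<alpha> \<le> 1")
        case True
        then have "\<bar>1 - r powr \<alpha>\<bar> powr p \<le> 1" using p by (intro powr_le1) auto
        then show ?thesis by (simp add: add_increasing2)
      next
        case False
        then have "\<bar>1 - r powr \<alpha>\<bar> powr p \<le> (r powr \<alpha>) powr p" using p by (intro powr_mono2) auto
        then show ?thesis by (simp add: powr_powr)
      qed
      then have "\<bar>1 - r powr \<alpha>\<bar> powr p * r powr (p * s - N) \<le> (1 + r powr (\<alpha> * p)) * r powr (p * s - N)"
        by (intro mult_right_mono) auto
      also have "\<dots> = r powr (p * s - N) + r powr 0"
        using 2 by (simp add: distrib_right \<alpha>p flip: powr_add)
      finally have 3: "\<bar>1 - r powr \<alpha>\<bar> powr p * r powr (p * s - N) \<le> r powr (p * s - N) + r powr 0" .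
      have "norm (b - y) powr - \<beta> \<le> (1/2) powr - \<beta>"
        using tri 2 N ps by (intro powr_mono2') (auto simp: \<beta>_def)
      also have "(1/2) powr - \<beta> = 2 powr \<beta>" by (simp add: powr_minus powr_divide)
      finally have "\<bar>1 - r powr \<alpha>\<bar> powr p * r powr (p * s - N) * norm (b - y) powr - \<beta> \<le> (r powr (p * s - N) + r powr 0) * 2 powr \<beta>"
        using 3 by (intro mult_mono) auto
      then have "ennreal (\<bar>1 - r powr \<alpha>\<bar> powr p * r powr (p * s - N)) * ennreal (norm (b - y) powr - \<beta>) \<le> ennreal (2 powr \<beta>) * (ennreal (r powr (p * s - N)) + ennreal (r powr 0))"
        by (simp flip: ennreal_mult ennreal_plus add: mult.commute)
      also have "\<dots> = ennreal (2 powr \<beta>) * (f1 y + f2 y)" using 2 by (simp add: f1_f2_f3_def r_def)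
      finally show ?thesis using 2 by (simp add: r_def[symmetric] add_increasing2)
    next
      case 3
      have "\<bar>1 - r powr \<alpha>\<bar> \<le> \<bar>\<alpha>\<bar> * 2 powr \<bar>1 - \<alpha>\<bar> * (1 - r)" using 3 by (intro one_minus_powr_le) auto
      also have "\<dots> \<le> \<bar>\<alpha>\<bar> * 2 powr \<bar>1 - \<alpha>\<bar> * norm (b - y)" using tri by (intro mult_left_mono) auto
      finally have "\<bar>1 - r powr \<alpha>\<bar> powr p \<le> (\<bar>\<alpha>\<bar> * 2 powr \<bar>1 - \<alpha>\<bar> * norm (b - y)) powr p" using p by (intro powr_mono2) auto
      also have "\<dots> = ?L powr p * norm (b - y) powr p" by (rule powr_mult; simp)
      finally have 4: "\<bar>1 - r powr \<alpha>\<bar> powr p \<le> ?L powr p * norm (b - y) powr p" .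
      have "r powr (p * s - N) = (1 / r) powr (N - p * s)" using 3 by (simp add: powr_divide powr_diff)
      also have "\<dots> \<le> (1 / r) powr \<bar>p * s - N\<bar>" using 3 by (intro powr_mono) auto
      also have "\<dots> \<le> 2 powr \<bar>p * s - N\<bar>" using 3 by (intro powr_mono2) (auto simp: field_simps)
      finally have "\<bar>1 - r powr \<alpha>\<bar> powr p * r powr (p * s - N) * norm (b - y) powr - \<beta> \<le>
        (?L powr p * norm (b - y) powr p) * 2 powr \<bar>p * s - N\<bar> * norm (b - y) powr - \<beta>"
        using 4 by (intro mult_mono) auto
      also have "\<dots> = K * (norm (b - y) powr p * norm (b - y) powr - \<beta>)" by (simp add: K_def mult_ac)
      also have "\<dots> = K * norm (b - y) powr (p - \<beta>)" by (simp flip: powr_add)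
      finally have "ennreal (\<bar>1 - r powr \<alpha>\<bar> powr p * r powr (p * s - N)) * ennreal (norm (b - y) powr - \<beta>) \<le> ennreal K * ennreal (norm (b - y) powr (p - \<beta>))"
        using K by (simp flip: ennreal_mult)
      also have "\<dots> = ennreal K * f3 (b - y)" using 3 tri by (simp add: f1_f2_f3_def)
      finally show ?thesis using 3 by (simp add: r_def[symmetric] add_increasing)
    qed
  qed
  also have "\<dots> = ennreal (2 powr \<beta>) * ((\<integral>\<^sup>+y. f1 y \<partial>lborel) + (\<integral>\<^sup>+y. f2 y \<partial>lborel)) + ennreal K * (\<integral>\<^sup>+y. f3 (b - y) \<partial>lborel)"
    by (simp add: nn_integral_add nn_integral_cmult)
  also have "(\<integral>\<^sup>+y. f3 (b - y) \<partial>lborel) = (\<integral>\<^sup>+y. f3 y \<partial>lborel)" by (rule nn_integral_lborel_reflect) measurable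
  also have "ennreal (2 powr \<beta>) * ((\<integral>\<^sup>+y. f1 y \<partial>lborel) + (\<integral>\<^sup>+y. f2 y \<partial>lborel)) + ennreal K * (\<integral>\<^sup>+y. f3 y \<partial>lborel) < \<infinity>"
  proof -
    have "(\<integral>\<^sup>+y. f1 y \<partial>lborel) < \<infinity>" "(\<integral>\<^sup>+y. f2 y \<partial>lborel) < \<infinity>" "(\<integral>\<^sup>+y. f3 y \<partial>lborel) < \<infinity>"
      unfolding f1_f2_f3_def using N ps by (intro nn_integral_powr_norm_finite; simp add: N_def \<beta>_def)+
    then show ?thesis by (simp add: ennreal_mult_less_top)
  qed
  finally show ?thesis .
qed

text \<open>With \<alpha> nonzero the integrand is positive on the punctured unit ball. Positivity
  allows division by the Hardy constant when the seminorm is used to bound the Hardy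
  integral.\<close>

lemma hardy_mass_pos:
  assumes p: "0 < p" and N: "p * s \<noteq> real DIM('a::euclidean_space)"
  shows "0 < hardy_mass DIM('a) s p 1"
proof (rule ccontr)
  assume "\<not> 0 < hardy_mass DIM('a) s p 1"
  then have 0: "hardy_mass DIM('a) s p 1 = 0" by simp
  obtain b :: 'a where b: "norm b = 1" using norm_Basis nonempty_Basis by blast
  define \<alpha> where "\<alpha> = (real DIM('a) - p * s) / p"
  have \<alpha>: "\<alpha> \<noteq> 0" using N p by (simp add: \<alpha>_def)
  have "AE y in lborel. ennreal (\<bar>1 - norm y powr \<alpha>\<bar> powr p * norm y powr (p * s - real DIM('a)))
    * indicator {..<1} (norm y) * ennreal (norm (b - y) powr - (real DIM('a) + p * s)) = 0"
    using 0 unfolding hardy_mass_eq_nn_integral[OF b] \<alpha>_def by (subst (asm) nn_integral_0_iff_AE) auto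
  then have "AE y :: 'a in lborel. y \<in> {0} \<union> - ball 0 1"
  proof (rule eventually_mono)
    fix y :: 'a
    assume *: "ennreal (\<bar>1 - norm y powr \<alpha>\<bar> powr p * norm y powr (p * s - real DIM('a)))
      * indicator {..<1} (norm y) * ennreal (norm (b - y) powr - (real DIM('a) + p * s)) = 0"
    show "y \<in> {0} \<union> - ball 0 1"
    proof (rule ccontr)
      assume "y \<notin> {0} \<union> - ball 0 1"
      then have y: "y \<noteq> 0" "norm y < 1" by auto
      then have "norm y powr \<alpha> \<noteq> 1" using \<alpha> by (simp add: powr_eq_one_iff_gen)
      moreover have "b \<noteq> y" using y b by auto
      ultimately show False using * y by simp
    qed
  qed
  moreover have "AE y :: 'a in lborel. y \<noteq> 0" by (rule AE_lborel_singleton)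
  ultimately have "AE y :: 'a in lborel. y \<notin> ball 0 1" by eventually_elim auto
  then have "emeasure lborel (ball (0::'a) 1) = 0" by (subst (asm) AE_iff_measurable[OF _ refl]) (auto simp: ball_def)
  then show False using unit_ball_vol_pos[of "real DIM('a)"] by (simp add: emeasure_ball)
qed

text \<open>Finiteness matters because the Bochner integral in \<open>Phi\<close> is 0 by convention
  for a non-integrable integrand. For N = 1 the quadratic at t = 1 and t = -1 is the square of 1 - r
  and of 1 + r.\<close>

lemma Phi_eq_sphere_kernel:
  assumes r: "0 < r" "r < 1" and N: "1 \<le> N" and fin: "sphere_kernel N (real N + p * s) r < \<infinity>"
  shows "0 \<le> Phi N s p r" "ennreal (Phi N s p r) = sphere_kernel N (real N + p * s) r"
proof -
  have "0 \<le> Phi N s p r \<and> ennreal (Phi N s p r) = sphere_kernel N (real N + p * s) r"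
  proof (cases "N = 1")
    case True
    have half: "2 * (x / 2) = x" for x :: real by simp
    have "((1 - r) powr 2) powr (- (1 + p * s) / 2) = (1 - r) powr (- 1 - p * s)"
      "((1 + r) powr 2) powr (- (1 + p * s) / 2) = (1 + r) powr (- 1 - p * s)"
      unfolding powr_powr half by simp_all
    moreover have "1 - 2 * r + r\<^sup>2 = (1 - r) powr 2" "1 + 2 * r + r\<^sup>2 = (1 + r) powr 2"
      using r by (simp_all add: power2_eq_square algebra_simps)
    ultimately show ?thesis using True
      by (simp add: Phi_def sphere_kernel_def axial_integral_def)
  next
    case False
    then have N2: "2 \<le> N" using N by simp
    define m where "m = (real N - 1) / 2"
    have "0 < m" using N2 by (simp add: m_def)
    then have S: "0 < sphere_area N" unfolding sphere_area_def m_def[symmetric] by (simp add: Gamma_real_pos)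
    define h where "h = (\<lambda>t. (1 - t\<^sup>2) powr ((real N - 3) / 2) * (1 - 2 * r * t + r\<^sup>2) powr (- (real N + p * s) / 2))"
    have [measurable]: "h \<in> borel_measurable borel" unfolding h_def by measurable
    have h: "0 \<le> h t" for t by (simp add: h_def)
  let ?I = "(\<integral>\<^sup>+t. ennreal (indicator {-1<..<1} t * h t) \<partial>lborel)"
  let ?J = "(\<integral>t. indicator {-1<..<1} t * h t \<partial>lborel)"
    have nn: "?I =
      (\<integral>\<^sup>+t. ennreal ((1 - t\<^sup>2) powr ((real N - 3) / 2)) * ennreal ((1 - 2 * r * t + r\<^sup>2) powr (- (real N + p * s) / 2)) * indicator {-1<..<1} t \<partial>lborel)"
      by (intro nn_integral_cong) (auto simp: h_def indicator_def ennreal_mult)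
    have sk: "sphere_kernel N (real N + p * s) r = ennreal (sphere_area N) * ?I"
      unfolding nn using False by (simp add: sphere_kernel_def axial_integral_def)
    with fin S have fin': "?I < \<infinity>"
      by (auto simp: ennreal_mult_less_top)
    have "integrable lborel (\<lambda>t. indicator {-1<..<1} t * h t)"
      using fin' h by (intro integrableI_nonneg) auto
    then have "?I = ennreal ?J"
      using h by (intro nn_integral_eq_integral) auto
    moreover have "Phi N s p r = sphere_area N * ?J"
    proof -
      have "einterval (- 1) 1 = {-1<..<1}"
        using einterval_eq(1)[of "-1" 1] by (simp add: one_ereal_def)
      moreover have "(- 1 :: ereal) \<le> 1" by (simp add: one_ereal_def)
      ultimately show ?thesis using False
        by (simp add: Phi_def h_def interval_lebesgue_integral_def set_lebesgue_integral_def)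
    qed
    moreover have "0 \<le> ?J" using h by (intro integral_nonneg_AE) auto
    ultimately show ?thesis using S sk by (simp add: ennreal_mult)
  qed
  then show "0 \<le> Phi N s p r" "ennreal (Phi N s p r) = sphere_kernel N (real N + p * s) r" by auto
qed

lemma measurable_Phi [measurable]: "Phi N s p \<in> borel_measurable borel"
proof (cases "N = 1")
  case True
  then show ?thesis unfolding Phi_def[abs_def] by simp
next
  case False
  then show ?thesis
    unfolding Phi_def[abs_def] interval_lebesgue_integral_def set_lebesgue_integral_def by simp
qed

text \<open>A finite mass makes the density finite almost everywhere. Its prefactor is positive on
  (0,1) since \<alpha> is nonzero, so the kernel itself is finite almost everywhere and agrees there
  with \<open>Phi\<close>.\<close>

lemma hardy_const_eq:
  assumes s: "0 < s" "s < 1" and p: "0 < p" and N: "p * s \<noteq> real DIM('a::euclidean_space)"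
  shows "ennreal (hardy_const DIM('a) s p) = 2 * hardy_mass DIM('a) s p 1"
proof -
  define F where "F = (\<lambda>r. r powr (p * s - 1) * \<bar>1 - r powr ((real DIM('a) - p * s) / p)\<bar> powr p * Phi DIM('a) s p r)"
  let ?F = "\<lambda>r. indicator {0<..<1} r * F r"
  let ?h = "\<lambda>r. hardy_density DIM('a) s p r * indicator {0<..<1} r"
  have [measurable]: "F \<in> borel_measurable borel" unfolding F_def by measurable
  have fin: "hardy_mass DIM('a) s p 1 < \<infinity>" by (rule hardy_mass_finite[OF s p])
  have "AE r in lborel. ?h r \<noteq> \<infinity>"
    using fin unfolding hardy_mass_def by (intro nn_integral_PInf_AE) auto
  then have AE: "AE r in lborel. 0 \<le> ?F r \<and>
    ennreal (?F r) = ?h r"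
  proof (rule eventually_mono)
    fix r :: real assume *: "?h r \<noteq> \<infinity>"
    show "0 \<le> ?F r \<and>
      ennreal (?F r) = ?h r"
    proof (cases "r \<in> {0<..<1}")
      case True
      then have r: "0 < r" "r < 1" by auto
      have "r powr ((real DIM('a) - p * s) / p) \<noteq> 1" using r N p by (simp add: powr_eq_one_iff_gen)
      then have "0 < \<bar>1 - r powr ((real DIM('a) - p * s) / p)\<bar> powr p * r powr (p * s - 1)"
        using r by simp
      then have "sphere_kernel DIM('a) (real DIM('a) + p * s) r < \<infinity>"
        using * True by (auto simp: hardy_density_def ennreal_mult_eq_top_iff less_top)
      from Phi_eq_sphere_kernel[OF r _ this] DIM_positive[where 'a='a]
      have "0 \<le> Phi DIM('a) s p r" "ennreal (Phi DIM('a) s p r) = sphere_kernel DIM('a) (real DIM('a) + p * s) r"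
        by (auto simp: Suc_leI)
      then show ?thesis using True by (simp add: F_def hardy_density_def ennreal_mult mult_ac)
    qed auto
  qed
  have "einterval 0 1 = {0<..<1::real}"
    using einterval_eq(1)[of 0 1] by (simp add: one_ereal_def zero_ereal_def)
  then have hc: "hardy_const DIM('a) s p = 2 * (\<integral>r. ?F r \<partial>lborel)"
    by (simp add: hardy_const_def F_def interval_lebesgue_integral_def set_lebesgue_integral_def)
  have nn: "(\<integral>\<^sup>+r. ennreal (?F r) \<partial>lborel) = hardy_mass DIM('a) s p 1"
    unfolding hardy_mass_def using AE by (intro nn_integral_cong_AE) auto
  have "integrable lborel (\<lambda>r. ?F r)"
    using AE fin nn by (intro integrableI_nonneg) auto
  then have "(\<integral>\<^sup>+r. ennreal (?F r) \<partial>lborel) = ennreal (\<integral>r. ?F r \<partial>lborel)"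
    using AE by (intro nn_integral_eq_integral) auto
  moreover have "0 \<le> (\<integral>r. ?F r \<partial>lborel)" using AE by (intro integral_nonneg_AE) auto
  ultimately show ?thesis unfolding hc nn by (simp add: ennreal_mult)
qed


subsection \<open>Scale-invariant truncation\<close>

text \<open>Excluding y = 0 makes |y|/|x| positive, away from the default value of
  \<open>powr\<close> at 0; the strict inequality also forces x to be nonzero.\<close>

definition sector :: "real \<Rightarrow> ('a::euclidean_space \<times> 'a) set" where
  "sector \<theta> = {(x, y). y \<noteq> 0 \<and> norm y < \<theta> * norm x}"

lemma sets_sector [measurable]: "sector \<theta> \<in> sets (borel \<Otimes>\<^sub>M borel)"
proof -
  have "sector \<theta> = {z \<in> space (borel \<Otimes>\<^sub>M borel). snd z \<noteq> (0::'a) \<and> norm (snd z) < \<theta> * norm (fst z)}"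
    by (auto simp: sector_def space_pair_measure)
  also have "\<dots> \<in> sets (borel \<Otimes>\<^sub>M borel)" by measurable
  finally show ?thesis .
qed

abbreviation jointly_measurable :: "('a::topological_space \<Rightarrow> 'b::topological_space \<Rightarrow> 'c::topological_space) \<Rightarrow> bool" where
  "jointly_measurable F \<equiv> (\<lambda>z. F (fst z) (snd z)) \<in> borel_measurable (borel \<Otimes>\<^sub>M borel)"

definition sector_integral :: "real \<Rightarrow> real \<Rightarrow> ('a::euclidean_space \<Rightarrow> 'a \<Rightarrow> ennreal) \<Rightarrow> ennreal" where
  "sector_integral \<beta> \<theta> F = (\<integral>\<^sup>+z. F (fst z) (snd z) * ennreal (norm (fst z - snd z) powr - \<beta>) * indicator (sector \<theta>) z
     \<partial>(lborel \<Otimes>\<^sub>M lborel))"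

lemma sector_integral_add:
  assumes [measurable]: "jointly_measurable F"
    "jointly_measurable G"
  shows "sector_integral \<beta> \<theta> (\<lambda>x y. F x y + G x y) = sector_integral \<beta> \<theta> F + sector_integral \<beta> \<theta> G"
  unfolding sector_integral_def by (simp add: distrib_right nn_integral_add)

lemma sector_integral_cmult:
  assumes [measurable]: "jointly_measurable F"
  shows "sector_integral \<beta> \<theta> (\<lambda>x y. c * F x y) = c * sector_integral \<beta> \<theta> F"
  unfolding sector_integral_def by (simp add: mult.assoc nn_integral_cmult)

lemma sector_integral_mono:
  assumes "\<And>x y. (x, y) \<in> sector \<theta> \<Longrightarrow> F x y \<le> G x y"
  shows "sector_integral \<beta> \<theta> F \<le> sector_integral \<beta> \<theta> G"
  unfolding sector_integral_def using assms
  by (intro nn_integral_mono) (auto simp: indicator_def intro!: mult_right_mono)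

lemma sector_integral_cong:
  assumes "\<And>x y. (x, y) \<in> sector \<theta> \<Longrightarrow> F x y = G x y"
  shows "sector_integral \<beta> \<theta> F = sector_integral \<beta> \<theta> G"
  using assms by (intro antisym sector_integral_mono) auto

lemma nn_integral_lborel_pair:
  fixes F :: "'a::euclidean_space \<Rightarrow> 'a \<Rightarrow> ennreal"
  assumes [measurable]: "jointly_measurable F"
  shows "(\<integral>\<^sup>+z. F (fst z) (snd z) \<partial>(lborel \<Otimes>\<^sub>M lborel)) = (\<integral>\<^sup>+x. \<integral>\<^sup>+y. F x y \<partial>lborel \<partial>lborel)"
    and "(\<integral>\<^sup>+z. F (fst z) (snd z) \<partial>(lborel \<Otimes>\<^sub>M lborel)) = (\<integral>\<^sup>+y. \<integral>\<^sup>+x. F x y \<partial>lborel \<partial>lborel)"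
  using lborel.nn_integral_fst[of "\<lambda>z. F (fst z) (snd z)" lborel]
    lborel_pair.nn_integral_snd[of "\<lambda>z. F (fst z) (snd z)"] by simp_all

lemma AE_norm_neq: "AE y in lborel. norm (y::'a::euclidean_space) \<noteq> c"
proof -
  have "negligible (sphere (0::'a) c)" by (rule negligible_sphere)
  then have "sphere (0::'a) c \<in> null_sets lborel"
    by (auto simp: null_sets_completion_iff negligible_iff_null_sets)
  from AE_not_in[OF this] show ?thesis by eventually_elim auto
qed

text \<open>Up to the null sets |x| = |y|, x = 0 and y = 0, the product space is the disjoint union
  of the sector with \<theta> = 1 and its mirror image, which contribute equally.\<close>

lemma sector_integral_symmetric:
  fixes F :: "'a::euclidean_space \<Rightarrow> 'a \<Rightarrow> ennreal"
  assumes F [measurable]: "jointly_measurable F"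
    and sym: "\<And>x y. F x y = F y x"
  shows "(\<integral>\<^sup>+x. \<integral>\<^sup>+y. F x y * ennreal (norm (x - y) powr - \<beta>) \<partial>lborel \<partial>lborel) = 2 * sector_integral \<beta> 1 F"
proof -
  let ?D = "indicator (sector 1)"
  define h where "h = (\<lambda>x y. F x y * ennreal (norm (x - y) powr - \<beta>))"
  have hsym: "h x y = h y x" for x y unfolding h_def using sym[of x y] by (simp add: norm_minus_commute)
  have h [measurable]: "jointly_measurable h"
    unfolding h_def by measurable
  have [measurable]: "(\<lambda>z. (snd z, fst z)) \<in> borel \<Otimes>\<^sub>M (borel :: 'a measure) \<rightarrow>\<^sub>M borel \<Otimes>\<^sub>M (borel :: 'a measure)"
    by measurable
  have [measurable]: "(\<lambda>z. ?D z :: ennreal) \<in> borel_measurable (borel \<Otimes>\<^sub>M (borel :: 'a measure))"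
    by measurable
  have [measurable]: "(\<lambda>z. ?D (snd z, fst z) :: ennreal) \<in> borel_measurable (borel \<Otimes>\<^sub>M (borel :: 'a measure))"
    by (rule measurable_compose[where f="\<lambda>z. (snd z, fst z)" and N="borel \<Otimes>\<^sub>M borel"]) measurable
  have 1: "sector_integral \<beta> 1 F = (\<integral>\<^sup>+x. \<integral>\<^sup>+y. h x y * ?D (x, y) \<partial>lborel \<partial>lborel)"
    unfolding sector_integral_def h_def[symmetric]
    using nn_integral_lborel_pair(1)[of "\<lambda>x y. h x y * ?D (x, y)"] by (simp add: h_def)
  have 2: "sector_integral \<beta> 1 F = (\<integral>\<^sup>+x. \<integral>\<^sup>+y. h x y * ?D (y, x) \<partial>lborel \<partial>lborel)"
  proof -
    have "(\<integral>\<^sup>+x. \<integral>\<^sup>+y. h x y * ?D (y, x) \<partial>lborel \<partial>lborel) =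
      (\<integral>\<^sup>+y. \<integral>\<^sup>+x. h x y * ?D (y, x) \<partial>lborel \<partial>lborel)"
      using nn_integral_lborel_pair[of "\<lambda>x y. h x y * ?D (y, x)"] by simp
    then show ?thesis unfolding 1 by (simp add: hsym)
  qed
  have "(\<integral>\<^sup>+x. \<integral>\<^sup>+y. h x y \<partial>lborel \<partial>lborel) =
    (\<integral>\<^sup>+x. (\<integral>\<^sup>+y. h x y * ?D (x, y) \<partial>lborel) + (\<integral>\<^sup>+y. h x y * ?D (y, x) \<partial>lborel) \<partial>lborel)"
  proof (rule nn_integral_cong_AE)
    have "AE x in lborel. x \<noteq> (0::'a)" by (rule AE_lborel_singleton)
    then show "AE x in lborel. (\<integral>\<^sup>+y. h x y \<partial>lborel) = (\<integral>\<^sup>+y. h x y * ?D (x, y) \<partial>lborel) + (\<integral>\<^sup>+y. h x y * ?D (y, x) \<partial>lborel)" (is "AE x in lborel. ?P x")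
    proof (rule eventually_mono)
      fix x :: 'a assume x: "x \<noteq> 0"
      have [measurable]: "(\<lambda>y. h x y) \<in> borel_measurable lborel"
        using measurable_compose[OF measurable_Pair1'[of x borel borel] h] by simp
      have [measurable]: "(\<lambda>y. ?D (x, y) :: ennreal) \<in> borel_measurable lborel"
        "(\<lambda>y. ?D (y, x) :: ennreal) \<in> borel_measurable lborel"
        by measurable
      have "(\<integral>\<^sup>+y. h x y \<partial>lborel) = (\<integral>\<^sup>+y. h x y * ?D (x, y) + h x y * ?D (y, x) \<partial>lborel)"
        using AE_norm_neq[of "norm x"] AE_lborel_singleton[of "0::'a"]
        by (intro nn_integral_cong_AE, eventually_elim) (use x in \<open>auto simp: sector_def indicator_def\<close>)
      also have "\<dots> = (\<integral>\<^sup>+y. h x y * ?D (x, y) \<partial>lborel) + (\<integral>\<^sup>+y. h x y * ?D (y, x) \<partial>lborel)"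
        by (rule nn_integral_add) measurable
      finally show "?P x" .
    qed
  qed
  also have "\<dots> = sector_integral \<beta> 1 F + sector_integral \<beta> 1 F"
  proof -
    have [measurable]: "(\<lambda>(x, y). h x y * ?D (x, y)) \<in> borel_measurable (borel \<Otimes>\<^sub>M borel)"
       "(\<lambda>(x, y). h x y * ?D (y, x)) \<in> borel_measurable (borel \<Otimes>\<^sub>M borel)"
      unfolding case_prod_beta' by measurable
    show ?thesis by (subst nn_integral_add) (auto simp flip: 1 2)
  qed
  finally show ?thesis unfolding h_def by (simp add: mult_2)
qed

lemma sector_integral_SUP:
  fixes F :: "'a::euclidean_space \<Rightarrow> 'a \<Rightarrow> ennreal"
  assumes [measurable]: "jointly_measurable F"
    and \<theta>: "incseq \<theta>" "\<And>n. \<theta> n < 1" "\<theta> \<longlonglongrightarrow> 1"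
  shows "sector_integral \<beta> 1 F = (SUP n. sector_integral \<beta> (\<theta> n) F)"
    and "incseq (\<lambda>n. sector_integral \<beta> (\<theta> n) F)"
proof -
  have mono: "sector a \<subseteq> (sector b :: ('a \<times> 'a) set)" if "a \<le> b" for a b
  proof (clarsimp simp: sector_def)
    fix x y :: 'a assume "norm y < a * norm x"
    also have "\<dots> \<le> b * norm x" using that by (intro mult_right_mono) auto
    finally show "norm y < b * norm x" .
  qed
  have inc: "incseq (\<lambda>n. sector (\<theta> n) :: ('a \<times> 'a) set)"
    using \<theta>(1) by (auto simp: incseq_def intro!: mono)
  have "(\<Union>n. sector (\<theta> n)) = (sector 1 :: ('a \<times> 'a) set)"
  proof
    show "(\<Union>n. sector (\<theta> n)) \<subseteq> (sector 1 :: ('a \<times> 'a) set)"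
      using \<theta>(2) by (intro UN_least mono) (simp add: less_imp_le)
    show "(sector 1 :: ('a \<times> 'a) set) \<subseteq> (\<Union>n. sector (\<theta> n))"
    proof
      fix z :: "'a \<times> 'a" assume "z \<in> sector 1"
      then obtain x y where z: "z = (x, y)" "y \<noteq> 0" "norm y < norm x" by (auto simp: sector_def)
      have x: "0 < norm x" using z(3) norm_ge_zero[of y] by linarith
      then have "norm y / norm x < 1" using z by simp
      then obtain n where "norm y / norm x < \<theta> n"
        using order_tendstoD(1)[OF \<theta>(3)] by (auto simp: eventually_sequentially)
      then show "z \<in> (\<Union>n. sector (\<theta> n))" using x z by (auto simp: sector_def field_simps)
    qed
  qed
  then show "sector_integral \<beta> 1 F = (SUP n. sector_integral \<beta> (\<theta> n) F)"
    unfolding sector_integral_def using inc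
    by (subst nn_integral_indicator_Union[symmetric]) auto
  show "incseq (\<lambda>n. sector_integral \<beta> (\<theta> n) F)"
  proof (rule monoI)
    fix m n :: nat assume "m \<le> n"
    with inc have "sector (\<theta> m) \<subseteq> (sector (\<theta> n) :: ('a \<times> 'a) set)" by (simp add: incseq_def)
    then show "sector_integral \<beta> (\<theta> m) F \<le> sector_integral \<beta> (\<theta> n) F"
      unfolding sector_integral_def by (intro nn_integral_mono mult_left_mono) (auto simp: indicator_def)
  qed
qed

lemma hardy_mass_SUP:
  assumes \<theta>: "incseq \<theta>" "\<And>n. \<theta> n < 1" "\<theta> \<longlonglongrightarrow> 1"
  shows "hardy_mass N s p 1 = (SUP n. hardy_mass N s p (\<theta> n))"
proof -
  have "(\<Union>n. {0<..<\<theta> n}) = {0<..<1}"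
  proof
    show "(\<Union>n. {0<..<\<theta> n}) \<subseteq> {0<..<1}" using \<theta>(2) by (force intro: less_trans)
    show "{0<..<1} \<subseteq> (\<Union>n. {0<..<\<theta> n})"
    proof
      fix r :: real assume r: "r \<in> {0<..<1}"
      then obtain n where "r < \<theta> n"
        using order_tendstoD(1)[OF \<theta>(3), of r] by (auto simp: eventually_sequentially)
      with r show "r \<in> (\<Union>n. {0<..<\<theta> n})" by auto
    qed
  qed
  moreover have "incseq (\<lambda>n. {0<..<\<theta> n})" using \<theta>(1) by (fastforce simp: incseq_def intro: less_le_trans)
  ultimately show ?thesis unfolding hardy_mass_def
    by (subst nn_integral_indicator_Union[symmetric]) auto
qed


section \<open>Integrating the pointwise inequality over a sector\<close>

definition hardy_integral :: "real \<Rightarrow> real \<Rightarrow> ('a::euclidean_space \<Rightarrow> real) \<Rightarrow> ennreal" where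
  "hardy_integral s p u = (\<integral>\<^sup>+x. ennreal (\<bar>u x\<bar> powr p / norm x powr (p * s)) \<partial>lborel)"

lemma sector_integral_inner:
  fixes u :: "'a::euclidean_space \<Rightarrow> real" and s p \<theta> :: real
  assumes [measurable]: "u \<in> borel_measurable borel" and p: "0 < p"
  defines "\<alpha> \<equiv> (real DIM('a) - p * s) / p"
  shows "sector_integral (real DIM('a) + p * s) \<theta> (\<lambda>x y. ennreal (\<bar>1 - (norm y / norm x) powr (- \<alpha>)\<bar> powr (p - 1) * \<bar>u x\<bar> powr p))
    = inner_mass DIM('a) s p \<theta> * hardy_integral s p u"
proof -
  let ?I = "inner_mass DIM('a) s p \<theta>"
  let ?D = "indicator (sector \<theta>)"
  define k where "k = (\<lambda>(x::'a) (y::'a). ennreal (norm (x - y) powr - (real DIM('a) + p * s)))"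
  define K where "K = (\<lambda>(x::'a) (y::'a). ennreal (\<bar>1 - (norm y / norm x) powr (- \<alpha>)\<bar> powr (p - 1)))"
  have [measurable]: "jointly_measurable k"
    "jointly_measurable K"
    unfolding k_def K_def by measurable
  have "sector_integral (real DIM('a) + p * s) \<theta> (\<lambda>x y. ennreal (\<bar>1 - (norm y / norm x) powr (- \<alpha>)\<bar> powr (p - 1) * \<bar>u x\<bar> powr p))
    = (\<integral>\<^sup>+x. \<integral>\<^sup>+y. ennreal (\<bar>u x\<bar> powr p) * (K x y * k x y * ?D (x, y)) \<partial>lborel \<partial>lborel)"
    unfolding sector_integral_def
    by (subst nn_integral_lborel_pair(1)[symmetric]) (auto simp: k_def K_def ennreal_mult mult_ac intro!: nn_integral_cong)
  also have "\<dots> = (\<integral>\<^sup>+x. ennreal (\<bar>u x\<bar> powr p / norm x powr (p * s)) * ?I \<partial>lborel)"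
  proof (rule nn_integral_cong_AE)
    have "AE x in lborel. x \<noteq> (0::'a)" by (rule AE_lborel_singleton)
    then show "AE x in lborel. (\<integral>\<^sup>+y. ennreal (\<bar>u x\<bar> powr p) * (K x y * k x y * ?D (x, y)) \<partial>lborel) =
      ennreal (\<bar>u x\<bar> powr p / norm x powr (p * s)) * ?I" (is "AE x in lborel. ?P x")
    proof (rule eventually_mono)
      fix x :: 'a assume x: "x \<noteq> 0"
      have [measurable]: "(\<lambda>y. K x y) \<in> borel_measurable borel" "(\<lambda>y. k x y) \<in> borel_measurable borel"
        unfolding K_def k_def by measurable
      have "(\<integral>\<^sup>+y. ennreal (\<bar>u x\<bar> powr p) * (K x y * k x y * ?D (x, y)) \<partial>lborel) =
        (\<integral>\<^sup>+y. ennreal (\<bar>u x\<bar> powr p) * (K x y * k x y * indicator {..<\<theta>} (norm y / norm x)) \<partial>lborel)"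
        using AE_lborel_singleton[of "0::'a"]
        by (intro nn_integral_cong_AE, eventually_elim) (use x in \<open>auto simp: sector_def indicator_def divide_less_eq\<close>)
      also have "\<dots> = ennreal (\<bar>u x\<bar> powr p) * (\<integral>\<^sup>+y. K x y * k x y * indicator {..<\<theta>} (norm y / norm x) \<partial>lborel)"
        by (rule nn_integral_cmult) measurable
      also have "(\<integral>\<^sup>+y. K x y * k x y * indicator {..<\<theta>} (norm y / norm x) \<partial>lborel) = ennreal (norm x powr (- (p * s))) * ?I"
        unfolding K_def k_def \<alpha>_def by (rule nn_integral_inner_kernel[OF p x])
      also have "ennreal (\<bar>u x\<bar> powr p) * (ennreal (norm x powr (- (p * s))) * ?I) =
        ennreal (\<bar>u x\<bar> powr p / norm x powr (p * s)) * ?I"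
        by (simp add: mult.assoc[symmetric] ennreal_mult[symmetric] powr_minus divide_inverse)
      finally show "?P x" .
    qed
  qed
  also have "\<dots> = ?I * hardy_integral s p u"
    unfolding hardy_integral_def by (subst nn_integral_multc) (auto simp: mult.commute)
  finally show ?thesis .
qed

lemma sector_integral_outer:
  fixes u :: "'a::euclidean_space \<Rightarrow> real" and s p \<theta> :: real
  assumes [measurable]: "u \<in> borel_measurable borel" and \<theta>: "0 < \<theta>"
  defines "\<alpha> \<equiv> (real DIM('a) - p * s) / p"
  shows "sector_integral (real DIM('a) + p * s) \<theta> (\<lambda>x y. ennreal (\<bar>1 - (norm y / norm x) powr \<alpha>\<bar> powr (p - 1) * \<bar>u y\<bar> powr p))
    = outer_mass DIM('a) s p \<theta> * hardy_integral s p u"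
proof -
  let ?O = "outer_mass DIM('a) s p \<theta>"
  let ?D = "indicator (sector \<theta>)"
  define k where "k = (\<lambda>(x::'a) (y::'a). ennreal (norm (x - y) powr - (real DIM('a) + p * s)))"
  define K where "K = (\<lambda>(x::'a) (y::'a). ennreal (\<bar>1 - (norm y / norm x) powr \<alpha>\<bar> powr (p - 1)))"
  have [measurable]: "jointly_measurable k"
    "jointly_measurable K"
    unfolding k_def K_def by measurable
  have "sector_integral (real DIM('a) + p * s) \<theta> (\<lambda>x y. ennreal (\<bar>1 - (norm y / norm x) powr \<alpha>\<bar> powr (p - 1) * \<bar>u y\<bar> powr p))
    = (\<integral>\<^sup>+y. \<integral>\<^sup>+x. ennreal (\<bar>u y\<bar> powr p) * (K x y * k x y * ?D (x, y)) \<partial>lborel \<partial>lborel)"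
    unfolding sector_integral_def
    by (subst nn_integral_lborel_pair(2)[symmetric]) (auto simp: k_def K_def ennreal_mult mult_ac intro!: nn_integral_cong)
  also have "\<dots> = (\<integral>\<^sup>+y. ennreal (\<bar>u y\<bar> powr p / norm y powr (p * s)) * ?O \<partial>lborel)"
  proof (rule nn_integral_cong_AE)
    have "AE y in lborel. y \<noteq> (0::'a)" by (rule AE_lborel_singleton)
    then show "AE y in lborel. (\<integral>\<^sup>+x. ennreal (\<bar>u y\<bar> powr p) * (K x y * k x y * ?D (x, y)) \<partial>lborel) =
      ennreal (\<bar>u y\<bar> powr p / norm y powr (p * s)) * ?O" (is "AE y in lborel. ?P y")
    proof (rule eventually_mono)
      fix y :: 'a assume y: "y \<noteq> 0"
      have [measurable]: "(\<lambda>x. K x y) \<in> borel_measurable borel" "(\<lambda>x. k x y) \<in> borel_measurable borel"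
        unfolding K_def k_def by measurable
      have "(\<integral>\<^sup>+x. ennreal (\<bar>u y\<bar> powr p) * (K x y * k x y * ?D (x, y)) \<partial>lborel) =
        (\<integral>\<^sup>+x. ennreal (\<bar>u y\<bar> powr p) * (K x y * k x y * indicator {..<\<theta>} (norm y / norm x)) \<partial>lborel)"
        using AE_lborel_singleton[of "0::'a"]
        by (intro nn_integral_cong_AE, eventually_elim) (use y in \<open>auto simp: sector_def indicator_def divide_less_eq\<close>)
      also have "\<dots> = ennreal (\<bar>u y\<bar> powr p) * (\<integral>\<^sup>+x. K x y * k x y * indicator {..<\<theta>} (norm y / norm x) \<partial>lborel)"
        by (rule nn_integral_cmult) measurable
      also have "(\<integral>\<^sup>+x. K x y * k x y * indicator {..<\<theta>} (norm y / norm x) \<partial>lborel) = ennreal (norm y powr (- (p * s))) * ?O"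
        unfolding K_def k_def \<alpha>_def by (rule nn_integral_outer_kernel[OF y \<theta>])
      also have "ennreal (\<bar>u y\<bar> powr p) * (ennreal (norm y powr (- (p * s))) * ?O) =
        ennreal (\<bar>u y\<bar> powr p / norm y powr (p * s)) * ?O"
        by (simp add: mult.assoc[symmetric] ennreal_mult[symmetric] powr_minus divide_inverse)
      finally show "?P y" .
    qed
  qed
  also have "\<dots> = ?O * hardy_integral s p u"
    unfolding hardy_integral_def by (subst nn_integral_multc) (auto simp: mult.commute)
  finally show ?thesis .
qed

text \<open>What remains in \<open>ground_state_pointwise\<close> when the terms in |u(x)|^p and
  |u(y)|^p are collected on the side of |u(x) - u(y)|^p. In the sector \<omega> is larger at y
  exactly when \<alpha> > 0, which explains the change of sign.\<close>

definition hardy_remainder :: "real \<Rightarrow> real \<Rightarrow> ('a::euclidean_space \<Rightarrow> real) \<Rightarrow> 'a \<Rightarrow> 'a \<Rightarrow> real" where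
  "hardy_remainder s p u x y =
    (let \<alpha> = (real DIM('a) - p * s) / p;
         A = \<bar>1 - (norm y / norm x) powr (- \<alpha>)\<bar> powr (p - 1) * \<bar>u x\<bar> powr p;
         B = \<bar>1 - (norm y / norm x) powr \<alpha>\<bar> powr (p - 1) * \<bar>u y\<bar> powr p
     in \<bar>u x - u y\<bar> powr p + (if 0 < \<alpha> then A - B else B - A))"

text \<open>(\<omega>(x) \<omega>(y))^(p/2) |v(x) - v(y)|^p, written out in norms.\<close>

definition ground_state_diff :: "real \<Rightarrow> real \<Rightarrow> ('a::euclidean_space \<Rightarrow> real) \<Rightarrow> 'a \<Rightarrow> 'a \<Rightarrow> real" where
  "ground_state_diff s p u x y =
    \<bar>norm x powr ((real DIM('a) - p * s) / p) * u x - norm y powr ((real DIM('a) - p * s) / p) * u y\<bar> powr p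
      / (norm x powr ((real DIM('a) - p * s) / 2) * norm y powr ((real DIM('a) - p * s) / 2))"

lemma ground_state_diff_nonneg: "0 \<le> ground_state_diff s p u x y"
  unfolding ground_state_diff_def by (intro divide_nonneg_nonneg mult_nonneg_nonneg powr_ge_zero)

lemma ground_state_weight:
  fixes X Y \<alpha> p a b :: real
  assumes "0 < X" "0 < Y"
  shows "((Y / X) powr \<alpha>) powr (p / 2) * \<bar>b - a / (Y / X) powr \<alpha>\<bar> powr p =
    \<bar>X powr \<alpha> * a - Y powr \<alpha> * b\<bar> powr p / (X powr (\<alpha> * p / 2) * Y powr (\<alpha> * p / 2))"
proof -
  define P Q where "P = X powr \<alpha>" "Q = Y powr \<alpha>"
  have PQ: "0 < P" "0 < Q" using assms by (auto simp: P_Q_def)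
  have e: "(Y / X) powr \<alpha> = Q / P" using assms by (simp add: powr_divide P_Q_def)
  have f: "X powr (\<alpha> * p / 2) = P powr (p / 2)" "Y powr (\<alpha> * p / 2) = Q powr (p / 2)"
    by (simp_all add: P_Q_def powr_powr)
  have "\<bar>b - a / (Q / P)\<bar> = \<bar>P * a - Q * b\<bar> / Q"
  proof -
    have "b - a / (Q / P) = - ((P * a - Q * b) / Q)" using PQ by (simp add: field_simps)
    then show ?thesis using PQ by simp
  qed
  then have e1: "\<bar>b - a / (Q / P)\<bar> powr p = \<bar>P * a - Q * b\<bar> powr p / (Q powr (p / 2) * Q powr (p / 2))"
    using PQ by (simp add: powr_divide flip: powr_add)
  have e2: "(Q / P) powr (p / 2) = Q powr (p / 2) / P powr (p / 2)" using PQ by (simp add: powr_divide)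
  show ?thesis unfolding e f P_Q_def[symmetric] e1 e2 using PQ by simp
qed

text \<open>\<open>ground_state_pointwise\<close> with t = (|y|/|x|)^|\<alpha>|; the sign of
  \<alpha> decides whether u(x) or u(y) takes the place of the value at the larger weight.\<close>

lemma hardy_remainder_bound:
  fixes u :: "'a::euclidean_space \<Rightarrow> real"
  assumes p: "2 \<le> p" and N: "p * s \<noteq> real DIM('a)" and xy: "(x, y) \<in> sector 1"
  shows "c_p p * ground_state_diff s p u x y \<le> hardy_remainder s p u x y"
    and "p = 2 \<Longrightarrow> hardy_remainder s p u x y = ground_state_diff s p u x y"
proof -
  define \<alpha> where "\<alpha> = (real DIM('a) - p * s) / p"
  have \<alpha>: "\<alpha> \<noteq> 0" "(real DIM('a) - p * s) / 2 = \<alpha> * p / 2" using N p by (auto simp: \<alpha>_def)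
  define X Y where "X = norm x" "Y = norm y"
  have XY: "0 < X" "0 < Y" "Y < X" using xy by (auto simp: sector_def X_Y_def)
  have gsd: "ground_state_diff s p u x y = \<bar>X powr \<alpha> * u x - Y powr \<alpha> * u y\<bar> powr p / (X powr (\<alpha> * p / 2) * Y powr (\<alpha> * p / 2))"
    unfolding ground_state_diff_def \<alpha>(2) \<alpha>_def[symmetric] X_Y_def ..
  have "c_p p * ground_state_diff s p u x y \<le> hardy_remainder s p u x y \<and>
    (p = 2 \<longrightarrow> hardy_remainder s p u x y = ground_state_diff s p u x y)"
  proof (cases "0 < \<alpha>")
    case True
    define t where "t = (Y / X) powr \<alpha>"
    have t: "0 < t" "t < 1" using XY True powr_less_mono2[of \<alpha> "Y / X" 1] by (auto simp: t_def)
    have it: "(Y / X) powr (- \<alpha>) = 1 / t" by (simp add: t_def powr_minus inverse_eq_divide)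
    have ab: "\<bar>1 - t\<bar> = 1 - t" "\<bar>1 - 1 / t\<bar> = (1 - t) / t" using t by (auto simp: field_simps)
    have rem: "hardy_remainder s p u x y = \<bar>u y - u x\<bar> powr p + ((1 - t) / t) powr (p - 1) * \<bar>u x\<bar> powr p - (1 - t) powr (p - 1) * \<bar>u y\<bar> powr p"
      unfolding hardy_remainder_def \<alpha>_def[symmetric] X_Y_def[symmetric] Let_def it t_def[symmetric] ab
      using True by (simp add: abs_minus_commute)
    have w: "t powr (p / 2) * \<bar>u y - u x / t\<bar> powr p = ground_state_diff s p u x y"
      unfolding gsd t_def by (rule ground_state_weight[OF XY(1,2)])
    show ?thesis
      using ground_state_pointwise[OF p t, of "u y" "u x"] unfolding rem w by linarith
  next
    case False
    define t where "t = (X / Y) powr \<alpha>"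
    have "t = (Y / X) powr (- \<alpha>)" using XY by (simp add: t_def powr_divide powr_minus field_simps)
    moreover have "(Y / X) powr (- \<alpha>) < 1" using XY False \<alpha> powr_less_mono2[of "- \<alpha>" "Y / X" 1] by auto
    ultimately have t: "0 < t" "t < 1" and te: "(Y / X) powr (- \<alpha>) = t" using XY by (auto simp: t_def)
    have it: "(Y / X) powr \<alpha> = 1 / t" using te powr_minus[of "Y / X" \<alpha>] by (metis inverse_eq_divide inverse_inverse_eq)
    have ab: "\<bar>1 - t\<bar> = 1 - t" "\<bar>1 - 1 / t\<bar> = (1 - t) / t" using t by (auto simp: field_simps)
    have rem: "hardy_remainder s p u x y = \<bar>u x - u y\<bar> powr p + ((1 - t) / t) powr (p - 1) * \<bar>u y\<bar> powr p - (1 - t) powr (p - 1) * \<bar>u x\<bar> powr p"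
      unfolding hardy_remainder_def \<alpha>_def[symmetric] X_Y_def[symmetric] Let_def it te ab
      using False by simp
    have w: "t powr (p / 2) * \<bar>u x - u y / t\<bar> powr p = ground_state_diff s p u x y"
      unfolding gsd t_def using ground_state_weight[OF XY(2,1), of \<alpha> p "u x" "u y"]
      by (simp add: abs_minus_commute mult.commute)
    show ?thesis
      using ground_state_pointwise[OF p t, of "u x" "u y"] unfolding rem w by linarith
  qed
  then show "c_p p * ground_state_diff s p u x y \<le> hardy_remainder s p u x y"
    "p = 2 \<Longrightarrow> hardy_remainder s p u x y = ground_state_diff s p u x y" by auto
qed

lemma measurable_hardy_remainder [measurable]:
  fixes u :: "'a::euclidean_space \<Rightarrow> real"
  assumes [measurable]: "u \<in> borel_measurable borel"
  shows "(\<lambda>z. hardy_remainder s p u (fst z) (snd z)) \<in> borel_measurable (borel \<Otimes>\<^sub>M borel)"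
  unfolding hardy_remainder_def Let_def by measurable

text \<open>Moving the subtracted term of the remainder across gives, for \<alpha> > 0, G + I H = R
  + O H with O = I + M. The common term I H is finite because \<theta> < 1 and the Hardy integral is
  finite, so it cancels. For \<alpha> < 0 the roles of I and O are exchanged.\<close>

lemma sector_identity:
  fixes u :: "'a::euclidean_space \<Rightarrow> real"
  assumes u [measurable]: "u \<in> borel_measurable borel" and s: "0 < s" "s < 1" and p: "2 \<le> p"
    and N: "p * s \<noteq> real DIM('a)" and \<theta>: "0 < \<theta>" "\<theta> < 1" and fin: "hardy_integral s p u < \<infinity>"
  shows "sector_integral (real DIM('a) + p * s) \<theta> (\<lambda>x y. ennreal (\<bar>u x - u y\<bar> powr p)) =
    sector_integral (real DIM('a) + p * s) \<theta> (\<lambda>x y. ennreal (hardy_remainder s p u x y)) +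
    hardy_mass DIM('a) s p \<theta> * hardy_integral s p u" (is "?G = ?R + ?M * ?H")
proof -
  let ?S = "sector_integral (real DIM('a) + p * s) \<theta>"
  let ?I = "inner_mass DIM('a) s p \<theta>"
  let ?O = "outer_mass DIM('a) s p \<theta>"
  define \<alpha> where "\<alpha> = (real DIM('a) - p * s) / p"
  have p0: "0 < p" using p by simp
  have \<alpha>: "0 < \<alpha> \<longleftrightarrow> p * s < real DIM('a)" using p0 by (simp add: \<alpha>_def zero_less_divide_iff)
  define A where "A = (\<lambda>(x::'a) (y::'a). ennreal (\<bar>1 - (norm y / norm x) powr (- \<alpha>)\<bar> powr (p - 1) * \<bar>u x\<bar> powr p))"
  define B where "B = (\<lambda>(x::'a) (y::'a). ennreal (\<bar>1 - (norm y / norm x) powr \<alpha>\<bar> powr (p - 1) * \<bar>u y\<bar> powr p))"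
  have [measurable]: "jointly_measurable A"
    "jointly_measurable B"
    unfolding A_def B_def by measurable
  have inner: "?S A = ?I * ?H"
    unfolding A_def \<alpha>_def by (rule sector_integral_inner[OF u p0])
  have outer: "?S B = ?O * ?H"
    unfolding B_def \<alpha>_def by (rule sector_integral_outer[OF u \<theta>(1)])
  note mass_fin = hardy_mass_finite[OF s p0, where 'a='a]
  have "?I < \<infinity>" "?O < \<infinity>"
    using inner_mass_finite[OF p0 \<theta> N mass_fin] outer_mass_finite[OF p0 \<theta> N mass_fin] by auto
  then have fin': "?I * ?H \<noteq> \<infinity>" "?O * ?H \<noteq> \<infinity>"
    using fin by (auto simp: ennreal_mult_eq_top_iff)
  \<comment> \<open>\<open>ennreal\<close> sends negative reals to 0, so the rearranged pointwise
    identity survives the embedding only because the remainder is nonnegative, which is the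
    pointwise inequality with c_p > 0.\<close>
  have rem: "0 \<le> hardy_remainder s p u x y" if "(x, y) \<in> sector \<theta>" for x y
  proof -
    have "norm y < \<theta> * norm x" "y \<noteq> 0" using that by (auto simp: sector_def)
    moreover have "\<theta> * norm x \<le> 1 * norm x" using \<theta> by (intro mult_right_mono) auto
    ultimately have "(x, y) \<in> sector 1" by (simp add: sector_def)
    from hardy_remainder_bound(1)[OF p N this, of u] show ?thesis
      using c_p_pos[OF p] ground_state_diff_nonneg[of s p u x y]
      by (meson less_imp_le mult_nonneg_nonneg order_trans)
  qed
  show ?thesis
  proof (cases "0 < \<alpha>")
    case True
    have "?S (\<lambda>x y. ennreal (\<bar>u x - u y\<bar> powr p) + A x y) =
      ?S (\<lambda>x y. ennreal (hardy_remainder s p u x y) + B x y)"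
    proof (rule sector_integral_cong)
      fix x y :: 'a assume "(x, y) \<in> sector \<theta>"
      from rem[OF this] True show "ennreal (\<bar>u x - u y\<bar> powr p) + A x y = ennreal (hardy_remainder s p u x y) + B x y"
        unfolding A_def B_def by (simp add: hardy_remainder_def Let_def \<alpha>_def flip: ennreal_plus)
    qed
    then have "?G + ?I * ?H = ?R + ?O * ?H"
      by (subst (asm) (1 2) sector_integral_add) (auto simp: inner outer)
    also have "?O = ?I + ?M"
      using mass_balance(1)[of p \<theta> s "DIM('a)"] p0 \<theta> True \<alpha> by simp
    finally have "?I * ?H + ?G = ?I * ?H + (?R + ?M * ?H)"
      by (simp add: distrib_right add_ac)
    then show ?thesis using fin' unfolding ennreal_add_left_cancel by auto
  next
    case False
    have "?S (\<lambda>x y. ennreal (\<bar>u x - u y\<bar> powr p) + B x y) =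
      ?S (\<lambda>x y. ennreal (hardy_remainder s p u x y) + A x y)"
    proof (rule sector_integral_cong)
      fix x y :: 'a assume "(x, y) \<in> sector \<theta>"
      from rem[OF this] False show "ennreal (\<bar>u x - u y\<bar> powr p) + B x y = ennreal (hardy_remainder s p u x y) + A x y"
        unfolding A_def B_def by (simp add: hardy_remainder_def Let_def \<alpha>_def flip: ennreal_plus)
    qed
    then have "?G + ?O * ?H = ?R + ?I * ?H"
      by (subst (asm) (1 2) sector_integral_add) (auto simp: inner outer)
    also have "?I = ?O + ?M"
      using mass_balance(2)[of p \<theta> "DIM('a)" s] p0 \<theta> False \<alpha> N by simp
    finally have "?O * ?H + ?G = ?O * ?H + (?R + ?M * ?H)"
      by (simp add: distrib_right add_ac)
    then show ?thesis using fin' unfolding ennreal_add_left_cancel by auto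
  qed
qed

lemma sector_identity_one:
  fixes u :: "'a::euclidean_space \<Rightarrow> real"
  assumes u [measurable]: "u \<in> borel_measurable borel" and s: "0 < s" "s < 1" and p: "2 \<le> p"
    and N: "p * s \<noteq> real DIM('a)" and fin: "hardy_integral s p u < \<infinity>"
  shows "sector_integral (real DIM('a) + p * s) 1 (\<lambda>x y. ennreal (\<bar>u x - u y\<bar> powr p)) =
    sector_integral (real DIM('a) + p * s) 1 (\<lambda>x y. ennreal (hardy_remainder s p u x y)) +
    hardy_mass DIM('a) s p 1 * hardy_integral s p u" (is "?G 1 = ?R 1 + ?M 1 * ?H")
proof -
  \<comment> \<open>The double successor starts the sequence at 1/2, so that every \<theta> n is
    positive.\<close>
  define \<theta> where "\<theta> = (\<lambda>n. 1 - inverse (real (Suc (Suc n))))"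
  have \<theta>: "incseq \<theta>" "\<And>n. 0 < \<theta> n" "\<And>n. \<theta> n < 1"
    by (auto simp: \<theta>_def incseq_Suc_iff field_simps)
  have "(\<lambda>n. 1 - inverse (real (Suc (Suc n)))) \<longlonglongrightarrow> 1 - 0"
    by (intro tendsto_intros LIMSEQ_Suc[OF LIMSEQ_inverse_real_of_nat])
  then have lim: "\<theta> \<longlonglongrightarrow> 1" by (simp add: \<theta>_def)
  note SUPs = sector_integral_SUP[OF _ \<theta>(1,3) lim]
  have inc: "incseq (\<lambda>n. ?M (\<theta> n) * ?H)"
    using \<theta>(1) by (auto simp: incseq_def intro!: mult_right_mono hardy_mass_mono)
  have "?G 1 = (SUP n. ?G (\<theta> n))" by (rule SUPs(1)) measurable
  also have "\<dots> = (SUP n. ?R (\<theta> n) + ?M (\<theta> n) * ?H)"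
    by (intro SUP_cong refl sector_identity[OF u s p N \<theta>(2,3) fin])
  also have "\<dots> = (SUP n. ?R (\<theta> n)) + (SUP n. ?M (\<theta> n) * ?H)"
    by (intro ennreal_SUP_add SUPs(2) inc) measurable
  also have "(SUP n. ?R (\<theta> n)) = ?R 1" by (rule SUPs(1)[symmetric]) measurable
  also have "(SUP n. ?M (\<theta> n) * ?H) = ?M 1 * ?H"
    by (simp add: hardy_mass_SUP[OF \<theta>(1,3) lim] SUP_mult_right_ennreal)
  finally show ?thesis .
qed


subsection \<open>Ground state representation\<close>

definition ground_state_energy :: "real \<Rightarrow> real \<Rightarrow> ('a::euclidean_space \<Rightarrow> real) \<Rightarrow> ennreal" where
  "ground_state_energy s p u = (\<integral>\<^sup>+x. \<integral>\<^sup>+y. ennreal (ground_state_diff s p u x y) *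
     ennreal (norm (x - y) powr - (real DIM('a) + p * s)) \<partial>lborel \<partial>lborel)"

lemma gagliardo_eq_lborel:
  fixes u :: "'a::euclidean_space \<Rightarrow> real"
  shows "gagliardo s p u = (\<integral>\<^sup>+x. \<integral>\<^sup>+y. ennreal (\<bar>u x - u y\<bar> powr p) *
     ennreal (norm (x - y) powr - (real DIM('a) + p * s)) \<partial>lborel \<partial>lborel)"
  unfolding gagliardo_def nn_integral_completion powr_minus divide_inverse
  by (simp add: ennreal_mult)

lemma gagliardo_eq_sector_integral:
  fixes u :: "'a::euclidean_space \<Rightarrow> real"
  assumes [measurable]: "u \<in> borel_measurable borel"
  shows "gagliardo s p u = 2 * sector_integral (real DIM('a) + p * s) 1 (\<lambda>x y. ennreal (\<bar>u x - u y\<bar> powr p))"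
  unfolding gagliardo_eq_lborel
proof (rule sector_integral_symmetric)
  show "ennreal (\<bar>u x - u y\<bar> powr p) = ennreal (\<bar>u y - u x\<bar> powr p)" for x y
    by (simp only: abs_minus_commute)
qed measurable

lemma measurable_ground_state_diff [measurable]:
  fixes u :: "'a::euclidean_space \<Rightarrow> real"
  assumes [measurable]: "u \<in> borel_measurable borel"
  shows "(\<lambda>z. ground_state_diff s p u (fst z) (snd z)) \<in> borel_measurable (borel \<Otimes>\<^sub>M borel)"
  unfolding ground_state_diff_def by measurable

lemma ground_state_energy_eq_sector_integral:
  fixes u :: "'a::euclidean_space \<Rightarrow> real"
  assumes [measurable]: "u \<in> borel_measurable borel"
  shows "ground_state_energy s p u = 2 * sector_integral (real DIM('a) + p * s) 1 (\<lambda>x y. ennreal (ground_state_diff s p u x y))"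
  unfolding ground_state_energy_def
proof (rule sector_integral_symmetric)
  show "ennreal (ground_state_diff s p u x y) = ennreal (ground_state_diff s p u y x)" for x y
    unfolding ground_state_diff_def by (subst abs_minus_commute, subst mult.commute[of "norm x powr ((real DIM('a) - p * s) / 2)"]) (rule refl)
qed measurable

lemma ground_state_representation:
  fixes u :: "'a::euclidean_space \<Rightarrow> real"
  assumes u [measurable]: "u \<in> borel_measurable borel" and s: "0 < s" "s < 1" and p: "2 \<le> p"
    and N: "p * s \<noteq> real DIM('a)" and fin: "hardy_integral s p u < \<infinity>"
  shows "ennreal (hardy_const DIM('a) s p) * hardy_integral s p u + ennreal (c_p p) * ground_state_energy s p u \<le> gagliardo s p u"
    and "p = 2 \<Longrightarrow> gagliardo s p u = ennreal (hardy_const DIM('a) s p) * hardy_integral s p u + ground_state_energy s p u"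
proof -
  let ?C = "ennreal (hardy_const DIM('a) s p)"
  let ?H = "hardy_integral s p u"
  let ?R = "(\<lambda>x y. ennreal (hardy_remainder s p u x y))"
  let ?D = "(\<lambda>x y. ennreal (ground_state_diff s p u x y))"
  define S :: "('a \<Rightarrow> 'a \<Rightarrow> ennreal) \<Rightarrow> ennreal" where "S = sector_integral (real DIM('a) + p * s) 1"
  have p0: "0 < p" using p by simp
  have gag: "gagliardo s p u = 2 * S ?R + ?C * ?H"
    unfolding gagliardo_eq_sector_integral[OF u] sector_identity_one[OF assms] hardy_const_eq[OF s p0 N] S_def
    by (simp add: distrib_left mult.assoc)
  have gse: "ground_state_energy s p u = 2 * S ?D"
    unfolding S_def by (rule ground_state_energy_eq_sector_integral[OF u])
  have "ennreal (c_p p) * S ?D =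
    S (\<lambda>x y. ennreal (c_p p) * ennreal (ground_state_diff s p u x y))"
    unfolding S_def by (rule sector_integral_cmult[symmetric]) measurable
  also have "\<dots> \<le> S ?R"
    unfolding S_def
  proof (rule sector_integral_mono)
    fix x y :: 'a assume "(x, y) \<in> sector 1"
    from hardy_remainder_bound(1)[OF p N this, of u]
    show "ennreal (c_p p) * ennreal (ground_state_diff s p u x y) \<le> ennreal (hardy_remainder s p u x y)"
      using c_p_pos[OF p] ground_state_diff_nonneg[of s p u x y] by (simp flip: ennreal_mult add: ennreal_leI)
  qed
  finally have le: "ennreal (c_p p) * S ?D \<le> S ?R" .
  have "ennreal (c_p p) * ground_state_energy s p u \<le> 2 * S ?R"
    unfolding gse using mult_left_mono[OF le, of 2] by (simp add: mult.left_commute)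
  then show "?C * ?H + ennreal (c_p p) * ground_state_energy s p u \<le> gagliardo s p u"
    unfolding gag by (subst add.commute) (rule add_right_mono)
  show "gagliardo s p u = ?C * ?H + ground_state_energy s p u" if "p = 2"
  proof -
    have "S ?R = S ?D"
      unfolding S_def using hardy_remainder_bound(2)[OF p N _ that] by (intro sector_integral_cong) simp
    then show ?thesis unfolding gag gse by (simp add: add.commute)
  qed
qed

section \<open>Test functions and passage to the completion\<close>

lemma Cc_infty_bounded_support:
  fixes f :: "'a::euclidean_space \<Rightarrow> real"
  assumes f: "f \<in> Cc_infty"
  obtains B R where "f \<in> borel_measurable borel" "0 < R" "0 \<le> B" "\<forall>x. \<bar>f x\<bar> \<le> B" "\<forall>x. f x \<noteq> 0 \<longrightarrow> norm x \<le> R"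
proof -
  have "smooth_fun f" and K: "compact (closure {x. f x \<noteq> 0})" using f by (auto simp: Cc_infty_def)
  then have "f differentiable_on UNIV" by (auto elim: smooth_fun.cases)
  then have cont: "continuous_on UNIV f" by (rule differentiable_imp_continuous_on)
  then have "compact (f ` closure {x. f x \<noteq> 0})"
    using K by (intro compact_continuous_image) (auto intro: continuous_on_subset)
  then obtain B where B: "\<And>x. x \<in> closure {x. f x \<noteq> 0} \<Longrightarrow> \<bar>f x\<bar> \<le> B"
    using compact_imp_bounded[of "f ` closure {x. f x \<noteq> 0}"] by (auto simp: bounded_iff)
  obtain R where R: "0 < R" "\<And>x. x \<in> closure {x. f x \<noteq> 0} \<Longrightarrow> norm x \<le> R"
    using compact_imp_bounded[OF K] unfolding bounded_pos by auto
  show ?thesis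
  proof (rule that[of R "max B 0"])
    show "\<forall>x. \<bar>f x\<bar> \<le> max B 0"
    proof
      fix x show "\<bar>f x\<bar> \<le> max B 0"
        using B[of x] closure_subset[of "{x. f x \<noteq> 0}"] by (cases "f x = 0") (auto simp: subset_iff)
    qed
    show "\<forall>x. f x \<noteq> 0 \<longrightarrow> norm x \<le> R"
      using R(2) closure_subset[of "{x. f x \<noteq> 0}"] by blast
  qed (use R cont in \<open>auto intro: borel_measurable_continuous_onI\<close>)
qed

lemma hardy_integral_Cc_infty_finite:
  fixes f :: "'a::euclidean_space \<Rightarrow> real"
  assumes f: "f \<in> Cc_infty" and p: "0 \<le> p" and N: "p * s < real DIM('a)"
  shows "hardy_integral s p f < \<infinity>"
proof -
  obtain R B where BR: "f \<in> borel_measurable borel" "0 < R" "0 \<le> B" "\<forall>x. \<bar>f x\<bar> \<le> B" "\<forall>x. f x \<noteq> 0 \<longrightarrow> norm x \<le> R"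
    by (rule Cc_infty_bounded_support[OF f])
  have "hardy_integral s p f \<le> (\<integral>\<^sup>+x. ennreal (B powr p) * (ennreal (norm x powr (- (p * s))) * indicator (cball 0 R) x) \<partial>(lborel :: 'a measure))"
    unfolding hardy_integral_def
  proof (rule nn_integral_mono)
    fix x :: 'a
    show "ennreal (\<bar>f x\<bar> powr p / norm x powr (p * s)) \<le> ennreal (B powr p) * (ennreal (norm x powr (- (p * s))) * indicator (cball 0 R) x)"
    proof (cases "f x = 0")
      case False
      have "\<bar>f x\<bar> powr p * norm x powr (- (p * s)) \<le> B powr p * norm x powr (- (p * s))"
        using BR(4)[rule_format, of x] p by (intro mult_right_mono powr_mono2) auto
      then show ?thesis using BR(5)[rule_format, OF False]
        by (simp add: powr_minus divide_inverse flip: ennreal_mult)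
    qed simp
  qed
  also have "\<dots> = ennreal (B powr p) * (\<integral>\<^sup>+x. ennreal (norm x powr (- (p * s))) * indicator (cball 0 R) x \<partial>(lborel :: 'a measure))"
    by (rule nn_integral_cmult) (intro borel_measurable_times_ennreal borel_measurable_indicator; simp)
  also have "\<dots> < \<infinity>"
    using nn_integral_powr_norm_finite[where 'a='a, of "- (p * s)" R] N BR(2) by (simp add: ennreal_mult_less_top)
  finally show ?thesis .
qed

text \<open>The weight |x|^(-ps) may fail to be integrable at the origin, but the support keeps a
  distance e > 0 from it, so the integrand is bounded on a ball.\<close>

lemma hardy_integral_Cc_infty_punct_finite:
  fixes f :: "'a::euclidean_space \<Rightarrow> real"
  assumes f: "f \<in> Cc_infty_punct" and p: "0 \<le> p" and s: "0 \<le> s"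
  shows "hardy_integral s p f < \<infinity>"
proof -
  have f': "f \<in> Cc_infty" and 0: "0 \<notin> closure {x. f x \<noteq> 0}" using f by (auto simp: Cc_infty_punct_def)
  obtain R B where BR: "f \<in> borel_measurable borel" "0 < R" "0 \<le> B" "\<forall>x. \<bar>f x\<bar> \<le> B" "\<forall>x. f x \<noteq> 0 \<longrightarrow> norm x \<le> R"
    by (rule Cc_infty_bounded_support[OF f'])
  obtain e where e: "0 < e" "\<And>x. f x \<noteq> 0 \<Longrightarrow> e \<le> norm x"
    using 0 unfolding closure_approachable by (auto simp: dist_norm not_less)
  have "hardy_integral s p f \<le> (\<integral>\<^sup>+x. ennreal (B powr p * e powr (- (p * s))) * indicator (cball 0 R) x \<partial>(lborel :: 'a measure))"
    unfolding hardy_integral_def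
  proof (rule nn_integral_mono)
    fix x :: 'a
    show "ennreal (\<bar>f x\<bar> powr p / norm x powr (p * s)) \<le> ennreal (B powr p * e powr (- (p * s))) * indicator (cball 0 R) x"
    proof (cases "f x = 0")
      case False
      have "\<bar>f x\<bar> powr p * norm x powr (- (p * s)) \<le> B powr p * e powr (- (p * s))"
        using BR(4)[rule_format, of x] p s e(1) e(2)[OF False] by (intro mult_mono powr_mono2 powr_mono2') auto
      then show ?thesis using BR(5)[rule_format, OF False]
        by (simp add: powr_minus divide_inverse ennreal_leI)
    qed simp
  qed
  also have "\<dots> = ennreal (B powr p * e powr (- (p * s))) * emeasure lborel (cball (0::'a) R)"
    by (rule nn_integral_cmult_indicator) simp
  also have "\<dots> < \<infinity>" using BR(2) by (simp add: emeasure_cball ennreal_mult_less_top)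
  finally show ?thesis .
qed

text \<open>The factor 2^p comes from a + b \<le> 2 max a b; a crude constant suffices, since only a
  bound uniform along the approximating sequence is needed.\<close>

lemma gagliardo_triangle:
  fixes u f :: "'a::euclidean_space \<Rightarrow> real"
  assumes [measurable]: "u \<in> borel_measurable borel" "f \<in> borel_measurable borel" and p: "0 \<le> p"
  shows "gagliardo s p f \<le> ennreal (2 powr p) * (gagliardo s p u + gagliardo s p (\<lambda>x. u x - f x))"
proof -
  define S :: "('a \<Rightarrow> 'a \<Rightarrow> ennreal) \<Rightarrow> ennreal" where "S = sector_integral (real DIM('a) + p * s) 1"
  have "S (\<lambda>x y. ennreal (\<bar>f x - f y\<bar> powr p)) \<le>
    S (\<lambda>x y. ennreal (2 powr p) * (ennreal (\<bar>u x - u y\<bar> powr p) + ennreal (\<bar>u x - f x - (u y - f y)\<bar> powr p)))"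
    unfolding S_def
  proof (rule sector_integral_mono)
    fix x y
    define a b where "a = \<bar>u x - u y\<bar>" "b = \<bar>u x - f x - (u y - f y)\<bar>"
    have "\<bar>f x - f y\<bar> \<le> a + b" unfolding a_b_def by linarith
    also have "\<dots> \<le> 2 * max a b" by simp
    finally have "\<bar>f x - f y\<bar> powr p \<le> (2 * max a b) powr p" using p by (intro powr_mono2) auto
    also have "\<dots> = 2 powr p * max a b powr p" by (rule powr_mult; simp add: a_b_def)
    also have "\<dots> \<le> 2 powr p * (a powr p + b powr p)" by (intro mult_left_mono) (auto simp: max_def)
    finally show "ennreal (\<bar>f x - f y\<bar> powr p) \<le>
      ennreal (2 powr p) * (ennreal (\<bar>u x - u y\<bar> powr p) + ennreal (\<bar>u x - f x - (u y - f y)\<bar> powr p))"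
      by (simp add: a_b_def flip: ennreal_mult ennreal_plus)
  qed
  also have "\<dots> = ennreal (2 powr p) * (S (\<lambda>x y. ennreal (\<bar>u x - u y\<bar> powr p)) + S (\<lambda>x y. ennreal (\<bar>u x - f x - (u y - f y)\<bar> powr p)))"
    unfolding S_def by (subst sector_integral_cmult, measurable) (subst sector_integral_add, auto)
  finally have "2 * S (\<lambda>x y. ennreal (\<bar>f x - f y\<bar> powr p)) \<le>
    2 * (ennreal (2 powr p) * (S (\<lambda>x y. ennreal (\<bar>u x - u y\<bar> powr p)) + S (\<lambda>x y. ennreal (\<bar>u x - f x - (u y - f y)\<bar> powr p))))"
    by (rule mult_left_mono) simp
  then show ?thesis
    by (simp add: gagliardo_eq_sector_integral flip: S_def) (simp add: distrib_left mult.left_commute)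
qed

text \<open>The representation is available for each \<phi> k, whose Hardy integral is finite.
  Dropping the energy term and dividing by the positive Hardy constant bounds these integrals by the
  seminorm of \<phi> k, hence eventually by one \<open>K\<close> depending only on u. Fatou's lemma
  transfers the bound to u.\<close>

lemma hardy_integral_finite_limit:
  fixes u :: "'a::euclidean_space \<Rightarrow> real"
  assumes u [measurable]: "u \<in> borel_measurable borel" and s: "0 < s" "s < 1" and p: "2 \<le> p"
    and N: "p * s \<noteq> real DIM('a)" and fin: "gagliardo s p u < \<infinity>"
    and \<phi>: "\<And>k. \<phi> k \<in> borel_measurable borel" "\<And>k. hardy_integral s p (\<phi> k) < \<infinity>"
    and lim: "AE x in lborel. (\<lambda>k. \<phi> k x) \<longlonglongrightarrow> u x" "(\<lambda>k. gagliardo s p (\<lambda>x. u x - \<phi> k x)) \<longlonglongrightarrow> 0"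
  shows "hardy_integral s p u < \<infinity>"
proof -
  note [measurable] = \<phi>(1)
  define C where "C = hardy_const DIM('a) s p"
  have "0 < ennreal C"
    unfolding C_def using hardy_const_eq[OF s _ N] hardy_mass_pos[OF _ N] p by (simp add: ennreal_zero_less_mult_iff)
  then have C: "0 < C" by simp
  define K where "K = ennreal (1 / C) * (ennreal (2 powr p) * (gagliardo s p u + 1))"
  have K: "K < \<infinity>" using fin by (simp add: K_def ennreal_mult_less_top)
  have "eventually (\<lambda>k. gagliardo s p (\<lambda>x. u x - \<phi> k x) < 1) sequentially"
    using lim(2) by (rule order_tendstoD) simp
  then have ev: "eventually (\<lambda>k. hardy_integral s p (\<phi> k) \<le> K) sequentially"
  proof (rule eventually_mono)
    fix k assume k: "gagliardo s p (\<lambda>x. u x - \<phi> k x) < 1"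
    have "ennreal C * hardy_integral s p (\<phi> k) \<le> ennreal C * hardy_integral s p (\<phi> k) + ennreal (c_p p) * ground_state_energy s p (\<phi> k)"
      by simp
    also have "\<dots> \<le> gagliardo s p (\<phi> k)"
      unfolding C_def by (rule ground_state_representation(1)[OF \<phi>(1) s p N \<phi>(2)])
    also have "\<dots> \<le> ennreal (2 powr p) * (gagliardo s p u + gagliardo s p (\<lambda>x. u x - \<phi> k x))"
      using p by (intro gagliardo_triangle) auto
    also have "\<dots> \<le> ennreal (2 powr p) * (gagliardo s p u + 1)"
      using k by (intro mult_left_mono add_left_mono) auto
    finally have "ennreal (1 / C) * (ennreal C * hardy_integral s p (\<phi> k)) \<le> K"
      unfolding K_def by (rule mult_left_mono) simp
    then show "hardy_integral s p (\<phi> k) \<le> K"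
      using C by (simp add: mult.assoc[symmetric] ennreal_mult[symmetric])
  qed
  have "hardy_integral s p u = (\<integral>\<^sup>+x. liminf (\<lambda>k. ennreal (\<bar>\<phi> k x\<bar> powr p / norm x powr (p * s))) \<partial>lborel)"
    unfolding hardy_integral_def
  proof (rule nn_integral_cong_AE, use lim(1) in eventually_elim)
    fix x assume x: "(\<lambda>k. \<phi> k x) \<longlonglongrightarrow> u x"
    have "continuous_on UNIV (\<lambda>z::real. \<bar>z\<bar> powr p)"
      using p by (intro continuous_intros continuous_on_powr') auto
    then have "isCont (\<lambda>z::real. \<bar>z\<bar> powr p) (u x)" by (simp add: continuous_on_eq_continuous_at)
    from isCont_tendsto_compose[OF this x] have "(\<lambda>k. \<bar>\<phi> k x\<bar> powr p) \<longlonglongrightarrow> \<bar>u x\<bar> powr p" .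
    then have "(\<lambda>k. ennreal (\<bar>\<phi> k x\<bar> powr p / norm x powr (p * s))) \<longlonglongrightarrow> ennreal (\<bar>u x\<bar> powr p / norm x powr (p * s))"
      unfolding divide_inverse by (intro tendsto_ennrealI tendsto_mult_right)
    then show "ennreal (\<bar>u x\<bar> powr p / norm x powr (p * s)) = liminf (\<lambda>k. ennreal (\<bar>\<phi> k x\<bar> powr p / norm x powr (p * s)))"
      by (rule lim_imp_Liminf[OF trivial_limit_sequentially, symmetric])
  qed
  also have "\<dots> \<le> liminf (\<lambda>k. hardy_integral s p (\<phi> k))"
    unfolding hardy_integral_def by (rule nn_integral_liminf) measurable
  also have "\<dots> \<le> limsup (\<lambda>k. hardy_integral s p (\<phi> k))" by (rule Liminf_le_Limsup) simp
  also have "\<dots> \<le> K" using ev by (rule Limsup_bounded)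
  finally show ?thesis using K by (rule le_less_trans)
qed

lemma gagliardo_cong_AE:
  assumes "AE x in lborel. u x = v x"
  shows "gagliardo s p u = gagliardo s p v"
  unfolding gagliardo_eq_lborel
proof (rule nn_integral_cong_AE, use assms in eventually_elim)
  fix x assume "u x = v x"
  then show "(\<integral>\<^sup>+y. ennreal (\<bar>u x - u y\<bar> powr p) * ennreal (norm (x - y) powr - (real DIM('a) + p * s)) \<partial>lborel) =
    (\<integral>\<^sup>+y. ennreal (\<bar>v x - v y\<bar> powr p) * ennreal (norm (x - y) powr - (real DIM('a) + p * s)) \<partial>lborel)"
    by (intro nn_integral_cong_AE, use assms in eventually_elim) simp
qed

lemma ground_state_energy_cong_AE:
  assumes "AE x in lborel. u x = v x"
  shows "ground_state_energy s p u = ground_state_energy s p v"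
  unfolding ground_state_energy_def
proof (rule nn_integral_cong_AE, use assms in eventually_elim)
  fix x assume "u x = v x"
  then show "(\<integral>\<^sup>+y. ennreal (ground_state_diff s p u x y) * ennreal (norm (x - y) powr - (real DIM('a) + p * s)) \<partial>lborel) =
    (\<integral>\<^sup>+y. ennreal (ground_state_diff s p v x y) * ennreal (norm (x - y) powr - (real DIM('a) + p * s)) \<partial>lborel)"
    by (intro nn_integral_cong_AE, use assms in eventually_elim) (simp add: ground_state_diff_def)
qed

lemma ground_state_energy_eq_lebesgue:
  fixes u :: "'a::euclidean_space \<Rightarrow> real" and s p :: real
  defines "N \<equiv> real DIM('a)"
  defines "v \<equiv> (\<lambda>x. norm x powr ((N - p * s) / p) * u x)"
  shows "ground_state_energy s p u = (\<integral>\<^sup>+ x. \<integral>\<^sup>+ y. ennreal (\<bar>v x - v y\<bar> powr p / norm (x - y) powr (N + p * s)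
              / (norm x powr ((N - p * s) / 2) * norm y powr ((N - p * s) / 2))) \<partial>lebesgue \<partial>lebesgue)"
proof -
  have "ennreal (ground_state_diff s p u x y) * ennreal (norm (x - y) powr - (real DIM('a) + p * s)) =
    ennreal (\<bar>v x - v y\<bar> powr p / norm (x - y) powr (N + p * s) / (norm x powr ((N - p * s) / 2) * norm y powr ((N - p * s) / 2)))" for x y
  proof -
    have "ennreal (ground_state_diff s p u x y) * ennreal (norm (x - y) powr - (real DIM('a) + p * s)) =
      ennreal (ground_state_diff s p u x y * norm (x - y) powr - (real DIM('a) + p * s))"
      using ground_state_diff_nonneg[of s p u x y] by (simp add: ennreal_mult)
    also have "ground_state_diff s p u x y * norm (x - y) powr - (real DIM('a) + p * s) =
      \<bar>v x - v y\<bar> powr p / norm (x - y) powr (N + p * s) / (norm x powr ((N - p * s) / 2) * norm y powr ((N - p * s) / 2))"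
      unfolding ground_state_diff_def v_def N_def powr_minus by (simp only: divide_inverse mult_ac)
    finally show ?thesis .
  qed
  then show ?thesis unfolding ground_state_energy_def nn_integral_completion by simp
qed

theorem theorem1p2:
  fixes s p :: real and u :: "'a::euclidean_space \<Rightarrow> real"
  defines "N \<equiv> real DIM('a)"
  defines "v \<equiv> (\<lambda>x. norm x powr ((N - p * s) / p) * u x)"
  assumes s: "0 < s" "s < 1" and p: "2 \<le> p"
    and u: "(p < N / s \<and> u \<in> hom_frac_sobolev s p Cc_infty) \<or>
            (p > N / s \<and> u \<in> hom_frac_sobolev s p Cc_infty_punct)"
  shows "(\<exists>\<tau>\<in>{0<..<1/2}. cp_fun p \<tau> = c_p p) \<and> 0 < c_p p \<and> c_p p \<le> 1
    \<and> gagliardo s p u \<ge>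
         ennreal (hardy_const DIM('a) s p) * (\<integral>\<^sup>+ x. ennreal (\<bar>u x\<bar> powr p / norm x powr (p * s)) \<partial>lebesgue)
       + ennreal (c_p p) *
         (\<integral>\<^sup>+ x. \<integral>\<^sup>+ y. ennreal (\<bar>v x - v y\<bar> powr p / norm (x - y) powr (N + p * s)
              / (norm x powr ((N - p * s) / 2) * norm y powr ((N - p * s) / 2))) \<partial>lebesgue \<partial>lebesgue)
    \<and> (p = 2 \<longrightarrow> c_p p = 1 \<and> gagliardo s p u =
         ennreal (hardy_const DIM('a) s p) * (\<integral>\<^sup>+ x. ennreal (\<bar>u x\<bar> powr p / norm x powr (p * s)) \<partial>lebesgue)
       + (\<integral>\<^sup>+ x. \<integral>\<^sup>+ y. ennreal (\<bar>v x - v y\<bar> powr p / norm (x - y) powr (N + p * s)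
              / (norm x powr ((N - p * s) / 2) * norm y powr ((N - p * s) / 2))) \<partial>lebesgue \<partial>lebesgue))"
proof -
  have H: "(\<integral>\<^sup>+ x. ennreal (\<bar>u x\<bar> powr p / norm x powr (p * s)) \<partial>lebesgue) = hardy_integral s p u"
    by (simp add: hardy_integral_def nn_integral_completion)
  \<comment> \<open>The two cases enter the rest of the argument only through the class T of Borel
    test functions with finite Hardy integral and through N \<noteq> ps, so they are treated
    together from here on.\<close>
  obtain T :: "('a \<Rightarrow> real) set" where uT: "u \<in> hom_frac_sobolev s p T" and pN: "p * s \<noteq> real DIM('a)"
    and T: "\<And>f. f \<in> T \<Longrightarrow> f \<in> borel_measurable borel \<and> hardy_integral s p f < \<infinity>"
    using u
  proof (elim disjE conjE)
    assume "p < N / s" "u \<in> hom_frac_sobolev s p Cc_infty"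
    then show ?thesis
      using s p that[of Cc_infty] Cc_infty_bounded_support hardy_integral_Cc_infty_finite[where p=p and s=s]
      by (simp add: N_def less_divide_eq) blast
  next
    assume "N / s < p" "u \<in> hom_frac_sobolev s p Cc_infty_punct"
    then show ?thesis
      using s p that[of Cc_infty_punct] Cc_infty_bounded_support hardy_integral_Cc_infty_punct_finite[where p=p and s=s]
      by (simp add: N_def divide_less_eq Cc_infty_punct_def) blast
  qed
  obtain \<phi> where \<phi>: "\<And>k. \<phi> k \<in> T" "AE x in lborel. (\<lambda>k. \<phi> k x) \<longlonglongrightarrow> u x"
      "(\<lambda>k. gagliardo s p (\<lambda>x. u x - \<phi> k x)) \<longlonglongrightarrow> 0" and "u \<in> borel_measurable lebesgue"
    using uT unfolding hom_frac_sobolev_def AE_completion_iff by auto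
  \<comment> \<open>u is only Lebesgue measurable, whereas the preceding lemmas assume Borel
    measurability. All three integrals are unchanged on passing to a Borel representative.\<close>
  then obtain u' where u': "u' \<in> borel_measurable borel" and AE: "AE x in lborel. u x = u' x"
    using completion_ex_borel_measurable_real[of u lborel] by auto
  have gag: "gagliardo s p u = gagliardo s p u'" by (rule gagliardo_cong_AE[OF AE])
  have energy: "ground_state_energy s p u = ground_state_energy s p u'" by (rule ground_state_energy_cong_AE[OF AE])
  have hardy: "hardy_integral s p u = hardy_integral s p u'"
    unfolding hardy_integral_def by (rule nn_integral_cong_AE, use AE in eventually_elim) simp
  have "AE x in lborel. (\<lambda>k. \<phi> k x) \<longlonglongrightarrow> u' x" using \<phi>(2) AE by eventually_elim simp
  moreover have "gagliardo s p (\<lambda>x. u' x - \<phi> k x) = gagliardo s p (\<lambda>x. u x - \<phi> k x)" for k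
    by (rule gagliardo_cong_AE, use AE in eventually_elim) simp
  then have "(\<lambda>k. gagliardo s p (\<lambda>x. u' x - \<phi> k x)) \<longlonglongrightarrow> 0" using \<phi>(3) by simp
  ultimately have fin: "hardy_integral s p u' < \<infinity>" if "gagliardo s p u' < \<infinity>"
    using hardy_integral_finite_limit[OF u' s p pN that, of \<phi>] T \<phi>(1) by blast
  note rep = ground_state_representation[OF u' s p pN]
  have "ennreal (hardy_const DIM('a) s p) * hardy_integral s p u + ennreal (c_p p) * ground_state_energy s p u \<le> gagliardo s p u"
  proof (cases "gagliardo s p u' < \<infinity>")
    case True
    then show ?thesis unfolding gag energy hardy by (intro rep(1) fin)
  next
    case False
    then have "gagliardo s p u' = \<infinity>" by (metis infinity_ennreal_def top.not_eq_extremum)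
    then show ?thesis unfolding gag by simp
  qed
  moreover have "gagliardo s p u = ennreal (hardy_const DIM('a) s p) * hardy_integral s p u + ground_state_energy s p u" if "p = 2"
  proof (cases "hardy_integral s p u' < \<infinity>")
    case True
    then show ?thesis unfolding gag energy hardy by (intro rep(2) that)
  next
    case False
    then have "gagliardo s p u' = \<infinity>" by (metis fin infinity_ennreal_def top.not_eq_extremum)
    \<comment> \<open>Both sides of the equality are infinite. Positivity of the constant is
      essential on the right, because 0 times \<infinity> is 0 in \<open>ennreal\<close>.\<close>
    moreover have "0 < ennreal (hardy_const DIM('a) s p)"
      using hardy_const_eq[OF s _ pN] hardy_mass_pos[OF _ pN] p by (simp add: ennreal_zero_less_mult_iff)
    moreover have "hardy_integral s p u' = \<infinity>" using False by (metis infinity_ennreal_def top.not_eq_extremum)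
    ultimately show ?thesis unfolding gag energy hardy by (simp add: ennreal_mult_eq_top_iff)
  qed
  moreover obtain \<sigma> where "\<sigma> \<in> {0<..<1/2}" "cp_fun p \<sigma> = c_p p" using c_p_attained[OF p] by blast
  ultimately show ?thesis
    using c_p_pos[OF p] c_p_le_one[OF p] c_p_two
    unfolding v_def N_def ground_state_energy_eq_lebesgue[symmetric] H by auto
qed

end
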